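(* Let $f:\Sigma\to\Gamma$ be a function between multiset types. Then $f$ is a first-order interpretation (with multiset types viewed as classes of structures) if and only if $f$ is derivable.
   Context: Multiset types are generated by $1$, $\Sigma+\Gamma$, $\Sigma\times\Gamma$, $\mathsf M\Sigma$ (finite multisets over $\Sigma$). Each multiset type is viewed as a class of finite relational structures, inductively: $1$ is the class containing the single one-element structure over the empty vocabulary. $\Sigma\times\Gamma$ has vocabulary $voc(\Sigma)+voc(\Gamma)$ plus a fresh unary relation $R$; its structures are obtained from $A\in\Sigma$, $B\in\Gamma$ by extending both to the joint vocabulary with the other relations empty, taking the disjoint union, and interpreting $R$ as the elements coming from $A$. $\Sigma+\Gamma$ has vocabulary $voc(\Sigma)+voc(\Gamma)$ plus a fresh nullary relation $R$; its structures are structures of $\Sigma$ (extended, $R$ true) or of $\Gamma$ (extended, $R$ false). $\mathsf M\Sigma$ has the vocabulary of $\Sigma$ with every nullary relation replaced by a unary one, plus a binary relation $\sim$; a structure is obtained from $A_1,\ldots,A_n\in\Sigma$ ($n\ge0$) by taking their disjoint union, replacing each nullary $R$ by the unary relation holding on all elements of those $A_i$ where $R$ is true, interpreting $\sim$ as the equivalence whose classes are the universes of the $A_i$, and adding one extra root element in no relation. Functions between multiset types are considered on values, i.e.\ on structures up to isomorphism. An (injective) first-order interpretation $f:\mathcal C\to\mathcal D$ is given by a finite set $I$ of components, each $i$ with dimension $k_i\ge0$ and FO formula $\varphi_i$ with $k_i$ free variables, the universe of $f(A)$ being $\coprod_{i\in I}\{\bar a\in A^{k_i}:A\models\varphi_i(\bar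 a)\}$, and for each $n$-ary output relation $R$ and components $i_1,\ldots,i_n$ an FO formula $\varphi$ with $k_{i_1}+\cdots+k_{i_n}$ free variables with $f(A)\models R((i_1,\bar a_1),\ldots,(i_n,\bar a_n))$ iff $A\models\varphi(\bar a_1\cdots\bar a_n)$. The derivable functions are the least class containing the prime functions $\mathit{union}:\mathsf M\mathsf M\Sigma\to\mathsf M\Sigma$; $\mathit{add}:\Sigma\times\mathsf M\Sigma\to\mathsf M\Sigma$; $\mathit{choices}:\mathsf M\Sigma\to\mathsf M(\Sigma\times\mathsf M\Sigma)$, $\{\!\{A_1,\ldots,A_n\}\!\}\mapsto\{\!\{(A_i,\{\!\{A_1,\ldots,A_n\}\!\}-\{\!\{A_i\}\!\}) : i=1..n\}\!\}$; $\mathit{de\text{-}singleton}:\mathsf M\Sigma\to1+\Sigma$ (singleton to its element, otherwise the element of $1$); $\mathit{empty}:1\to\mathsf M1$; identities; projections; coprojections; $\mathit{dist}:\Sigma\times(\Sigma_1+\Sigma_2)\to\Sigma\times\Sigma_1+\Sigma\times\Sigma_2$; and closed under pairing $\langle f_1,f_2\rangle$, co-pairing $[f_1,f_2]$, mapping $\mathsf Mf$ and composition. *)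

theory Defs
  imports "HOL-Library.Multiset" "HOL-Library.FuncSet"
begin

section \<open>Relational structures and first-order interpretations\<close>

text \<open>A vocabulary is a partial function assigning arities to the symbols that belong to it.
  A structure interprets a symbol by a set of lists; symbols outside the vocabulary are
  interpreted as empty, so that structures over a vocabulary have a unique representation.\<close>

type_synonym 's vocab = "'s \<Rightarrow> nat option"

record ('s, 'a) struct =
  univ :: "'a set"
  rel :: "'s \<Rightarrow> 'a list set"

definition struct_over :: "'s vocab \<Rightarrow> ('s, 'a) struct \<Rightarrow> bool" where
  "struct_over V A \<longleftrightarrow>
     (\<forall>R. \<forall>xs \<in> rel A R. V R = Some (length xs) \<and> xs \<in> lists (univ A))"

definition isomorphic :: "('s, 'a) struct \<Rightarrow> ('s, 'b) struct \<Rightarrow> bool" where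
  "isomorphic A B \<longleftrightarrow> (\<exists>h. bij_betw h (univ A) (univ B) \<and>
     (\<forall>R. \<forall>xs \<in> lists (univ A). xs \<in> rel A R \<longleftrightarrow> map h xs \<in> rel B R))"

datatype 's fo =
    FFalse
  | FRel 's "nat list"
  | FEq nat nat
  | FNot "'s fo"
  | FAnd "'s fo" "'s fo"
  | FEx nat "'s fo"

primrec sat :: "('s, 'a) struct \<Rightarrow> (nat \<Rightarrow> 'a) \<Rightarrow> 's fo \<Rightarrow> bool" where
  "sat A \<nu> FFalse \<longleftrightarrow> False"
| "sat A \<nu> (FRel R xs) \<longleftrightarrow> map \<nu> xs \<in> rel A R"
| "sat A \<nu> (FEq x y) \<longleftrightarrow> \<nu> x = \<nu> y"
| "sat A \<nu> (FNot \<phi>) \<longleftrightarrow> \<not> sat A \<nu> \<phi>"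
| "sat A \<nu> (FAnd \<phi> \<psi>) \<longleftrightarrow> sat A \<nu> \<phi> \<and> sat A \<nu> \<psi>"
| "sat A \<nu> (FEx x \<phi>) \<longleftrightarrow> (\<exists>a \<in> univ A. sat A (\<nu>(x := a)) \<phi>)"

primrec free_vars :: "'s fo \<Rightarrow> nat set" where
  "free_vars FFalse = {}"
| "free_vars (FRel R xs) = set xs"
| "free_vars (FEq x y) = {x, y}"
| "free_vars (FNot \<phi>) = free_vars \<phi>"
| "free_vars (FAnd \<phi> \<psi>) = free_vars \<phi> \<union> free_vars \<psi>"
| "free_vars (FEx x \<phi>) = free_vars \<phi> - {x}"

primrec fo_over :: "'s vocab \<Rightarrow> 's fo \<Rightarrow> bool" where
  "fo_over V FFalse \<longleftrightarrow> True"
| "fo_over V (FRel R xs) \<longleftrightarrow> V R = Some (length xs)"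
| "fo_over V (FEq x y) \<longleftrightarrow> True"
| "fo_over V (FNot \<phi>) \<longleftrightarrow> fo_over V \<phi>"
| "fo_over V (FAnd \<phi> \<psi>) \<longleftrightarrow> fo_over V \<phi> \<and> fo_over V \<psi>"
| "fo_over V (FEx x \<phi>) \<longleftrightarrow> fo_over V \<phi>"

text \<open>A formula with \<open>k\<close> free variables has its free variables among \<open>0, \<dots>, k - 1\<close>;
  satisfaction by a tuple of length \<open>k\<close> assigns to variable \<open>j\<close> the \<open>j\<close>-th entry.\<close>

definition formula_in :: "'s vocab \<Rightarrow> nat \<Rightarrow> 's fo \<Rightarrow> bool" where
  "formula_in V k \<phi> \<longleftrightarrow> fo_over V \<phi> \<and> free_vars \<phi> \<subseteq> {..<k}"

definition sat_tuple :: "('s, 'a) struct \<Rightarrow> 'a list \<Rightarrow> 's fo \<Rightarrow> bool" where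
  "sat_tuple A as \<phi> \<longleftrightarrow> sat A (\<lambda>j. as ! j) \<phi>"

record ('s, 't) interp =
  comps :: "nat set"
  dim :: "nat \<Rightarrow> nat"
  ufml :: "nat \<Rightarrow> 's fo"
  rfml :: "'t \<Rightarrow> nat list \<Rightarrow> 's fo"

definition interp_over :: "'s vocab \<Rightarrow> 't vocab \<Rightarrow> ('s, 't) interp \<Rightarrow> bool" where
  "interp_over V W J \<longleftrightarrow>
     finite (comps J) \<and>
     (\<forall>i \<in> comps J. formula_in V (dim J i) (ufml J i)) \<and>
     (\<forall>R n is. W R = Some n \<longrightarrow> is \<in> lists (comps J) \<longrightarrow> length is = n \<longrightarrow>
        formula_in V (sum_list (map (dim J) is)) (rfml J R is))"

definition interp_univ :: "('s, 't) interp \<Rightarrow> ('s, 'a) struct \<Rightarrow> (nat \<times> 'a list) set" where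
  "interp_univ J A =
     {(i, as). i \<in> comps J \<and> as \<in> lists (univ A) \<and> length as = dim J i \<and> sat_tuple A as (ufml J i)}"

definition apply_interp ::
    "'t vocab \<Rightarrow> ('s, 't) interp \<Rightarrow> ('s, 'a) struct \<Rightarrow> ('t, nat \<times> 'a list) struct" where
  "apply_interp W J A =
     \<lparr>univ = interp_univ J A,
      rel = (\<lambda>R. {xs \<in> lists (interp_univ J A).
                   W R = Some (length xs) \<and>
                   sat_tuple A (concat (map snd xs)) (rfml J R (map fst xs))})\<rparr>"


section \<open>Multiset types\<close>

datatype mty = TOne | TSum mty mty | TProd mty mty | TMul mty

datatype val =
    VUnit
  | VInl val
  | VInr val
  | VPair (vfst: val) (vsnd: val)
  | VMul (elems: "val multiset")

primrec vals :: "mty \<Rightarrow> val set" where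
  "vals TOne = {VUnit}"
| "vals (TSum s t) = VInl ` vals s \<union> VInr ` vals t"
| "vals (TProd s t) = {VPair v w | v w. v \<in> vals s \<and> w \<in> vals t}"
| "vals (TMul s) = {VMul M | M. set_mset M \<subseteq> vals s}"

text \<open>\<open>Fresh\<close> is the symbol added by the outermost type constructor: the unary relation of a
  product, the nullary relation of a sum, the equivalence \<open>\<sim>\<close> of a multiset type.\<close>

datatype sym = Fresh | SymL sym | SymR sym

primrec voc :: "mty \<Rightarrow> sym vocab" where
  "voc TOne = (\<lambda>_. None)"
| "voc (TSum s t) = case_sym (Some 0) (voc s) (voc t)"
| "voc (TProd s t) = case_sym (Some 1) (voc s) (voc t)"
| "voc (TMul s) =
     case_sym (Some 2) (\<lambda>R. if voc s R = Some 0 then Some 1 else voc s R) (\<lambda>_. None)"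

definition inl_struct :: "(sym, 'a) struct \<Rightarrow> (sym, 'a) struct" where
  "inl_struct A = \<lparr>univ = univ A, rel = case_sym {[]} (rel A) (\<lambda>_. {})\<rparr>"

definition inr_struct :: "(sym, 'a) struct \<Rightarrow> (sym, 'a) struct" where
  "inr_struct B = \<lparr>univ = univ B, rel = case_sym {} (\<lambda>_. {}) (rel B)\<rparr>"

definition prod_struct :: "(sym, 'a) struct \<Rightarrow> (sym, 'a) struct \<Rightarrow> (sym, 'a) struct" where
  "prod_struct A B =
     \<lparr>univ = univ A \<union> univ B, rel = case_sym {[a] | a. a \<in> univ A} (rel A) (rel B)\<rparr>"

text \<open>Here \<open>V\<close> is the vocabulary of the structures in \<open>As\<close>, and \<open>r\<close> is the extra root element.\<close>

definition mul_struct ::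
    "sym vocab \<Rightarrow> 'a \<Rightarrow> (sym, 'a) struct list \<Rightarrow> (sym, 'a) struct" where
  "mul_struct V r As =
     \<lparr>univ = insert r (\<Union>A \<in> set As. univ A),
      rel = case_sym
        {[a, b] | a b. \<exists>A \<in> set As. a \<in> univ A \<and> b \<in> univ A}
        (\<lambda>R. if V R = Some 0 then {[a] | a. \<exists>A \<in> set As. a \<in> univ A \<and> [] \<in> rel A R}
              else (\<Union>A \<in> set As. rel A R))
        (\<lambda>_. {})\<rparr>"

text \<open>\<open>represents s v A\<close>: the structure \<open>A\<close> belongs to the class of the type \<open>s\<close>, and is built
  in the way described by the value \<open>v\<close>. Disjoint unions are taken internally, as unions of
  structures with disjoint universes inside one carrier type \<open>'a\<close>; thus over an infinite
  carrier type the class is closed under isomorphism. The last section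
  shows that the values of \<open>s\<close> are the same thing as structures of \<open>s\<close> up to isomorphism
  (\<open>represents_exists\<close>, \<open>represents_eq_iff_isomorphic\<close>, \<open>represents_isomorphic\<close>).\<close>

inductive represents :: "mty \<Rightarrow> val \<Rightarrow> (sym, 'a) struct \<Rightarrow> bool" where
  represents_One: "represents TOne VUnit \<lparr>univ = {a}, rel = (\<lambda>_. {})\<rparr>"
| represents_Inl: "represents s v A \<Longrightarrow> represents (TSum s t) (VInl v) (inl_struct A)"
| represents_Inr: "represents t w B \<Longrightarrow> represents (TSum s t) (VInr w) (inr_struct B)"
| represents_Pair:
    "\<lbrakk>represents s v A; represents t w B; univ A \<inter> univ B = {}\<rbrakk>
      \<Longrightarrow> represents (TProd s t) (VPair v w) (prod_struct A B)"
| represents_Mul: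
    "\<lbrakk>list_all2 (represents s) vs As;
      \<And>i j. i < j \<Longrightarrow> j < length As \<Longrightarrow> univ (As ! i) \<inter> univ (As ! j) = {};
      \<And>A. A \<in> set As \<Longrightarrow> r \<notin> univ A\<rbrakk>
      \<Longrightarrow> represents (TMul s) (VMul (mset vs)) (mul_struct (voc s) r As)"

section \<open>Functions between multiset types\<close>

text \<open>A function from \<open>s\<close> to \<open>t\<close> is an element of \<open>vals s \<rightarrow>\<^sub>E vals t\<close>, so that functions are
  equal iff they agree on the values of \<open>s\<close>.\<close>

text \<open>The requirement on the interpretation ranges over the structures with universe contained in
  \<open>nat\<close>; every finite structure is isomorphic to one of these.\<close>

definition fo_interpretation :: "mty \<Rightarrow> mty \<Rightarrow> (val \<Rightarrow> val) \<Rightarrow> bool" where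
  "fo_interpretation s t f \<longleftrightarrow> f \<in> vals s \<rightarrow>\<^sub>E vals t \<and>
     (\<exists>J. interp_over (voc s) (voc t) J \<and>
        (\<forall>v \<in> vals s. \<forall>A :: (sym, nat) struct. represents s v A \<longrightarrow>
           represents t (f v) (apply_interp (voc t) J A)))"

definition union_fn :: "val \<Rightarrow> val" where
  "union_fn v = VMul (\<Sum>\<^sub># (image_mset elems (elems v)))"

definition add_fn :: "val \<Rightarrow> val" where
  "add_fn v = VMul (add_mset (vfst v) (elems (vsnd v)))"

definition choices_fn :: "val \<Rightarrow> val" where
  "choices_fn v = VMul {# VPair a (VMul (elems v - {#a#})). a \<in># elems v #}"

definition de_singleton_fn :: "val \<Rightarrow> val" where
  "de_singleton_fn v = (if \<exists>a. v = VMul {#a#} then VInr (THE a. v = VMul {#a#}) else VInl VUnit)"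

definition empty_fn :: "val \<Rightarrow> val" where
  "empty_fn v = VMul {#}"

fun dist_fn :: "val \<Rightarrow> val" where
  "dist_fn (VPair v (VInl w)) = VInl (VPair v w)"
| "dist_fn (VPair v (VInr w)) = VInr (VPair v w)"
| "dist_fn _ = undefined"

fun copair_fn :: "(val \<Rightarrow> val) \<Rightarrow> (val \<Rightarrow> val) \<Rightarrow> val \<Rightarrow> val" where
  "copair_fn f g (VInl v) = f v"
| "copair_fn f g (VInr v) = g v"
| "copair_fn f g _ = undefined"

definition map_fn :: "(val \<Rightarrow> val) \<Rightarrow> val \<Rightarrow> val" where
  "map_fn f v = VMul (image_mset f (elems v))"

inductive derivable :: "mty \<Rightarrow> mty \<Rightarrow> (val \<Rightarrow> val) \<Rightarrow> bool" where
  derivable_union: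
    "derivable (TMul (TMul s)) (TMul s) (restrict union_fn (vals (TMul (TMul s))))"
| derivable_add:
    "derivable (TProd s (TMul s)) (TMul s) (restrict add_fn (vals (TProd s (TMul s))))"
| derivable_choices:
    "derivable (TMul s) (TMul (TProd s (TMul s))) (restrict choices_fn (vals (TMul s)))"
| derivable_de_singleton:
    "derivable (TMul s) (TSum TOne s) (restrict de_singleton_fn (vals (TMul s)))"
| derivable_empty:
    "derivable TOne (TMul TOne) (restrict empty_fn (vals TOne))"
| derivable_id:
    "derivable s s (restrict id (vals s))"
| derivable_fst:
    "derivable (TProd s t) s (restrict vfst (vals (TProd s t)))"
| derivable_snd:
    "derivable (TProd s t) t (restrict vsnd (vals (TProd s t)))"
| derivable_inl:
    "derivable s (TSum s t) (restrict VInl (vals s))"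
| derivable_inr:
    "derivable t (TSum s t) (restrict VInr (vals t))"
| derivable_dist:
    "derivable (TProd s (TSum t u)) (TSum (TProd s t) (TProd s u))
       (restrict dist_fn (vals (TProd s (TSum t u))))"
| derivable_pair:
    "\<lbrakk>derivable s t f; derivable s u g\<rbrakk>
      \<Longrightarrow> derivable s (TProd t u) (\<lambda>v \<in> vals s. VPair (f v) (g v))"
| derivable_copair:
    "\<lbrakk>derivable s u f; derivable t u g\<rbrakk>
      \<Longrightarrow> derivable (TSum s t) u (restrict (copair_fn f g) (vals (TSum s t)))"
| derivable_map:
    "derivable s t f \<Longrightarrow> derivable (TMul s) (TMul t) (restrict (map_fn f) (vals (TMul s)))"
| derivable_compose:
    "\<lbrakk>derivable s t f; derivable t u g\<rbrakk> \<Longrightarrow> derivable s u (compose (vals s) g f)"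

theorem derivable_vals: "derivable s t f \<Longrightarrow> f \<in> vals s \<rightarrow>\<^sub>E vals t"
proof (induction rule: derivable.induct)
  case (derivable_compose s t f u g)
  then show ?case by (auto simp: compose_def PiE_iff Pi_iff extensional_def)
next
  case (derivable_choices s)
  then show ?case by (fastforce simp: choices_fn_def restrict_PiE_iff dest: in_diffD)
next
  case (derivable_map s t f)
  then show ?case by (fastforce simp: map_fn_def restrict_PiE_iff PiE_iff)
next
  case (derivable_pair s t f u g)
  then show ?case by (subst restrict_PiE_iff) (auto simp: PiE_iff)
next
  case (derivable_copair s u f t g)
  then show ?case by (subst restrict_PiE_iff) (auto simp: PiE_iff)
qed (fastforce simp: union_fn_def add_fn_def de_singleton_fn_def empty_fn_def restrict_PiE_iff)+


section \<open>Values are structures up to isomorphism\<close>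

lemma represents_wf:
  assumes "represents s v A"
  shows "finite (univ A) \<and> univ A \<noteq> {} \<and> struct_over (voc s) A \<and> v \<in> vals s"
  using assms
proof induction
  case (represents_One a)
  then show ?case by (simp add: struct_over_def)
next
  case (represents_Inl s v A t)
  then show ?case
    by (auto simp: struct_over_def inl_struct_def split: sym.split)
next
  case (represents_Inr s v A t)
  then show ?case
    by (auto simp: struct_over_def inr_struct_def split: sym.split)
next
  case (represents_Pair s v A t w B)
  then show ?case
    by (fastforce simp: struct_over_def prod_struct_def split: sym.split option.splits)
next
  case (represents_Mul s vs As r)
  have 1: "set vs \<subseteq> vals s"
    using represents_Mul.IH(1) by (fastforce simp: list_all2_conv_all_nth set_conv_nth)
  have *: "finite (univ A) \<and> univ A \<noteq> {} \<and> struct_over (voc s) A" if "A \<in> set As" for A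
    using represents_Mul.IH(1) that by (fastforce simp: list_all2_conv_all_nth set_conv_nth)
  have "\<forall>xs \<in> rel A R. voc s R = Some (length xs) \<and> xs \<in> lists (univ A)"
    if "A \<in> set As" for A R
    using *[OF that] unfolding struct_over_def by blast
  then have 2: "struct_over (voc (TMul s)) (mul_struct (voc s) r As)"
    by (fastforce simp: struct_over_def mul_struct_def split: sym.split option.splits)
  show ?case using 1 2 * by (auto simp: mul_struct_def)
qed

definition map_struct :: "('a \<Rightarrow> 'b) \<Rightarrow> ('s, 'a) struct \<Rightarrow> ('s, 'b) struct" where
  "map_struct h A = \<lparr>univ = h ` univ A, rel = (\<lambda>R. map h ` rel A R)\<rparr>"

lemma singles: "{[a] | a. a \<in> U} = (\<lambda>a. [a]) ` U"
  by blast

lemma blocks_pairs: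
  "{[a, b] | a b. \<exists>A \<in> X. a \<in> univ A \<and> b \<in> univ A} = (\<Union>A\<in>X. \<Union>a\<in>univ A. (\<lambda>b. [a, b]) ` univ A)"
  by blast

lemma blocks_singles:
  "{[a] | a. \<exists>A \<in> X. a \<in> univ A \<and> [] \<in> rel A S} = (\<Union>A\<in>{A\<in>X. [] \<in> rel A S}. (\<lambda>a. [a]) ` univ A)"
  by blast

lemma map_mul_struct:
  "map_struct h (mul_struct V r As) = mul_struct V (h r) (map (map_struct h) As)"
proof -
  have "map h ` rel (mul_struct V r As) R = rel (mul_struct V (h r) (map (map_struct h) As)) R" for R
  proof (cases R)
    case Fresh
    then show ?thesis
      by (simp add: mul_struct_def map_struct_def blocks_pairs image_UN image_image) blast
  next
    case (SymL S)
    then show ?thesis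
      by (auto simp: mul_struct_def map_struct_def blocks_singles image_UN image_image)
  qed (simp add: mul_struct_def)
  then show ?thesis
    by (intro struct.equality) (auto simp: map_struct_def mul_struct_def)
qed

lemma represents_map_struct:
  assumes "represents s v A" "inj_on h (univ A)"
  shows "represents s v (map_struct h A)"
  using assms
proof induction
  case (represents_One a)
  have "map_struct h \<lparr>univ = {a}, rel = (\<lambda>_::sym. {})\<rparr> = \<lparr>univ = {h a}, rel = (\<lambda>_. {})\<rparr>"
    by (simp add: map_struct_def)
  then show ?case using represents.represents_One[of "h a"] by simp
next
  case (represents_Inl s v A t)
  have "map_struct h (inl_struct A) = inl_struct (map_struct h A)"
    by (auto simp: map_struct_def inl_struct_def fun_eq_iff split: sym.split)
  with represents_Inl show ?case by (metis inl_struct_def represents.represents_Inl struct.select_convs(1))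
next
  case (represents_Inr t v A s)
  have "map_struct h (inr_struct A) = inr_struct (map_struct h A)"
    by (auto simp: map_struct_def inr_struct_def fun_eq_iff split: sym.split)
  with represents_Inr show ?case by (metis inr_struct_def represents.represents_Inr struct.select_convs(1))
next
  case (represents_Pair s v A t w B)
  have "map_struct h (prod_struct A B) = prod_struct (map_struct h A) (map_struct h B)"
    unfolding map_struct_def prod_struct_def singles
    by (auto simp: fun_eq_iff image_Un image_image split: sym.split)
  moreover have "univ (map_struct h A) \<inter> univ (map_struct h B) = {}"
    using represents_Pair.hyps represents_Pair.prems
    by (auto simp: map_struct_def prod_struct_def inj_on_def)
  moreover have "inj_on h (univ A)" "inj_on h (univ B)"
    using represents_Pair.prems by (auto simp: prod_struct_def inj_on_Un)
  ultimately show ?case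
    using represents_Pair by (simp add: represents.represents_Pair)
next
  case (represents_Mul s vs As r)
  have inj: "inj_on h (insert r (\<Union>A \<in> set As. univ A))"
    using represents_Mul.prems by (simp add: mul_struct_def)
  have eq: "map_struct h (mul_struct (voc s) r As) = mul_struct (voc s) (h r) (map (map_struct h) As)"
    by (rule map_mul_struct)
  have "list_all2 (represents s) vs (map (map_struct h) As)"
  proof -
    have "inj_on h (univ (As ! i))" if "i < length As" for i
      by (rule inj_on_subset[OF inj]) (use that in auto)
    then show ?thesis using represents_Mul.IH unfolding list_all2_conv_all_nth by simp
  qed
  moreover have "univ (map (map_struct h) As ! i) \<inter> univ (map (map_struct h) As ! j) = {}"
    if "i < j" "j < length (map (map_struct h) As)" for i j
  proof -
    have "univ (As ! i) \<subseteq> (\<Union>A \<in> set As. univ A)" "univ (As ! j) \<subseteq> (\<Union>A \<in> set As. univ A)"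
      using that by (auto intro!: bexI[OF _ nth_mem])
    then have "h ` univ (As ! i) \<inter> h ` univ (As ! j) = h ` (univ (As ! i) \<inter> univ (As ! j))"
      using inj by (subst inj_on_image_Int[OF inj]) auto
    then show ?thesis using represents_Mul.hyps(1)[of i j] that by (simp add: map_struct_def)
  qed
  moreover have "h r \<notin> univ A" if A: "A \<in> set (map (map_struct h) As)" for A
    using A inj represents_Mul.hyps(2) by (fastforce simp: map_struct_def inj_on_def)
  ultimately show ?case
    unfolding eq by (rule represents.represents_Mul)
qed

lemma isomorphic_map_struct:
  assumes "struct_over V A" "struct_over V B" "isomorphic A B"
  shows "\<exists>h. inj_on h (univ A) \<and> B = map_struct h A"
proof -
  obtain h where h: "bij_betw h (univ A) (univ B)"
    "\<And>R xs. xs \<in> lists (univ A) \<Longrightarrow> xs \<in> rel A R \<longleftrightarrow> map h xs \<in> rel B R"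
    using assms(3) unfolding isomorphic_def by blast
  have A: "rel A R \<subseteq> lists (univ A)" for R
    using assms(1) unfolding struct_over_def by blast
  have B: "rel B R \<subseteq> lists (univ B)" for R
    using assms(2) unfolding struct_over_def by blast
  have im: "h ` univ A = univ B" using h(1) by (simp add: bij_betw_def)
  have "rel B R = map h ` rel A R" for R
  proof
    show "map h ` rel A R \<subseteq> rel B R" using A h(2) by blast
    show "rel B R \<subseteq> map h ` rel A R"
    proof
      fix ys assume y: "ys \<in> rel B R"
      then have "ys \<in> lists (h ` univ A)" using B im by blast
      then obtain xs where xs: "xs \<in> lists (univ A)" "ys = map h xs"
        by (auto simp: lists_image)
      then show "ys \<in> map h ` rel A R" using h(2) y by blast
    qed
  qed
  then have "B = map_struct h A" by (intro struct.equality) (auto simp: map_struct_def im)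
  then show ?thesis using h(1) by (auto simp: bij_betw_def)
qed

lemma map_struct_isomorphic:
  assumes "struct_over V A" "inj_on h (univ A)"
  shows "isomorphic A (map_struct h A)"
proof -
  have A: "rel A R \<subseteq> lists (univ A)" for R
    using assms(1) unfolding struct_over_def by blast
  have inj: "inj_on (map h) (lists (univ A))" using assms(2) by (rule inj_on_map_lists)
  show ?thesis unfolding isomorphic_def
    using assms(2) A inj by (intro exI[of _ h]) (auto simp: map_struct_def bij_betw_def inj_on_image_mem_iff[OF inj])
qed

inductive_cases represents_OneE: "represents TOne v A"
inductive_cases represents_SumE: "represents (TSum s t) v A"
inductive_cases represents_ProdE: "represents (TProd s t) v A"
inductive_cases represents_MulE: "represents (TMul s) v A"


lemma list_disjoint_iff:
  assumes "list_all2 (represents s) vs As"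
  shows "(\<forall>i j. i < j \<longrightarrow> j < length As \<longrightarrow> univ (As ! i) \<inter> univ (As ! j) = {}) \<longleftrightarrow>
    distinct As \<and> (\<forall>A \<in> set As. \<forall>B \<in> set As. A \<noteq> B \<longrightarrow> univ A \<inter> univ B = {})" (is "?L \<longleftrightarrow> ?R")
proof
  assume L: ?L
  have ne: "univ A \<noteq> {}" if "A \<in> set As" for A
    using assms that represents_wf by (fastforce simp: list_all2_conv_all_nth in_set_conv_nth)
  have L': "univ (As ! i) \<inter> univ (As ! j) = {}" if "i \<noteq> j" "i < length As" "j < length As" for i j
    using L that by (metis Int_commute linorder_neqE_nat)
  have "distinct As" unfolding distinct_conv_nth using L' ne by (metis inf.idem nth_mem)
  moreover have "univ A \<inter> univ B = {}" if "A \<in> set As" "B \<in> set As" "A \<noteq> B" for A B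
    using that L' by (metis in_set_conv_nth)
  ultimately show ?R by blast
next
  assume ?R then show ?L
    by (metis distinct_conv_nth less_trans nat_neq_iff nth_mem)
qed

definition block :: "sym vocab \<Rightarrow> (sym, 'a) struct \<Rightarrow> 'a \<Rightarrow> (sym, 'a) struct" where
  "block V M a = \<lparr>univ = {b. [a, b] \<in> rel M Fresh},
     rel = (\<lambda>R. if V R = Some 0 then {xs. xs = [] \<and> [a] \<in> rel M (SymL R)}
                else {xs \<in> rel M (SymL R). xs \<in> lists {b. [a, b] \<in> rel M Fresh}})\<rparr>"

lemma block_mul_struct:
  assumes A: "A \<in> set As" "a \<in> univ A"
    and disj: "\<And>B. B \<in> set As \<Longrightarrow> B \<noteq> A \<Longrightarrow> univ B \<inter> univ A = {}"
    and wf: "\<And>B. B \<in> set As \<Longrightarrow> struct_over V B"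
  shows "block V (mul_struct V r As) a = A"
proof -
  have u: "{b. [a, b] \<in> rel (mul_struct V r As) Fresh} = univ A"
    using A disj by (fastforce simp: mul_struct_def)
  have wf': "V R = Some (length xs) \<and> xs \<in> lists (univ B)" if "B \<in> set As" "xs \<in> rel B R" for B R xs
    using wf that unfolding struct_over_def by blast
  have null: "rel A R = {xs. xs = [] \<and> [a] \<in> rel (mul_struct V r As) (SymL R)}" if R: "V R = Some 0" for R
  proof -
    have "[a] \<in> rel (mul_struct V r As) (SymL R) \<longleftrightarrow> [] \<in> rel A R"
      using A disj R by (fastforce simp: mul_struct_def)
    then show ?thesis using wf'[OF A(1)] R by force
  qed
  have nonnull: "rel A R = {xs \<in> rel (mul_struct V r As) (SymL R). xs \<in> lists (univ A)}"
    if R: "V R \<noteq> Some 0" for R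
  proof -
    have "xs \<in> rel A R" if xs: "B \<in> set As" "xs \<in> rel B R" "xs \<in> lists (univ A)" for B xs
    proof (cases "B = A")
      case False
      have "xs \<noteq> []" using wf'[OF xs(1,2)] R by auto
      then obtain y ys where "xs = y # ys" by (cases xs) auto
      then show ?thesis using False wf'[OF xs(1,2)] xs disj by auto
    qed (use xs in simp)
    moreover have "xs \<in> rel (mul_struct V r As) (SymL R) \<longleftrightarrow> (\<exists>B \<in> set As. xs \<in> rel B R)" for xs
      using R by (simp add: mul_struct_def)
    ultimately show ?thesis using A(1) wf'[OF A(1)] by blast
  qed
  have "rel (block V (mul_struct V r As) a) R = rel A R" for R
  proof (cases "V R = Some 0")
    case True
    then show ?thesis using null[OF True] by (simp add: block_def)
  next
    case False
    have "rel (block V (mul_struct V r As) a) R = {xs \<in> rel (mul_struct V r As) (SymL R). xs \<in> lists (univ A)}"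
      using False by (simp only: block_def u struct.simps if_False)
    also have "\<dots> = rel A R" by (rule nonnull[OF False, symmetric])
    finally show ?thesis .
  qed
  then show ?thesis by (intro struct.equality) (auto simp: block_def u)
qed

lemma represents_unique_val:
  "represents s v A \<Longrightarrow> represents s w A \<Longrightarrow> v = w"
proof (induction s arbitrary: v w A)
  case TOne
  then show ?case by (auto elim!: represents_OneE)
next
  case (TSum s t)
  have inl: "A = B" if "inl_struct A = inl_struct B" for A B :: "(sym, 'a) struct"
  proof -
    have "rel A R = rel B R" for R
      using arg_cong[OF that, of "\<lambda>A. rel A (SymL R)"] by (simp add: inl_struct_def)
    then show ?thesis using that by (intro struct.equality) (auto simp: inl_struct_def)
  qed
  have inr: "A = B" if "inr_struct A = inr_struct B" for A B :: "(sym, 'a) struct"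
  proof -
    have "rel A R = rel B R" for R
      using arg_cong[OF that, of "\<lambda>A. rel A (SymR R)"] by (simp add: inr_struct_def)
    then show ?thesis using that by (intro struct.equality) (auto simp: inr_struct_def)
  qed
  have ne: "inl_struct A \<noteq> inr_struct B" for A B :: "(sym, 'a) struct"
    by (rule notI, drule arg_cong[of _ _ "\<lambda>A. rel A Fresh"]) (simp add: inl_struct_def inr_struct_def)
  from TSum show ?case
    by (elim represents_SumE) (use inl inr ne in metis)+
next
  case (TProd s t)
  from TProd.prems obtain v1 v2 A1 A2 w1 w2 B1 B2 where *:
    "v = VPair v1 v2" "A = prod_struct A1 A2" "represents s v1 A1" "represents t v2 A2" "univ A1 \<inter> univ A2 = {}"
    "w = VPair w1 w2" "A = prod_struct B1 B2" "represents s w1 B1" "represents t w2 B2" "univ B1 \<inter> univ B2 = {}"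
    by (elim represents_ProdE) metis
  have eq: "prod_struct A1 A2 = prod_struct B1 B2" using * by simp
  have r: "rel (prod_struct A1 A2) R = rel (prod_struct B1 B2) R" for R using eq by simp
  have u: "univ (prod_struct A1 A2) = univ (prod_struct B1 B2)" using eq by simp
  have u1: "univ A1 = univ B1" using r[of Fresh] by (auto simp: prod_struct_def)
  have u2: "univ A2 = univ B2" using u u1 * by (auto simp: prod_struct_def)
  have "A1 = B1" using r[of "SymL _"] u1 by (intro struct.equality) (auto simp: prod_struct_def)
  moreover have "A2 = B2" using r[of "SymR _"] u2 by (intro struct.equality) (auto simp: prod_struct_def)
  ultimately show ?case using * TProd.IH by blast
next
  case (TMul s)
  from TMul.prems(1) obtain vs As r where 1: "v = VMul (mset vs)" "A = mul_struct (voc s) r As"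
    "list_all2 (represents s) vs As"
    "\<forall>i j. i < j \<longrightarrow> j < length As \<longrightarrow> univ (As ! i) \<inter> univ (As ! j) = {}"
    by (elim represents_MulE) blast
  from TMul.prems(2) obtain ws Bs q where 2: "w = VMul (mset ws)" "A = mul_struct (voc s) q Bs"
    "list_all2 (represents s) ws Bs"
    "\<forall>i j. i < j \<longrightarrow> j < length Bs \<longrightarrow> univ (Bs ! i) \<inter> univ (Bs ! j) = {}"
    by (elim represents_MulE) blast
  note 1 = 1(1-3) iffD1[OF list_disjoint_iff[OF 1(3)] 1(4)]
  note 2 = 2(1-3) iffD1[OF list_disjoint_iff[OF 2(3)] 2(4)]
  have sub: "set Xs \<subseteq> set Ys"
    if X: "A = mul_struct (voc s) r Xs" "list_all2 (represents s) vs Xs"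
      "\<forall>A \<in> set Xs. \<forall>B \<in> set Xs. A \<noteq> B \<longrightarrow> univ A \<inter> univ B = {}"
    and Y: "A = mul_struct (voc s) q Ys" "list_all2 (represents s) ws Ys"
      "\<forall>A \<in> set Ys. \<forall>B \<in> set Ys. A \<noteq> B \<longrightarrow> univ A \<inter> univ B = {}" for Xs Ys vs ws r q
  proof
    fix X assume X': "X \<in> set Xs"
    have wfX: "struct_over (voc s) B \<and> univ B \<noteq> {}" if "B \<in> set Xs" for B
      using X(2) that represents_wf by (fastforce simp: list_all2_conv_all_nth in_set_conv_nth)
    have wfY: "struct_over (voc s) B \<and> univ B \<noteq> {}" if "B \<in> set Ys" for B
      using Y(2) that represents_wf by (fastforce simp: list_all2_conv_all_nth in_set_conv_nth)
    obtain a where a: "a \<in> univ X" using wfX X' by blast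
    have "[a, a] \<in> rel A Fresh" using X' a by (auto simp: X(1) mul_struct_def)
    then obtain Y0 where Y0: "Y0 \<in> set Ys" "a \<in> univ Y0" by (auto simp: Y(1) mul_struct_def)
    have "block (voc s) A a = X" unfolding X(1)
      by (rule block_mul_struct) (use X' a X(3) wfX in auto)
    moreover have "block (voc s) A a = Y0" unfolding Y(1)
      by (rule block_mul_struct) (use Y0 Y(3) wfY in auto)
    ultimately show "X \<in> set Ys" using Y0 by simp
  qed
  have "set As = set Bs" using sub[of r As vs q Bs ws] sub[of q Bs ws r As vs] 1 2 by blast
  then have "mset As = mset Bs" using 1 2 by (simp add: set_eq_iff_mset_eq_distinct)
  moreover have "mset vs = image_mset (\<lambda>A. THE v. represents s v A) (mset As)"
    if "list_all2 (represents s) vs As" for vs and As :: "(sym, 'a) struct list"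
  proof -
    have "vs = map (\<lambda>A. THE v. represents s v A) As"
      using that TMul.IH by (intro nth_equalityI) (auto simp: list_all2_conv_all_nth intro!: the_equality[symmetric])
    then show ?thesis by (metis mset_map)
  qed
  ultimately show ?case using 1 2 by metis
qed

lemma represents_map_structE:
  "represents s v A \<Longrightarrow> represents s v B \<Longrightarrow> \<exists>h. inj_on h (univ A) \<and> B = map_struct h A"
proof (induction arbitrary: B rule: represents.induct)
  case (represents_One a)
  then obtain b where "B = \<lparr>univ = {b}, rel = (\<lambda>_. {})\<rparr>" by (auto elim: represents_OneE)
  then show ?case by (intro exI[of _ "\<lambda>_. b"]) (auto simp: map_struct_def)
next
  case (represents_Inl s v A t)
  then obtain B' where B': "B = inl_struct B'" "represents s v B'" by (auto elim: represents_SumE)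
  then obtain h where "inj_on h (univ A)" "B' = map_struct h A" using represents_Inl by blast
  then show ?case using B'
    by (intro exI[of _ h]) (auto simp: map_struct_def inl_struct_def fun_eq_iff split: sym.split)
next
  case (represents_Inr s v A t)
  then obtain B' where B': "B = inr_struct B'" "represents s v B'" by (auto elim: represents_SumE)
  then obtain h where "inj_on h (univ A)" "B' = map_struct h A" using represents_Inr by blast
  then show ?case using B'
    by (intro exI[of _ h]) (auto simp: map_struct_def inr_struct_def fun_eq_iff split: sym.split)
next
  case (represents_Pair s v A1 t w A2)
  then obtain B1 B2 where B: "B = prod_struct B1 B2" "represents s v B1" "represents t w B2"
    "univ B1 \<inter> univ B2 = {}" by (auto elim: represents_ProdE)
  obtain h1 where h1: "inj_on h1 (univ A1)" "B1 = map_struct h1 A1" using represents_Pair B by blast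
  obtain h2 where h2: "inj_on h2 (univ A2)" "B2 = map_struct h2 A2" using represents_Pair B by blast
  define h where "h = (\<lambda>x. if x \<in> univ A1 then h1 x else h2 x)"
  have e1: "h x = h1 x" if "x \<in> univ A1" for x using that by (simp add: h_def)
  have e2: "h x = h2 x" if "x \<in> univ A2" for x
    using that represents_Pair.hyps by (auto simp: h_def)
  have l1: "map h xs = map h1 xs" if "xs \<in> rel A1 R" for xs R
    using represents_wf[OF represents_Pair.hyps(1)] that e1 unfolding struct_over_def by auto
  have l2: "map h xs = map h2 xs" if "xs \<in> rel A2 R" for xs R
    using represents_wf[OF represents_Pair.hyps(2)] that e2 unfolding struct_over_def by auto
  have i1: "map h ` rel A1 R = map h1 ` rel A1 R" for R using l1 by (intro image_cong) auto
  have i2: "map h ` rel A2 R = map h2 ` rel A2 R" for R using l2 by (intro image_cong) auto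
  have u1: "h ` univ A1 = h1 ` univ A1" using e1 by (intro image_cong) auto
  have u2: "h ` univ A2 = h2 ` univ A2" using e2 by (intro image_cong) auto
  have j1: "inj_on h (univ A1)" using h1 e1 by (simp cong: inj_on_cong)
  have j2: "inj_on h (univ A2)" using h2 e2 by (simp cong: inj_on_cong)
  have "inj_on h (univ A1 \<union> univ A2)" 
  proof -
    have "h ` univ A1 \<inter> h ` univ A2 = {}" using B(4) u1 u2 h1 h2 by (simp add: map_struct_def)
    then show ?thesis using j1 j2 by (subst inj_on_Un) blast
  qed
  moreover have "B = map_struct h (prod_struct A1 A2)"
    unfolding B(1) h1(2) h2(2) map_struct_def prod_struct_def singles
    by (auto simp: fun_eq_iff image_Un u1 u2 i1 i2 image_image e1 split: sym.split)
  ultimately show ?case by (auto simp: prod_struct_def)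
next
  case (represents_Mul s vs As r)
  obtain ws Bs q where B: "mset vs = mset ws" "B = mul_struct (voc s) q Bs"
    "list_all2 (represents s) ws Bs"
    "\<forall>i j. i < j \<longrightarrow> j < length Bs \<longrightarrow> univ (Bs ! i) \<inter> univ (Bs ! j) = {}"
    "\<forall>B \<in> set Bs. q \<notin> univ B"
    using represents_Mul.prems by (elim represents_MulE) auto
  obtain Cs where C: "list_all2 (represents s) vs Cs" "mset Cs = mset Bs"
    using list_all2_reorder_left_invariance[OF B(3,1)] by blast
  have setC: "set Cs = set Bs" using C(2) by (metis set_mset_mset)
  have BC: "B = mul_struct (voc s) q Cs" unfolding B(2) mul_struct_def setC ..
  have dC: "\<forall>i j. i < j \<longrightarrow> j < length Cs \<longrightarrow> univ (Cs ! i) \<inter> univ (Cs ! j) = {}"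
    using iffD1[OF list_disjoint_iff[OF B(3)] B(4)] setC C(2)
    by (subst list_disjoint_iff[OF C(1)]) (metis mset_eq_imp_distinct_iff)
  have dC': "univ (Cs ! i) \<inter> univ (Cs ! j) = {}" if "i \<noteq> j" "i < length Cs" "j < length Cs" for i j
    using dC that by (metis Int_commute linorder_neqE_nat)
  have dA: "univ (As ! i) \<inter> univ (As ! j) = {}" if "i \<noteq> j" "i < length As" "j < length As" for i j
    using represents_Mul.hyps(1) that by (metis Int_commute linorder_neqE_nat)
  have len: "length Cs = length As" "length vs = length As"
    using C(1) represents_Mul.IH by (auto simp: list_all2_conv_all_nth)
  have "\<exists>h. inj_on h (univ (As ! i)) \<and> Cs ! i = map_struct h (As ! i)" if "i < length As" for i
    using represents_Mul.IH C(1) that by (auto simp: list_all2_conv_all_nth)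
  then obtain H where H: "\<And>i. i < length As \<Longrightarrow> inj_on (H i) (univ (As ! i)) \<and> Cs ! i = map_struct (H i) (As ! i)"
    by metis
  define h where "h = (\<lambda>x. if x = r then q else H (THE i. i < length As \<and> x \<in> univ (As ! i)) x)"
  have e: "h x = H i x" if "i < length As" "x \<in> univ (As ! i)" for i x
  proof -
    have "(THE i. i < length As \<and> x \<in> univ (As ! i)) = i"
      using that dA by blast
    moreover have "x \<noteq> r" using that represents_Mul.hyps(2) by fastforce
    ultimately show ?thesis by (simp add: h_def)
  qed
  have wfA: "struct_over (voc s) (As ! i)" if "i < length As" for i
    using represents_Mul.IH that represents_wf by (fastforce simp: list_all2_conv_all_nth)
  have M: "map_struct h (As ! i) = Cs ! i" if i: "i < length As" for i
  proof -
    have "map h xs = map (H i) xs" if "xs \<in> rel (As ! i) R" for xs R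
      using wfA[OF i] that e[OF i] unfolding struct_over_def by auto
    then have "map h ` rel (As ! i) R = map (H i) ` rel (As ! i) R" for R
      by (intro image_cong) auto
    moreover have "h ` univ (As ! i) = H i ` univ (As ! i)" using e[OF i] by (intro image_cong) auto
    ultimately show ?thesis using H[OF i] by (simp add: map_struct_def)
  qed
  have CA: "Cs = map (map_struct h) As" using M len by (intro nth_equalityI) auto
  have hr: "h r = q" by (simp add: h_def)
  have eq: "map_struct h (mul_struct (voc s) r As) = mul_struct (voc s) (h r) (map (map_struct h) As)"
    by (rule map_mul_struct)
  have uC: "h ` univ (As ! i) = univ (Cs ! i)" if "i < length As" for i
    using arg_cong[OF M[OF that], of univ] by (simp add: map_struct_def)
  have "inj_on h (insert r (\<Union>A \<in> set As. univ A))"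
  proof (rule inj_onI)
    fix x y assume x: "x \<in> insert r (\<Union>A \<in> set As. univ A)" and y: "y \<in> insert r (\<Union>A \<in> set As. univ A)"
      and xy: "h x = h y"
    have nq: "h z \<noteq> q" if "A \<in> set As" "z \<in> univ A" for A z
    proof -
      obtain i where i: "i < length As" "A = As ! i" using \<open>A \<in> set As\<close> by (auto simp: in_set_conv_nth)
      then have "h z \<in> univ (Cs ! i)" using uC[OF i(1)] that by blast
      moreover have "Cs ! i \<in> set Bs" using i(1) len(1) setC nth_mem by metis
      ultimately show ?thesis using B(5) by blast
    qed
    show "x = y"
    proof (cases "x = r \<or> y = r")
      case True
      have "h x = q \<and> h y = q" using True xy hr by auto
      then have "x = r" "y = r" using x y nq by blast+
      then show ?thesis by simp
    next
      case False
      then obtain i j where ij: "i < length As" "x \<in> univ (As ! i)" "j < length As" "y \<in> univ (As ! j)"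
        using x y by (auto simp: in_set_conv_nth)
      have "h x \<in> univ (Cs ! i)" "h y \<in> univ (Cs ! j)" using uC[OF ij(1)] uC[OF ij(3)] ij by blast+
      then have "i = j" using dC'[of i j] xy ij len by auto
      then show ?thesis using H[of i] e ij xy by (auto simp: inj_on_def)
    qed
  qed
  then show ?case using BC CA eq hr by (intro exI[of _ h]) (auto simp: mul_struct_def)
qed

theorem represents_eq_iff_isomorphic:
  assumes "represents s v A" "represents s w B"
  shows "v = w \<longleftrightarrow> isomorphic A B"
proof
  assume "v = w"
  then show "isomorphic A B"
    using represents_map_structE assms represents_wf map_struct_isomorphic by metis
next
  assume "isomorphic A B"
  then obtain h where "inj_on h (univ A)" "B = map_struct h A"
    using isomorphic_map_struct assms represents_wf by meson
  then show "v = w" using represents_map_struct represents_unique_val assms by metis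
qed

lemma represents_in:
  assumes "infinite (X :: 'a set)" "v \<in> vals s"
  shows "\<exists>A :: (sym, 'a) struct. represents s v A \<and> univ A \<subseteq> X"
  using assms
proof (induction s arbitrary: v X)
  case TOne
  then obtain a where "a \<in> X" by fastforce
  then show ?case using TOne by (intro exI[of _ "\<lparr>univ = {a}, rel = (\<lambda>_. {})\<rparr>"]) (auto intro: represents_One)
next
  case (TSum s t)
  then show ?case
    by (fastforce intro: represents_Inl represents_Inr simp: inl_struct_def inr_struct_def)
next
  case (TProd s t)
  then obtain v1 v2 where v: "v = VPair v1 v2" "v1 \<in> vals s" "v2 \<in> vals t" by auto
  obtain A :: "(sym, 'a) struct" where A: "represents s v1 A" "univ A \<subseteq> X" using TProd v by metis
  then have "infinite (X - univ A)" using TProd.prems represents_wf by (metis Diff_infinite_finite)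
  then obtain B :: "(sym, 'a) struct" where B: "represents t v2 B" "univ B \<subseteq> X - univ A"
    using TProd.IH(2) v by metis
  have "represents (TProd s t) v (prod_struct A B)" unfolding v by (rule represents_Pair) (use A B in auto)
  then show ?case using A B by (intro exI[of _ "prod_struct A B"]) (auto simp: prod_struct_def)
next
  case (TMul s)
  then obtain vs where vs: "v = VMul (mset vs)" "set vs \<subseteq> vals s" by auto (metis ex_mset set_mset_mset)
  obtain r where r: "r \<in> X" using TMul.prems by fastforce
  have "\<exists>As :: (sym, 'a) struct list. list_all2 (represents s) vs As \<and>
      (\<forall>i j. i < j \<longrightarrow> j < length As \<longrightarrow> univ (As ! i) \<inter> univ (As ! j) = {}) \<and>
      (\<forall>A \<in> set As. univ A \<subseteq> Y)" if "infinite Y" for Y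
    using vs(2) that
  proof (induction vs arbitrary: Y)
    case (Cons w ws)
    obtain A :: "(sym, 'a) struct" where A: "represents s w A" "univ A \<subseteq> Y"
      using TMul.IH Cons.prems by (metis insert_subset list.simps(15))
    then have "infinite (Y - univ A)" using Cons.prems represents_wf by (metis Diff_infinite_finite)
    then obtain As :: "(sym, 'a) struct list" where As: "list_all2 (represents s) ws As"
      "\<forall>i j. i < j \<longrightarrow> j < length As \<longrightarrow> univ (As ! i) \<inter> univ (As ! j) = {}"
      "\<forall>A' \<in> set As. univ A' \<subseteq> Y - univ A"
      using Cons.IH[of "Y - univ A"] Cons.prems by auto
    have "univ ((A # As) ! i) \<inter> univ ((A # As) ! j) = {}" if "i < j" "j < length (A # As)" for i j
    proof (cases i)
      case 0
      then show ?thesis using that As(3) nth_mem[of "j - 1" As] by (cases j) fastforce+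
    next
      case (Suc i')
      then show ?thesis using that As(2) by (cases j) auto
    qed
    then show ?case using A As by (intro exI[of _ "A # As"]) auto
  qed auto
  from this[of "X - {r}"] obtain As :: "(sym, 'a) struct list" where As: "list_all2 (represents s) vs As"
      "\<forall>i j. i < j \<longrightarrow> j < length As \<longrightarrow> univ (As ! i) \<inter> univ (As ! j) = {}"
      "\<forall>A \<in> set As. univ A \<subseteq> X - {r}"
    using TMul.prems by auto
  have "represents (TMul s) v (mul_struct (voc s) r As)"
    unfolding vs by (rule represents_Mul) (use As in auto)
  then show ?case using As r by (intro exI[of _ "mul_struct (voc s) r As"]) (auto simp: mul_struct_def)
qed

theorem represents_exists:
  assumes "infinite (UNIV :: 'a set)"
  shows "v \<in> vals s \<longleftrightarrow> (\<exists>A :: (sym, 'a) struct. represents s v A)"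
  using represents_in[OF assms] represents_wf by blast

theorem represents_isomorphic:
  assumes "represents s v A" "struct_over (voc s) B" "isomorphic A B"
  shows "represents s v B"
  using isomorphic_map_struct represents_map_struct represents_wf assms by metis

end

theory Submission
  imports Defs "HOL-Library.Nat_Bijection"
begin

text \<open>From derivable to first-order: composing an interpretation with a derivable function gives an
  interpretation, by induction on the derivation. For \<open>map\<close> one interprets a single class of an
  output multiset, using its root (an element that is definable in every structure of a type) as
  a parameter; so the induction is stated for interpretations with parameters.

  From first-order to derivable: a structure of type \<open>s\<close> with a distinguished element is a structure of
  another type, the derivative of \<open>s\<close>, on the same universe, and the function
  \<open>A \<mapsto> {{(A, a) | a \<in> A}}\<close> is derivable. Hence the truth value of a formula with parameters is derivable by
  induction on the formula, where a quantifier becomes a test over this multiset. Interpretations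
  with parameters are then derivable by induction on the output type; an output multiset is obtained
  by enumerating the tuples that are roots of classes.\<close>

section \<open>Structures of multiset types\<close>

text \<open>Interpretations here are injective: there is no quotient, so a class of
  \<open>\<sim>\<close> must be named by exactly one tuple. Multiplicities force this too: summing
  over all elements would count a class once per element, and summing over values would merge
  isomorphic classes. Hence multiset structures are treated as families indexed by the set of their
  roots.

  Formulas do not survive the passage to a factor of a product or a class of a multiset, because a
  quantifier sees the universe. Only atoms are transported. The atoms about a distinguished element
  have quantifier-free translations in the derivative, since the position of that element is
  recorded by the outer symbols. Once all free variables are distinguished elements, only nullary
  atoms remain, and these are read off the injections of sums.

  Pairing, \<open>choices\<close> and \<open>map\<close> copy parts of the input, so elements of
  intermediate structures are tuples of varying dimension. Fixing the component and dimension of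
  each parameter keeps everything first-order, and the finitely many possible dimensions turn a
  quantifier over such elements into a finite disjunction.\<close>

definition unl :: "(sym, 'a) struct \<Rightarrow> (sym, 'a) struct" where
  "unl A = \<lparr>univ = univ A, rel = (\<lambda>R. rel A (SymL R))\<rparr>"

definition unr :: "(sym, 'a) struct \<Rightarrow> (sym, 'a) struct" where
  "unr A = \<lparr>univ = univ A, rel = (\<lambda>R. rel A (SymR R))\<rparr>"

definition fst_struct :: "(sym, 'a) struct \<Rightarrow> (sym, 'a) struct" where
  "fst_struct A = \<lparr>univ = {x \<in> univ A. [x] \<in> rel A Fresh}, rel = (\<lambda>R. rel A (SymL R))\<rparr>"

definition snd_struct :: "(sym, 'a) struct \<Rightarrow> (sym, 'a) struct" where
  "snd_struct A = \<lparr>univ = {x \<in> univ A. [x] \<notin> rel A Fresh}, rel = (\<lambda>R. rel A (SymR R))\<rparr>"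

definition rest :: "(sym, 'a) struct \<Rightarrow> 'a \<Rightarrow> (sym, 'a) struct" where
  "rest A a = \<lparr>univ = {x \<in> univ A. [a, x] \<notin> rel A Fresh},
     rel = (\<lambda>R. {xs \<in> rel A R. \<forall>x \<in> set xs. [a, x] \<notin> rel A Fresh})\<rparr>"

lemma univ_inl_struct [simp]: "univ (inl_struct A) = univ A"
  and univ_inr_struct [simp]: "univ (inr_struct A) = univ A"
  and univ_prod_struct [simp]: "univ (prod_struct A B) = univ A \<union> univ B"
  and univ_unl [simp]: "univ (unl A) = univ A"
  and univ_unr [simp]: "univ (unr A) = univ A"
  and univ_fst_struct: "univ (fst_struct A) = {x \<in> univ A. [x] \<in> rel A Fresh}"
  and univ_snd_struct: "univ (snd_struct A) = {x \<in> univ A. [x] \<notin> rel A Fresh}"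
  and univ_rest: "univ (rest A a) = {x \<in> univ A. [a, x] \<notin> rel A Fresh}"
  and univ_block: "univ (block V A a) = {x. [a, x] \<in> rel A Fresh}"
  by (simp_all add: inl_struct_def inr_struct_def prod_struct_def unl_def unr_def
      fst_struct_def snd_struct_def rest_def block_def)

lemma rel_inl_struct [simp]:
  "rel (inl_struct A) Fresh = {[]}" "rel (inl_struct A) (SymL R) = rel A R" "rel (inl_struct A) (SymR R) = {}"
  by (simp_all add: inl_struct_def)

lemma rel_inr_struct [simp]:
  "rel (inr_struct A) Fresh = {}" "rel (inr_struct A) (SymL R) = {}" "rel (inr_struct A) (SymR R) = rel A R"
  by (simp_all add: inr_struct_def)

lemma rel_prod_struct [simp]:
  "xs \<in> rel (prod_struct A B) Fresh \<longleftrightarrow> (\<exists>a \<in> univ A. xs = [a])"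
  "rel (prod_struct A B) (SymL R) = rel A R" "rel (prod_struct A B) (SymR R) = rel B R"
  by (auto simp: prod_struct_def)

lemma rel_destr [simp]:
  "rel (unl A) R = rel A (SymL R)" "rel (unr A) R = rel A (SymR R)"
  "rel (fst_struct A) R = rel A (SymL R)" "rel (snd_struct A) R = rel A (SymR R)"
  by (simp_all add: unl_def unr_def fst_struct_def snd_struct_def)

lemma unl_inl_struct [simp]: "unl (inl_struct A) = A"
  and unr_inr_struct [simp]: "unr (inr_struct A) = A"
  by (auto intro!: struct.equality)

lemma fst_prod_struct: "univ A \<inter> univ B = {} \<Longrightarrow> fst_struct (prod_struct A B) = A"
  and snd_prod_struct: "univ A \<inter> univ B = {} \<Longrightarrow> snd_struct (prod_struct A B) = B"
  by (auto intro!: struct.equality simp: univ_fst_struct univ_snd_struct)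

lemma represents_vals: "represents s v A \<Longrightarrow> v \<in> vals s"
  and represents_finite: "represents s v A \<Longrightarrow> finite (univ A)"
  and represents_nonempty: "represents s v A \<Longrightarrow> univ A \<noteq> {}"
  using represents_wf by blast+

lemma represents_rel:
  "represents s v A \<Longrightarrow> xs \<in> rel A R \<Longrightarrow> voc s R = Some (length xs) \<and> set xs \<subseteq> univ A"
  using represents_wf[of s v A] unfolding struct_over_def by auto

text \<open>\<open>\<sim>\<close> is the only binary symbol, and \<open>TMul\<close> changes an
  arity only from 0 to 1.\<close>

lemma voc_le_2: "voc s R = Some n \<Longrightarrow> n \<le> 2"
proof (induction s arbitrary: R n)
  case (TMul s)
  then show ?case
    by (cases R) (auto split: if_splits)
qed (auto split: sym.splits)

lemma represents_SumI:
  "represents s v A \<Longrightarrow> represents (TSum s t) (VInl v) (inl_struct A)"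
  "represents t v A \<Longrightarrow> represents (TSum s t) (VInr v) (inr_struct A)"
  by (auto intro: represents.intros)

text \<open>The components are computed from \<open>A\<close> instead of being arbitrary witnesses.
  This matters later, where they have to be definable from \<open>A\<close>.\<close>

lemma represents_SumD:
  assumes "represents (TSum s t) v A"
  obtains (Inl) w where "v = VInl w" "represents s w (unl A)" "A = inl_struct (unl A)" "[] \<in> rel A Fresh"
    | (Inr) w where "v = VInr w" "represents t w (unr A)" "A = inr_struct (unr A)" "[] \<notin> rel A Fresh"
  using assms by (elim represents_SumE) auto

lemma represents_ProdD:
  assumes "represents (TProd s t) v A"
  obtains w w' where "v = VPair w w'" "represents s w (fst_struct A)" "represents t w' (snd_struct A)"
    "A = prod_struct (fst_struct A) (snd_struct A)" "univ (fst_struct A) \<inter> univ (snd_struct A) = {}"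
  using assms by (elim represents_ProdE) (auto simp: fst_prod_struct snd_prod_struct)

lemma represents_OneD: "represents TOne v A \<Longrightarrow> v = VUnit \<and> (\<exists>a. A = \<lparr>univ = {a}, rel = (\<lambda>_. {})\<rparr>)"
  by (auto elim: represents_OneE)

text \<open>Determined by \<open>represents_unique_val\<close> whenever \<open>A\<close> represents
  some value of type \<open>s\<close>. It lets functions on values be applied to structures that are
  only described by a construction.\<close>

definition val_of :: "mty \<Rightarrow> (sym, 'a) struct \<Rightarrow> val" where
  "val_of s A = (THE v. represents s v A)"

lemma val_of_eq: "represents s v A \<Longrightarrow> val_of s A = v"
  unfolding val_of_def using represents_unique_val by blast

section \<open>Multiset structures as disjoint families\<close>

definition disjoint_family_struct :: "('i \<Rightarrow> (sym, 'a) struct) \<Rightarrow> 'i set \<Rightarrow> bool" where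
  "disjoint_family_struct H C \<longleftrightarrow> (\<forall>c \<in> C. \<forall>d \<in> C. c \<noteq> d \<longrightarrow> univ (H c) \<inter> univ (H d) = {})"

text \<open>The list of \<open>mul_struct\<close> enters only through its set, so an index set
  serves as well. The index set can consist of elements of another structure, and single classes can
  be removed from it.\<close>

definition mulf :: "sym vocab \<Rightarrow> 'a \<Rightarrow> ('i \<Rightarrow> (sym, 'a) struct) \<Rightarrow> 'i set \<Rightarrow> (sym, 'a) struct" where
  "mulf V r H C =
     \<lparr>univ = insert r (\<Union>c \<in> C. univ (H c)),
      rel = case_sym
        {[a, b] | a b. \<exists>c \<in> C. a \<in> univ (H c) \<and> b \<in> univ (H c)}
        (\<lambda>R. if V R = Some 0 then {[a] | a. \<exists>c \<in> C. a \<in> univ (H c) \<and> [] \<in> rel (H c) R}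
              else (\<Union>c \<in> C. rel (H c) R))
        (\<lambda>_. {})\<rparr>"

lemma univ_mulf: "univ (mulf V r H C) = insert r (\<Union>c \<in> C. univ (H c))"
  and rel_mulf_Fresh: "xs \<in> rel (mulf V r H C) Fresh \<longleftrightarrow> (\<exists>c \<in> C. \<exists>a \<in> univ (H c). \<exists>b \<in> univ (H c). xs = [a, b])"
  and rel_mulf_SymL: "xs \<in> rel (mulf V r H C) (SymL R) \<longleftrightarrow>
    (\<exists>c \<in> C. if V R = Some 0 then \<exists>a \<in> univ (H c). xs = [a] \<and> [] \<in> rel (H c) R else xs \<in> rel (H c) R)"
  and rel_mulf_SymR: "rel (mulf V r H C) (SymR R) = {}"
  by (auto simp: mulf_def)

lemma mul_struct_mulf: "set As = H ` C \<Longrightarrow> mul_struct V r As = mulf V r H C"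
  by (auto simp: mul_struct_def mulf_def fun_eq_iff split: sym.split)

text \<open>The sum runs over indices rather than over values, so that isomorphic classes are
  counted as often as they occur.\<close>

lemma represents_mulf:
  assumes "finite C" "\<And>c. c \<in> C \<Longrightarrow> represents s (val c) (H c)"
    "disjoint_family_struct H C" "\<And>c. c \<in> C \<Longrightarrow> r \<notin> univ (H c)"
  shows "represents (TMul s) (VMul (\<Sum>c\<in>C. {#val c#})) (mulf (voc s) r H C)"
proof -
  obtain cs where cs: "set cs = C" "distinct cs" using assms(1) finite_distinct_list by blast
  have "(\<Sum>c\<in>C. {#val c#}) = mset (map val cs)"
    using cs by (simp add: sum_list_distinct_conv_sum_set[symmetric] flip: sum_unfold_sum_mset)
       (induct cs arbitrary: C; auto)
  moreover have "list_all2 (represents s) (map val cs) (map H cs)"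
    using assms(2) cs(1) by (auto simp: list_all2_conv_all_nth)
  moreover have "univ (map H cs ! i) \<inter> univ (map H cs ! j) = {}" if "i < j" "j < length (map H cs)" for i j
  proof -
    have "cs ! i \<noteq> cs ! j" "cs ! i \<in> C" "cs ! j \<in> C"
      using that cs nth_eq_iff_index_eq[OF cs(2), of i j] by auto
    then show ?thesis using that assms(3) by (auto simp: disjoint_family_struct_def)
  qed
  moreover have "mul_struct (voc s) r (map H cs) = mulf (voc s) r H C"
    using cs by (intro mul_struct_mulf) simp
  ultimately show ?thesis
    using represents_Mul[of s "map val cs" "map H cs" r] assms(4) cs(1) by auto
qed

text \<open>The classes are disjoint and nonempty, hence pairwise different; so the list of classes
  can be replaced by the set \<open>C\<close> of structures without losing multiplicities.\<close>

lemma represents_MulD: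
  assumes "represents (TMul s) v A"
  obtains r and C :: "(sym, 'a) struct set" where "finite C" "\<And>B. B \<in> C \<Longrightarrow> represents s (val_of s B) B"
    "disjoint_family_struct id C" "\<And>B. B \<in> C \<Longrightarrow> r \<notin> univ B"
    "(A :: (sym, 'a) struct) = mulf (voc s) r id C" "v = VMul (\<Sum>B\<in>C. {#val_of s B#})"
proof -
  from assms obtain vs As r where *: "v = VMul (mset vs)" "A = mul_struct (voc s) r As"
    "list_all2 (represents s) vs As"
    "\<forall>i j. i < j \<longrightarrow> j < length As \<longrightarrow> univ (As ! i) \<inter> univ (As ! j) = {}" "\<forall>A \<in> set As. r \<notin> univ A"
    by (elim represents_MulE) blast
  have d: "distinct As" "\<forall>A \<in> set As. \<forall>B \<in> set As. A \<noteq> B \<longrightarrow> univ A \<inter> univ B = {}"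
    using iffD1[OF list_disjoint_iff[OF *(3)] *(4)] by auto
  have vs: "vs = map (val_of s) As"
    using *(3) by (intro nth_equalityI) (auto simp: list_all2_conv_all_nth val_of_eq)
  have rep: "represents s (val_of s B) B" if "B \<in> set As" for B
    using *(3) that by (auto simp: list_all2_conv_all_nth in_set_conv_nth val_of_eq)
  have "mset vs = (\<Sum>B\<in>set As. {#val_of s B#})"
    unfolding vs using d(1) by (induct As) auto
  with * rep d show ?thesis
    by (intro that[of "set As" r]) (auto simp: disjoint_family_struct_def intro!: mul_struct_mulf)
qed

context
  fixes s :: mty and C :: "'i set" and H :: "'i \<Rightarrow> (sym, 'a) struct" and r :: 'a
  assumes rep: "\<And>c. c \<in> C \<Longrightarrow> \<exists>v. represents s v (H c)"
    and disj: "disjoint_family_struct H C"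
    and fresh: "\<And>c. c \<in> C \<Longrightarrow> r \<notin> univ (H c)"
begin

lemma disjD: "c \<in> C \<Longrightarrow> d \<in> C \<Longrightarrow> x \<in> univ (H c) \<Longrightarrow> x \<in> univ (H d) \<Longrightarrow> c = d"
  using disj unfolding disjoint_family_struct_def by blast

lemma mulf_Fresh_left: "c \<in> C \<Longrightarrow> a \<in> univ (H c) \<Longrightarrow> [a, x] \<in> rel (mulf V r H C) Fresh \<longleftrightarrow> x \<in> univ (H c)"
  using disjD by (auto simp: rel_mulf_Fresh)

lemma block_mulf:
  assumes c: "c \<in> C" "a \<in> univ (H c)"
  shows "block (voc s) (mulf (voc s) r H C) a = H c"
proof (rule struct.equality)
  show "univ (block (voc s) (mulf (voc s) r H C) a) = univ (H c)"
    using mulf_Fresh_left[OF c] by (auto simp: univ_block)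
  obtain v where v: "represents s v (H c)" using rep c by blast
  have "rel (block (voc s) (mulf (voc s) r H C) a) R = rel (H c) R" for R
  proof (cases "voc s R = Some 0")
    case True
    have "[a] \<in> rel (mulf (voc s) r H C) (SymL R) \<longleftrightarrow> [] \<in> rel (H c) R"
      using c True disjD by (auto simp: rel_mulf_SymL)
    with True show ?thesis using represents_rel[OF v] by (force simp: block_def)
  next
    case False
    \<comment> \<open>A nonempty tuple contained in both classes gives them a common element, and
      disjointness then makes the classes equal.\<close>
    have "xs \<in> rel (H c) R" if d: "d \<in> C" "xs \<in> rel (H d) R" "set xs \<subseteq> univ (H c)" for d xs
    proof -
      obtain w where w: "represents s w (H d)" using rep[OF d(1)] by blast
      have "xs \<noteq> []" "set xs \<subseteq> univ (H d)" using represents_rel[OF w d(2)] False by auto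
      then obtain y where "y \<in> univ (H d)" "y \<in> univ (H c)" using d(3) by (cases xs) auto
      then show ?thesis using disjD[OF d(1) c(1)] d by blast
    qed
    then have "xs \<in> rel (mulf (voc s) r H C) (SymL R) \<and> set xs \<subseteq> univ (H c) \<longleftrightarrow> xs \<in> rel (H c) R" for xs
      using False c(1) represents_rel[OF v, of xs R] unfolding rel_mulf_SymL by auto
    moreover have "rel (block (voc s) (mulf (voc s) r H C) a) R =
      {xs \<in> rel (mulf (voc s) r H C) (SymL R). set xs \<subseteq> univ (H c)}"
      using False by (simp add: block_def mulf_Fresh_left[OF c] lists_eq_set)
    ultimately show ?thesis by blast
  qed
  then show "rel (block (voc s) (mulf (voc s) r H C) a) = rel (H c)" by blast
qed simp

text \<open>Every tuple of the multiset structure is nonempty and lies inside one class, so the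
  tuples that avoid the class of \<open>a\<close> are exactly the tuples of the other
  classes.\<close>

lemma rest_mulf:
  assumes c: "c \<in> C" "a \<in> univ (H c)"
  shows "rest (mulf (voc s) r H C) a = mulf (voc s) r H (C - {c})"
proof (rule struct.equality)
  let ?A = "mulf (voc s) r H C"
  have out: "x \<notin> univ (H c)" if "x \<in> univ (H d)" "d \<in> C" "d \<noteq> c" for x d
    using that c disjD by blast
  show "univ (rest ?A a) = univ (mulf (voc s) r H (C - {c}))"
    using c fresh out by (auto simp: univ_rest univ_mulf mulf_Fresh_left[OF c])
  have "rel (rest ?A a) R = rel (mulf (voc s) r H (C - {c})) R" for R
  proof (cases R)
    case Fresh
    have "rel (rest ?A a) R = {xs \<in> rel ?A Fresh. \<forall>x \<in> set xs. x \<notin> univ (H c)}"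
      by (simp add: rest_def mulf_Fresh_left[OF c] Fresh)
    also have "\<dots> = rel (mulf (voc s) r H (C - {c})) Fresh"
    proof -
      have "xs \<in> rel ?A Fresh \<and> (\<forall>x \<in> set xs. x \<notin> univ (H c)) \<longleftrightarrow> xs \<in> rel (mulf (voc s) r H (C - {c})) Fresh" for xs
        unfolding rel_mulf_Fresh using out by fastforce
      then show ?thesis by blast
    qed
    finally show ?thesis by (simp add: Fresh)
  next
    case (SymL R)
    have 1: "d \<noteq> c" if d: "d \<in> C" "xs \<in> rel (H d) R" "\<forall>x\<in>set xs. x \<notin> univ (H c)" "voc s R \<noteq> Some 0" for d xs
    proof -
      obtain w where "represents s w (H d)" using rep[OF d(1)] by blast
      from represents_rel[OF this d(2)] d show ?thesis by (cases xs) auto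
    qed
    have 2: "\<forall>x\<in>set xs. x \<notin> univ (H c)" if d: "d \<in> C" "xs \<in> rel (H d) R" "d \<noteq> c" for d xs
    proof -
      obtain w where "represents s w (H d)" using rep[OF d(1)] by blast
      from represents_rel[OF this d(2)] d out show ?thesis by blast
    qed
    have "rel (rest ?A a) (SymL R) = {xs \<in> rel ?A (SymL R). \<forall>x \<in> set xs. x \<notin> univ (H c)}"
      by (simp add: rest_def mulf_Fresh_left[OF c])
    also have "\<dots> = rel (mulf (voc s) r H (C - {c})) (SymL R)"
    proof -
      have "xs \<in> rel ?A (SymL R) \<and> (\<forall>x \<in> set xs. x \<notin> univ (H c)) \<longleftrightarrow>
          xs \<in> rel (mulf (voc s) r H (C - {c})) (SymL R)" for xs
      proof (cases "voc s R = Some 0")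
        case True
        then show ?thesis unfolding rel_mulf_SymL using out by fastforce
      next
        case False
        then show ?thesis unfolding rel_mulf_SymL using 1 2 by fastforce
      qed
      then show ?thesis by blast
    qed
    finally show ?thesis by (simp add: SymL)
  next
    case (SymR R)
    then show ?thesis by (simp add: rest_def rel_mulf_SymR)
  qed
  then show "rel (rest ?A a) = rel (mulf (voc s) r H (C - {c}))" by blast
qed simp

end

text \<open>Every structure of a type has a distinguished element. It names the structure when the
  structure occurs as a class of \<open>\<sim>\<close>.\<close>

primrec is_root :: "mty \<Rightarrow> (sym, 'a) struct \<Rightarrow> 'a \<Rightarrow> bool" where
  "is_root TOne A x \<longleftrightarrow> True"
| "is_root (TSum s t) A x \<longleftrightarrow> (if [] \<in> rel A Fresh then is_root s (unl A) x else is_root t (unr A) x)"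
| "is_root (TProd s t) A x \<longleftrightarrow> [x] \<in> rel A Fresh \<and> is_root s (fst_struct A) x"
| "is_root (TMul s) A x \<longleftrightarrow> [x, x] \<notin> rel A Fresh"

text \<open>A multiset has its extra element, the only one not related to itself by
  \<open>\<sim>\<close>; a sum inherits the root of its summand, and a product takes the root of its
  left factor.\<close>

lemma is_root_unique: "represents s v A \<Longrightarrow> \<exists>!x. x \<in> univ A \<and> is_root s A x"
proof (induction s arbitrary: v A)
  case TOne
  then show ?case by (auto dest: represents_OneD)
next
  case (TSum s t)
  from TSum.prems show ?case
  proof (cases rule: represents_SumD)
    case (Inl w)
    then show ?thesis using TSum.IH(1)[OF Inl(2)] by (simp only: is_root.simps if_True univ_unl)
  next
    case (Inr w)
    then show ?thesis using TSum.IH(2)[OF Inr(2)] by (simp only: is_root.simps if_False univ_unr)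
  qed
next
  case (TProd s t)
  from TProd.prems obtain w where "represents s w (fst_struct A)" by (metis represents_ProdD)
  from TProd.IH(1)[OF this] show ?case by (auto simp: univ_fst_struct)
next
  case (TMul s)
  from TMul.prems obtain r and C :: "(sym, 'a) struct set" where
    "A = mulf (voc s) r id C" "\<And>B. B \<in> C \<Longrightarrow> r \<notin> univ B"
    by (elim represents_MulD) blast
  then have "x \<in> univ A \<and> is_root (TMul s) A x \<longleftrightarrow> x = r" for x
    by (auto simp: univ_mulf rel_mulf_Fresh)
  then show ?case by metis
qed

text \<open>One representative for each class of \<open>\<sim>\<close>: rootness is evaluated inside
  the class of the element. This replaces a quotient by a definable subset.\<close>

definition roots :: "mty \<Rightarrow> (sym, 'a) struct \<Rightarrow> 'a set" where
  "roots s A = {x \<in> univ A. [x, x] \<in> rel A Fresh \<and> is_root s (block (voc s) A x) x}"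

lemma represents_Mul_roots:
  fixes A :: "(sym, 'a) struct"
  assumes "represents (TMul s) v A"
  obtains r where "finite (roots s A)"
    "\<And>c. c \<in> roots s A \<Longrightarrow> represents s (val_of s (block (voc s) A c)) (block (voc s) A c)"
    "disjoint_family_struct (block (voc s) A) (roots s A)"
    "\<And>c. c \<in> roots s A \<Longrightarrow> r \<notin> univ (block (voc s) A c)"
    "\<And>c. c \<in> roots s A \<Longrightarrow> c \<in> univ (block (voc s) A c)"
    "A = mulf (voc s) r (block (voc s) A) (roots s A)"
    "v = VMul (\<Sum>c\<in>roots s A. {#val_of s (block (voc s) A c)#})"
proof -
  from assms obtain r and C :: "(sym, 'a) struct set" where C: "finite C"
    "\<And>B. B \<in> C \<Longrightarrow> represents s (val_of s B) B"
    "disjoint_family_struct id C" "\<And>B. B \<in> C \<Longrightarrow> r \<notin> univ B"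
    "A = mulf (voc s) r id C" "v = VMul (\<Sum>B\<in>C. {#val_of s B#})"
    by (elim represents_MulD) blast
  have bl: "block (voc s) A x = B" if "B \<in> C" "x \<in> univ B" for B x
    unfolding C(5) using block_mulf[of C s id r B x] C that by auto
  \<comment> \<open>\<open>g\<close> picks the root of a class and \<open>block\<close> recovers the
    class from any of its elements, so \<open>C\<close> can be reindexed by elements of
    \<open>A\<close>.\<close>
  define g where "g B = (THE x. x \<in> univ B \<and> is_root s B x)" for B :: "(sym, 'a) struct"
  have g: "g B \<in> univ B" "is_root s B (g B)" if "B \<in> C" for B
    using theI'[OF is_root_unique[OF C(2)[OF that]]] unfolding g_def by auto
  have g': "x = g B" if "B \<in> C" "x \<in> univ B" "is_root s B x" for B x
    using is_root_unique[OF C(2)[OF that(1)]] g that by blast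
  have x: "[x, x] \<in> rel A Fresh \<longleftrightarrow> (\<exists>B\<in>C. x \<in> univ B)" for x
    unfolding C(5) by (auto simp: rel_mulf_Fresh)
  have roots: "roots s A = g ` C"
  proof (intro equalityI subsetI)
    fix c assume "c \<in> roots s A"
    then obtain B where B: "B \<in> C" "c \<in> univ B" "is_root s (block (voc s) A c) c"
      unfolding roots_def x by blast
    with bl[of B c] g'[of B c] show "c \<in> g ` C" by auto
  next
    fix c assume "c \<in> g ` C"
    then obtain B where B: "B \<in> C" "c = g B" by blast
    then have "block (voc s) A c = B" "[c, c] \<in> rel A Fresh" using g bl x by auto
    moreover have "c \<in> univ A" using B g unfolding C(5) by (auto simp: univ_mulf)
    ultimately show "c \<in> roots s A" using B g by (simp add: roots_def)
  qed
  have bg: "block (voc s) A (g B) = B" if "B \<in> C" for B using that g bl by blast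
  have inj: "inj_on g C" by (metis bg inj_onI)
  have img: "block (voc s) A ` roots s A = C" unfolding roots using bg by force
  have A: "A = mulf (voc s) r (block (voc s) A) (roots s A)"
  proof -
    have "mulf (voc s) r (block (voc s) A) (roots s A) = mulf (voc s) r id C"
      using img by (auto simp: mulf_def fun_eq_iff split: sym.split)
    then show ?thesis using C(5) by simp
  qed
  show ?thesis
  proof (rule that[of r])
    show "finite (roots s A)" using roots C(1) by simp
    show "disjoint_family_struct (block (voc s) A) (roots s A)"
      using C(3) bg unfolding roots disjoint_family_struct_def by fastforce
    show "v = VMul (\<Sum>c\<in>roots s A. {#val_of s (block (voc s) A c)#})"
      unfolding C(6) roots using bg by (simp add: sum.reindex[OF inj])
    show "A = mulf (voc s) r (block (voc s) A) (roots s A)" by (rule A)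
  qed (auto simp: roots bg C(1,2,4) g)
qed

lemma val_of_struct_rules:
  "represents s v A \<Longrightarrow> val_of (TSum s t) (inl_struct A) = VInl v"
  "represents t w B \<Longrightarrow> val_of (TSum s t) (inr_struct B) = VInr w"
  "represents s v A \<Longrightarrow> represents t w B \<Longrightarrow> univ A \<inter> univ B = {} \<Longrightarrow>
    val_of (TProd s t) (prod_struct A B) = VPair v w"
  by (intro val_of_eq represents_SumI represents_Pair; assumption)+

section \<open>Derivable functions\<close>

text \<open>Derivable functions are extensional. The restriction admits arbitrary lambda terms and
  makes only their values on \<open>vals s\<close> matter.\<close>

definition dv :: "mty \<Rightarrow> mty \<Rightarrow> (val \<Rightarrow> val) \<Rightarrow> bool" where
  "dv s t f \<longleftrightarrow> derivable s t (restrict f (vals s))"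

lemma dv_vals: "dv s t f \<Longrightarrow> v \<in> vals s \<Longrightarrow> f v \<in> vals t"
  unfolding dv_def using derivable_vals by (fastforce simp: PiE_iff)

lemma dv_cong: "dv s t f \<Longrightarrow> (\<And>v. v \<in> vals s \<Longrightarrow> f v = g v) \<Longrightarrow> dv s t g"
  unfolding dv_def by (metis restrict_ext)

lemma dv_comp:
  assumes "dv s t f" "dv t u g"
  shows "dv s u (\<lambda>v. g (f v))"
proof -
  have "compose (vals s) (restrict g (vals t)) (restrict f (vals s)) = restrict (\<lambda>v. g (f v)) (vals s)"
    using dv_vals[OF assms(1)] by (auto simp: compose_def)
  then show ?thesis using derivable_compose assms unfolding dv_def by metis
qed

lemma dv_id: "dv s s (\<lambda>v. v)"
  unfolding dv_def using derivable_id by (simp add: id_def)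

lemma dv_fst: "dv s (TProd t u) f \<Longrightarrow> dv s t (\<lambda>v. vfst (f v))"
  and dv_snd: "dv s (TProd t u) f \<Longrightarrow> dv s u (\<lambda>v. vsnd (f v))"
  by (rule dv_comp[OF _ derivable_fst[folded dv_def]] dv_comp[OF _ derivable_snd[folded dv_def]]; assumption)+

lemma dv_pair: "dv s t f \<Longrightarrow> dv s u g \<Longrightarrow> dv s (TProd t u) (\<lambda>v. VPair (f v) (g v))"
proof -
  assume "dv s t f" "dv s u g"
  then have "derivable s (TProd t u) (\<lambda>v \<in> vals s. VPair (restrict f (vals s) v) (restrict g (vals s) v))"
    unfolding dv_def by (rule derivable_pair)
  then show ?thesis unfolding dv_def by (metis (mono_tags, lifting) restrict_apply' restrict_ext)
qed

lemma dv_inl: "dv s t f \<Longrightarrow> dv s (TSum t u) (\<lambda>v. VInl (f v))"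
  and dv_inr: "dv s u f \<Longrightarrow> dv s (TSum t u) (\<lambda>v. VInr (f v))"
  by (rule dv_comp[OF _ derivable_inl[folded dv_def]] dv_comp[OF _ derivable_inr[folded dv_def]]; assumption)+

lemma dv_add: "dv s t f \<Longrightarrow> dv s (TMul t) (\<lambda>v. VMul (G v)) \<Longrightarrow> dv s (TMul t) (\<lambda>v. VMul (add_mset (f v) (G v)))"
  using dv_comp[OF dv_pair, of s t f "TMul t" "\<lambda>v. VMul (G v)" "TMul t" add_fn]
    derivable_add[folded dv_def, of t] by (simp add: add_fn_def)

lemma dv_map: "dv s t f \<Longrightarrow> dv (TMul s) (TMul t) (\<lambda>v. VMul (image_mset f (elems v)))"
proof -
  assume "dv s t f"
  then have "derivable (TMul s) (TMul t) (restrict (map_fn (restrict f (vals s))) (vals (TMul s)))"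
    unfolding dv_def by (rule derivable_map)
  moreover have "restrict (map_fn (restrict f (vals s))) (vals (TMul s)) =
      restrict (\<lambda>v. VMul (image_mset f (elems v))) (vals (TMul s))"
    by (rule restrict_ext) (auto simp: map_fn_def intro!: image_mset_cong)
  ultimately show ?thesis by (simp add: dv_def)
qed

lemma dv_bind:
  assumes "dv s (TMul t) (\<lambda>v. VMul (F v))"
  shows "dv (TMul s) (TMul t) (\<lambda>v. VMul (\<Sum>x\<in>#elems v. F x))"
proof -
  have "dv (TMul (TMul t)) (TMul t) union_fn" unfolding dv_def by (rule derivable_union)
  from dv_comp[OF dv_map[OF assms] this] show ?thesis
    by (simp add: union_fn_def image_mset.compositionality comp_def)
qed

lemma dv_sum:
  assumes "dv s u (\<lambda>x. h (VInl x))" "dv t u (\<lambda>x. h (VInr x))"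
  shows "dv (TSum s t) u h"
proof -
  have "restrict (copair_fn (restrict (\<lambda>x. h (VInl x)) (vals s)) (restrict (\<lambda>x. h (VInr x)) (vals t)))
      (vals (TSum s t)) = restrict h (vals (TSum s t))"
    by (rule restrict_ext) auto
  then show ?thesis using derivable_copair assms unfolding dv_def by metis
qed

text \<open>Co-pairing alone forgets the context \<open>v\<close> in the branches; pairing
  \<open>v\<close> with the scrutinee and applying \<open>dist_fn\<close> keeps it.\<close>

lemma dv_case:
  assumes g: "dv s (TSum t1 t2) g" and l: "dv (TProd s t1) u (\<lambda>p. F (vfst p) (VInl (vsnd p)))"
    and r: "dv (TProd s t2) u (\<lambda>p. F (vfst p) (VInr (vsnd p)))"
  shows "dv s u (\<lambda>v. F v (g v))"
proof -
  define h where "h x = (case x of VInl p \<Rightarrow> F (vfst p) (VInl (vsnd p)) | VInr p \<Rightarrow> F (vfst p) (VInr (vsnd p)))" for x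
  have "dv (TSum (TProd s t1) (TProd s t2)) u h"
    by (rule dv_sum) (simp_all add: h_def l r)
  moreover have "dv s (TProd s (TSum t1 t2)) (\<lambda>v. VPair v (g v))" by (intro dv_pair dv_id g)
  moreover have "dv (TProd s (TSum t1 t2)) (TSum (TProd s t1) (TProd s t2)) dist_fn"
    unfolding dv_def by (rule derivable_dist)
  ultimately have "dv s u (\<lambda>v. h (dist_fn (VPair v (g v))))" by (intro dv_comp[of s _ _ _ h] dv_comp[of s _ _ _ dist_fn])
  then show ?thesis
  proof (rule dv_cong)
    fix v assume "v \<in> vals s"
    then have "g v \<in> vals (TSum t1 t2)" using g dv_vals by blast
    then show "h (dist_fn (VPair v (g v))) = F v (g v)" by (auto simp: h_def)
  qed
qed

lemma de_singleton_fn [simp]: "de_singleton_fn (VMul {#a#}) = VInr a"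
  "(\<And>a. M \<noteq> {#a#}) \<Longrightarrow> de_singleton_fn (VMul M) = VInl VUnit"
  by (auto simp: de_singleton_fn_def)

lemma dv_de_singleton: "dv (TMul s) (TSum TOne s) de_singleton_fn"
  unfolding dv_def by (rule derivable_de_singleton)

text \<open>For \<open>TMul s\<close>, \<open>de_singleton_fn\<close> leads to \<open>1 + s\<close>,
  where the induction hypothesis takes care of the second summand.\<close>

lemma dv_terminal: "dv s TOne (\<lambda>_. VUnit)"
proof (induction s)
  case TOne
  show ?case by (rule dv_cong[OF dv_id]) auto
next
  case (TSum s1 s2)
  then show ?case by (intro dv_sum)
next
  case (TProd s1 s2)
  show ?case by (rule dv_comp[OF dv_fst[OF dv_id] TProd.IH(1)])
next
  case (TMul s)
  have "dv (TSum TOne s) TOne (\<lambda>_. VUnit)" by (intro dv_sum TMul.IH) (rule dv_cong[OF dv_id]; auto)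
  from dv_comp[OF dv_de_singleton this] show ?case .
qed

text \<open>Serves to change the element type of the empty multiset: \<open>empty_fn\<close> yields
  one over \<open>TOne\<close>, and mapping any function from \<open>TOne\<close> to
  \<open>t\<close> over it gives one over \<open>t\<close>.\<close>

lemma dv_const_ex: "\<exists>d. dv TOne t (\<lambda>_. d)"
proof (induction t)
  case TOne
  then show ?case using dv_terminal by blast
next
  case (TSum t1 t2)
  then obtain d where "dv TOne t1 (\<lambda>_. d)" by blast
  from dv_inl[OF this] show ?case by (rule exI)
next
  case (TProd t1 t2)
  then obtain d d' where "dv TOne t1 (\<lambda>_. d)" "dv TOne t2 (\<lambda>_. d')" by blast
  from dv_pair[OF this] show ?case by (rule exI)
next
  case (TMul t)
  then obtain d where "dv TOne t (\<lambda>_. d)" by blast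
  from dv_comp[OF derivable_empty[folded dv_def] dv_map[OF this]]
  show ?case by (auto simp: empty_fn_def)
qed

lemma dv_empty: "dv s (TMul t) (\<lambda>_. VMul {#})"
proof -
  obtain d where "dv TOne t (\<lambda>_. d)" using dv_const_ex by blast
  moreover have "dv s (TMul TOne) (\<lambda>v. empty_fn VUnit)"
    by (rule dv_comp[OF dv_terminal]) (simp add: empty_fn_def derivable_empty[folded dv_def, unfolded empty_fn_def])
  ultimately show ?thesis using dv_comp[OF _ dv_map] by (fastforce simp: empty_fn_def)
qed

lemma dv_single: "dv s t f \<Longrightarrow> dv s (TMul t) (\<lambda>v. VMul {#f v#})"
  by (rule dv_add[OF _ dv_empty])

lemma dv_plus:
  assumes "dv s (TMul t) (\<lambda>v. VMul (F v))" "dv s (TMul t) (\<lambda>v. VMul (G v))"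
  shows "dv s (TMul t) (\<lambda>v. VMul (F v + G v))"
proof -
  have "dv s (TMul (TMul t)) (\<lambda>v. VMul {#VMul (F v), VMul (G v)#})"
    by (intro dv_add dv_empty assms)
  moreover have "dv (TMul (TMul t)) (TMul t) (\<lambda>v. VMul (\<Sum>x\<in>#elems v. elems x))"
    by (rule dv_bind, rule dv_cong[OF dv_id]) auto
  ultimately show ?thesis using dv_comp by fastforce
qed

lemma dv_Sum:
  assumes "finite I" "\<And>i. i \<in> I \<Longrightarrow> dv s (TMul t) (\<lambda>v. VMul (F i v))"
  shows "dv s (TMul t) (\<lambda>v. VMul (\<Sum>i\<in>I. F i v))"
  using assms by (induction I) (auto intro: dv_empty dv_plus)

section \<open>Derivable predicates\<close>

definition truth :: "bool \<Rightarrow> val" where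
  "truth b = (if b then VInl VUnit else VInr VUnit)"

definition dvp :: "mty \<Rightarrow> (val \<Rightarrow> bool) \<Rightarrow> bool" where
  "dvp s P \<longleftrightarrow> dv s (TSum TOne TOne) (\<lambda>v. truth (P v))"

lemma dvp_cong: "dvp s P \<Longrightarrow> (\<And>v. v \<in> vals s \<Longrightarrow> P v = Q v) \<Longrightarrow> dvp s Q"
  unfolding dvp_def by (erule dv_cong) simp

lemma dvp_comp: "dv s t f \<Longrightarrow> dvp t P \<Longrightarrow> dvp s (\<lambda>v. P (f v))"
  unfolding dvp_def by (rule dv_comp)

lemma dvp_const: "dvp s (\<lambda>_. b)"
  unfolding dvp_def truth_def by (auto intro: dv_inl dv_inr dv_terminal)

lemma dv_if:
  assumes "dvp s P" "dv s t f" "dv s t g"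
  shows "dv s t (\<lambda>v. if P v then f v else g v)"
proof -
  let ?F = "\<lambda>v b. if b = VInl VUnit then f v else g v"
  have "dv s t (\<lambda>v. ?F v (truth (P v)))"
  proof (rule dv_case[of s TOne TOne _ t ?F])
    have "dv (TProd s TOne) t (\<lambda>p. f (vfst p))" by (rule dv_comp[OF dv_fst[OF dv_id] assms(2)])
    then show "dv (TProd s TOne) t (\<lambda>p. ?F (vfst p) (VInl (vsnd p)))"
      by (rule dv_cong) auto
    have "dv (TProd s TOne) t (\<lambda>p. g (vfst p))" by (rule dv_comp[OF dv_fst[OF dv_id] assms(3)])
    then show "dv (TProd s TOne) t (\<lambda>p. ?F (vfst p) (VInr (vsnd p)))"
      by (rule dv_cong) auto
  qed (use assms(1) in \<open>simp add: dvp_def\<close>)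
  then show ?thesis by (rule dv_cong) (simp add: truth_def)
qed

lemma dvp_not: "dvp s P \<Longrightarrow> dvp s (\<lambda>v. \<not> P v)"
  and dvp_conj: "dvp s P \<Longrightarrow> dvp s Q \<Longrightarrow> dvp s (\<lambda>v. P v \<and> Q v)"
proof -
  assume P: "dvp s P"
  have "dv s (TSum TOne TOne) (\<lambda>v. if P v then truth False else truth True)"
    by (rule dv_if[OF P]) (use dvp_const in \<open>auto simp: dvp_def\<close>)
  then show "dvp s (\<lambda>v. \<not> P v)" unfolding dvp_def by (rule dv_cong) simp
  assume Q: "dvp s Q"
  have "dv s (TSum TOne TOne) (\<lambda>v. if P v then truth (Q v) else truth False)"
    by (rule dv_if[OF P]) (use Q dvp_const in \<open>auto simp: dvp_def\<close>)
  then show "dvp s (\<lambda>v. P v \<and> Q v)" unfolding dvp_def by (rule dv_cong) simp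
qed

lemma dvp_sum: "dvp s (\<lambda>x. P (VInl x)) \<Longrightarrow> dvp t (\<lambda>x. P (VInr x)) \<Longrightarrow> dvp (TSum s t) P"
  unfolding dvp_def by (rule dv_sum)

text \<open>A multiset is empty iff adding one element yields a singleton.\<close>

lemma dvp_empty: "dvp (TMul s) (\<lambda>v. elems v = {#})"
proof -
  have "dv (TMul s) (TMul TOne) (\<lambda>v. VMul (add_mset VUnit (image_mset (\<lambda>_. VUnit) (elems v))))"
    by (intro dv_add dv_terminal dv_map)
  from dv_comp[OF this dv_de_singleton]
  have "dv (TMul s) (TSum TOne TOne) (\<lambda>v. truth (elems v \<noteq> {#}))"
    by (rule dv_cong) (auto simp: truth_def)
  then have "dvp (TMul s) (\<lambda>v. elems v \<noteq> {#})" by (simp add: dvp_def)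
  from dvp_not[OF this] show ?thesis by simp
qed

lemma sum_mset_single: "(\<Sum>x\<in>#M. if P x then {#x#} else {#}) = filter_mset P M"
  by (induction M) auto

text \<open>Each element is replaced by a singleton or by the empty multiset, and the union is
  taken.\<close>

lemma dv_filter: "dvp s P \<Longrightarrow> dv (TMul s) (TMul s) (\<lambda>v. VMul (filter_mset P (elems v)))"
proof -
  assume P: "dvp s P"
  have "dv s (TMul s) (\<lambda>v. if P v then VMul {#v#} else VMul {#})"
    by (intro dv_if[OF P] dv_single dv_empty dv_id)
  then have "dv s (TMul s) (\<lambda>v. VMul (if P v then {#v#} else {#}))"
    by (rule dv_cong) simp
  from dv_bind[OF this] show ?thesis by (simp add: sum_mset_single)
qed

lemma dvp_any: "dvp s P \<Longrightarrow> dvp (TMul s) (\<lambda>v. \<exists>x\<in>#elems v. P x)"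
  using dvp_not[OF dvp_comp[OF dv_filter dvp_empty]] by (rule dvp_cong) (auto simp: filter_mset_eq_mempty_iff)

text \<open>Add \<open>b\<close> to the multiset, apply \<open>choices\<close>, and recover \<open>b\<close> from the remainder of each choice.\<close>

lemma dv_strength: "dv (TProd (TMul s) t) (TMul (TProd s t)) (\<lambda>p. VMul {#VPair a (vsnd p). a \<in># elems (vfst p)#})"
proof -
  let ?st = "TSum s t"
  define right where "right x = (case x of VInr y \<Rightarrow> {#y#} | _ \<Rightarrow> {#})" for x
  \<comment> \<open>When an element of the original multiset has been chosen, \<open>VInr b\<close>
    is the only right injection left in the remainder, so \<open>de_singleton_fn\<close> extracts
    \<open>b\<close>.\<close>
  define W where "W v = de_singleton_fn (VMul (\<Sum>x\<in>#elems v. right x))" for v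
  have "dv (TSum s t) (TMul t) (\<lambda>x. VMul (right x))"
    by (rule dv_sum) (simp_all add: right_def dv_empty dv_single dv_id)
  then have W: "dv (TMul ?st) (TSum TOne t) W"
    unfolding W_def by (intro dv_comp[OF dv_bind dv_de_singleton])
  \<comment> \<open>The choice of the added element itself contributes nothing, so each original
    element is paired exactly once.\<close>
  define F where "F a b = (case (a, b) of (VInl a, VInr b) \<Rightarrow> {#VPair a b#} | _ \<Rightarrow> {#})" for a b
  have "dv (TProd ?st (TMul ?st)) (TMul (TProd s t)) (\<lambda>q. VMul (F (vfst q) (W (vsnd q))))"
  proof (rule dv_case[of _ s t "vfst" _ "\<lambda>q a. VMul (F a (W (vsnd q)))"])
    show "dv (TProd ?st (TMul ?st)) ?st vfst" by (rule dv_fst[OF dv_id])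
    let ?c = "TProd (TProd ?st (TMul ?st)) s"
    have g: "dv ?c (TSum TOne t) (\<lambda>p. W (vsnd (vfst p)))"
      by (rule dv_comp[OF dv_snd[OF dv_fst[OF dv_id]] W])
    show "dv ?c (TMul (TProd s t)) (\<lambda>p. VMul (F (VInl (vsnd p)) (W (vsnd (vfst p)))))"
    proof (rule dv_case[OF g, of _ "\<lambda>p b. VMul (F (VInl (vsnd p)) b)"])
      show "dv (TProd ?c TOne) (TMul (TProd s t)) (\<lambda>p. VMul (F (VInl (vsnd (vfst p))) (VInl (vsnd p))))"
        by (simp add: F_def dv_empty)
      show "dv (TProd ?c t) (TMul (TProd s t)) (\<lambda>p. VMul (F (VInl (vsnd (vfst p))) (VInr (vsnd p))))"
        by (simp add: F_def) (intro dv_single dv_pair dv_snd dv_fst dv_id; (rule dv_id)?)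
    qed
    show "dv (TProd (TProd ?st (TMul ?st)) t) (TMul (TProd s t))
        (\<lambda>p. VMul (F (VInr (vsnd p)) (W (vsnd (vfst p)))))"
      by (simp add: F_def dv_empty)
  qed
  from dv_bind[OF this]
  have b: "dv (TMul (TProd ?st (TMul ?st))) (TMul (TProd s t)) (\<lambda>v. VMul (\<Sum>q\<in>#elems v. F (vfst q) (W (vsnd q))))" .
  have 1: "dv (TProd (TMul s) t) (TMul ?st) (\<lambda>p. VMul (add_mset (VInr (vsnd p)) (image_mset VInl (elems (vfst p)))))"
    using dv_comp[OF dv_fst[OF dv_id] dv_map[OF dv_inl[OF dv_id]]]
    by (intro dv_add dv_inr dv_snd[OF dv_id]) auto
  have c: "dv (TMul ?st) (TMul (TProd ?st (TMul ?st))) choices_fn"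
    unfolding dv_def by (rule derivable_choices)
  from dv_comp[OF dv_comp[OF 1 c] b] show ?thesis
  proof (rule dv_cong)
    fix p assume "p \<in> vals (TProd (TMul s) t)"
    define M where "M = elems (vfst p)"
    define b where "b = vsnd p"
    define N where "N = add_mset (VInr b) (image_mset VInl M)"
    have r: "(\<Sum>x\<in>#image_mset VInl X. right x) = {#}" for X by (induction X) (auto simp: right_def)
    have "(\<Sum>x\<in>#N - {#VInl a#}. right x) = {#b#}" if "a \<in># M" for a
    proof -
      have "N - {#VInl a#} = add_mset (VInr b) (image_mset VInl (M - {#a#}))"
        using that by (auto simp: N_def image_mset_Diff diff_union_swap2)
      then show ?thesis using r[of "M - {#a#}"] by (simp add: right_def)
    qed
    then have "(\<Sum>a\<in>#M. F (VInl a) (W (VMul (N - {#VInl a#})))) = (\<Sum>a\<in>#M. {#VPair a b#})"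
      by (intro arg_cong[of _ _ sum_mset] image_mset_cong) (simp add: W_def F_def)
    also have "\<dots> = {#VPair a b. a \<in># M#}" by (induction M) auto
    finally show "VMul (\<Sum>q\<in>#elems (choices_fn (VMul (add_mset (VInr (vsnd p)) (image_mset VInl (elems (vfst p)))))).
        F (vfst q) (W (vsnd q))) = VMul {#VPair a (vsnd p). a \<in># elems (vfst p)#}"
      by (simp add: choices_fn_def M_def[symmetric] b_def[symmetric] N_def[symmetric] image_mset.compositionality comp_def)
        (simp add: N_def F_def image_mset.compositionality comp_def)
  qed
qed

section \<open>Pointed structures\<close>

text \<open>In the derivative of \<open>M s\<close>, the first summand is the case where the root is distinguished;
  in the second, the remaining classes keep the root.\<close>

primrec dty :: "mty \<Rightarrow> mty" where
  "dty TOne = TOne"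
| "dty (TSum s t) = TSum (dty s) (dty t)"
| "dty (TProd s t) = TSum (TProd (dty s) t) (TProd s (dty t))"
| "dty (TMul s) = TSum (TMul s) (TProd (dty s) (TMul s))"

text \<open>No new unary symbol marks \<open>a\<close>. Its position is recorded by the new sums and
  products: the nullary symbol tells in which part \<open>a\<close> lies, and in the case of a class
  the unary symbol separates this class from the rest.\<close>

primrec dstruct :: "mty \<Rightarrow> (sym, 'a) struct \<Rightarrow> 'a \<Rightarrow> (sym, 'a) struct" where
  "dstruct TOne A a = A"
| "dstruct (TSum s t) A a =
     (if [] \<in> rel A Fresh then inl_struct (dstruct s (unl A) a) else inr_struct (dstruct t (unr A) a))"
| "dstruct (TProd s t) A a =
     (if [a] \<in> rel A Fresh then inl_struct (prod_struct (dstruct s (fst_struct A) a) (snd_struct A))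
      else inr_struct (prod_struct (fst_struct A) (dstruct t (snd_struct A) a)))"
| "dstruct (TMul s) A a =
     (if [a, a] \<notin> rel A Fresh then inl_struct A
      else inr_struct (prod_struct (dstruct s (block (voc s) A a) a) (rest A a)))"

lemma image_mset_sum_single: "image_mset f (\<Sum>a\<in>X. {#h a#}) = (\<Sum>a\<in>X. {#f (h a)#})"
  by (induction X rule: infinite_finite_induct) auto

lemma sum_mset_sum_single: "(\<Sum>x\<in>#(\<Sum>a\<in>X. {#h a#}). F x) = (\<Sum>a\<in>X. F (h a))"
  by (induction X rule: infinite_finite_induct) auto

lemma sum_single_diff: "finite X \<Longrightarrow> a \<in> X \<Longrightarrow> (\<Sum>x\<in>X. {#h x#}) - {#h a#} = (\<Sum>x\<in>X - {a}. {#h x#})"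
  by (simp add: sum.remove)

lemma represents_val_of: "represents s v A \<Longrightarrow> represents s (val_of s A) A"
  by (simp add: val_of_eq)

lemma represents_Mul_elem:
  fixes A :: "(sym, 'a) struct"
  assumes "represents (TMul s) v A" and c: "c \<in> roots s A" "a \<in> univ (block (voc s) A c)"
  shows "block (voc s) A a = block (voc s) A c"
    "represents (TMul s) (VMul (elems v - {#val_of s (block (voc s) A c)#})) (rest A a)"
    "[a, a] \<in> rel A Fresh" "a \<in> univ A"
proof -
  define H where "H = block (voc s) A"
  define C where "C = roots s A"
  from represents_Mul_roots[OF assms(1)] obtain r where
    H: "finite C" "\<And>c. c \<in> C \<Longrightarrow> represents s (val_of s (H c)) (H c)"
      "disjoint_family_struct H C" "\<And>c. c \<in> C \<Longrightarrow> r \<notin> univ (H c)"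
      "A = mulf (voc s) r H C" "v = VMul (\<Sum>c\<in>C. {#val_of s (H c)#})"
    unfolding H_def C_def by (metis (no_types, lifting))
  have c: "c \<in> C" "a \<in> univ (H c)" using c unfolding H_def C_def .
  have ex: "\<And>c. c \<in> C \<Longrightarrow> \<exists>v. represents s v (H c)" using H(2) by blast
  show "block (voc s) A a = block (voc s) A c"
    using block_mulf[OF ex H(3,4) c] unfolding H(5)[symmetric] by (simp add: H_def)
  show "[a, a] \<in> rel A Fresh" "a \<in> univ A"
    unfolding H(5) using c by (auto simp: rel_mulf_Fresh univ_mulf)
  have "represents (TMul s) (VMul (\<Sum>x\<in>C - {c}. {#val_of s (H x)#})) (mulf (voc s) r H (C - {c}))"
    by (rule represents_mulf) (use H(1-4) in \<open>auto simp: disjoint_family_struct_def\<close>)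
  then show "represents (TMul s) (VMul (elems v - {#val_of s (block (voc s) A c)#})) (rest A a)"
    using rest_mulf[OF ex H(3,4) c] unfolding H(5)[symmetric]
    using sum_single_diff[OF H(1) c(1), of "\<lambda>x. val_of s (H x)"] by (simp add: H(6)) (simp add: H_def)
qed

lemma represents_Mul_univ:
  fixes A :: "(sym, 'a) struct"
  assumes "represents (TMul s) v A"
  obtains r where "univ A = insert r (\<Union>c\<in>roots s A. univ (block (voc s) A c))"
    "\<And>c. c \<in> roots s A \<Longrightarrow> r \<notin> univ (block (voc s) A c)"
    "\<And>x. x \<in> univ A \<Longrightarrow> [x, x] \<notin> rel A Fresh \<longleftrightarrow> x = r"
proof -
  obtain r where r: "A = mulf (voc s) r (block (voc s) A) (roots s A)"
    "\<And>c. c \<in> roots s A \<Longrightarrow> r \<notin> univ (block (voc s) A c)"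
    using represents_Mul_roots[OF assms] by metis
  have u: "univ A = insert r (\<Union>c\<in>roots s A. univ (block (voc s) A c))"
    by (subst r(1)) (rule univ_mulf)
  have "[x, x] \<in> rel A Fresh \<longleftrightarrow> (\<exists>c\<in>roots s A. x \<in> univ (block (voc s) A c))" for x
    by (subst r(1)) (auto simp: rel_mulf_Fresh)
  with u r(2) show ?thesis by (intro that[of r]) blast+
qed

lemma represents_Mul_block:
  assumes rep: "represents (TMul s) v A" and a: "[a, a] \<in> rel A Fresh"
  shows "\<exists>w. represents s w (block (voc s) A a)"
    "b \<in> univ (block (voc s) A a) \<Longrightarrow> block (voc s) A b = block (voc s) A a"
proof -
  have "a \<in> univ A" using represents_rel[OF rep a] by simp
  then obtain c where c: "c \<in> roots s A" "a \<in> univ (block (voc s) A c)"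
    using represents_Mul_univ[OF rep] a by (metis UN_E insertE)
  note e = represents_Mul_elem(1)[OF rep c(1)]
  show "\<exists>w. represents s w (block (voc s) A a)"
    using represents_Mul_roots[OF rep] c(1) e[OF c(2)] by metis
  show "block (voc s) A b = block (voc s) A a" if "b \<in> univ (block (voc s) A a)"
    using e[of b] e[OF c(2)] that by simp
qed

text \<open>Every tuple lies inside a single class, because the relations of the multiset are
  assembled class by class.\<close>

lemma represents_Mul_rel:
  assumes rep: "represents (TMul s) v A" and a: "[a, a] \<in> rel A Fresh" and xs: "xs \<in> rel A R"
  shows "set xs \<subseteq> univ (block (voc s) A a) \<or> set xs \<inter> univ (block (voc s) A a) = {}"
proof -
  obtain r and C :: "(sym, 'a) struct set" where C: "\<And>B. B \<in> C \<Longrightarrow> represents s (val_of s B) B"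
    "disjoint_family_struct id C" "\<And>B. B \<in> C \<Longrightarrow> r \<notin> univ B" "A = mulf (voc s) r id C"
    using represents_MulD[OF rep] by metis
  obtain B where B: "B \<in> C" "a \<in> univ B" using a unfolding C(4) by (auto simp: rel_mulf_Fresh)
  have "block (voc s) A a = B" unfolding C(4) using block_mulf[of C s id r B a] B C by auto
  moreover obtain B' where "B' \<in> C" "set xs \<subseteq> univ B'"
  proof (cases R)
    case (SymL R)
    then show ?thesis using that xs represents_rel[OF C(1)] unfolding C(4)
      by (fastforce simp: rel_mulf_SymL split: if_splits)
  qed (use that xs in \<open>auto simp: C(4) rel_mulf_Fresh rel_mulf_SymR\<close>)
  ultimately show ?thesis using B C(2) by (cases "B = B'") (auto simp: disjoint_family_struct_def)
qed

lemma represents_Mul_root: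
  assumes rep: "represents (TMul s) v A" and a: "[a, a] \<notin> rel A Fresh" and xs: "xs \<in> rel A R"
  shows "a \<notin> set xs"
proof -
  obtain r and C :: "(sym, 'a) struct set" where C: "\<And>B. B \<in> C \<Longrightarrow> represents s (val_of s B) B"
    "A = mulf (voc s) r id C"
    using represents_MulD[OF rep] by metis
  have "\<exists>B \<in> C. set xs \<subseteq> univ B"
  proof (cases R)
    case (SymL R)
    then show ?thesis using xs represents_rel[OF C(1)] unfolding C(2)
      by (fastforce simp: rel_mulf_SymL split: if_splits)
  qed (use xs in \<open>auto simp: C(2) rel_mulf_Fresh rel_mulf_SymR\<close>)
  then show ?thesis using a unfolding C(2) by (auto simp: rel_mulf_Fresh)
qed

text \<open>That the universe does not change is what allows elements to be distinguished
  repeatedly. For a multiset this holds because \<open>block\<close> and \<open>rest\<close> have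
  complementary universes.\<close>

lemma dstruct_represents:
  "represents s v A \<Longrightarrow> a \<in> univ A \<Longrightarrow>
    univ (dstruct s A a) = univ A \<and> represents (dty s) (val_of (dty s) (dstruct s A a)) (dstruct s A a)"
proof (induction s arbitrary: v A)
  case TOne
  from represents_val_of[OF TOne(1)] show ?case by simp
next
  case (TSum s t)
  from TSum.prems(1) show ?case
  proof (cases rule: represents_SumD)
    case (Inl w)
    let ?B = "dstruct s (unl A) a"
    have B: "univ ?B = univ A" "represents (dty s) (val_of (dty s) ?B) ?B"
      using TSum.IH(1)[OF Inl(2)] TSum.prems(2) by auto
    show ?thesis using B(1) Inl(4) represents_val_of[OF represents_SumI(1)[OF B(2)]] by simp
  next
    case (Inr w)
    let ?B = "dstruct t (unr A) a"
    have B: "univ ?B = univ A" "represents (dty t) (val_of (dty t) ?B) ?B"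
      using TSum.IH(2)[OF Inr(2)] TSum.prems(2) by auto
    show ?thesis using B(1) Inr(4) represents_val_of[OF represents_SumI(2)[OF B(2)]] by simp
  qed
next
  case (TProd s t)
  from TProd.prems(1) obtain w w' where A: "represents s w (fst_struct A)" "represents t w' (snd_struct A)"
    "univ (fst_struct A) \<inter> univ (snd_struct A) = {}" by (rule represents_ProdD)
  have u: "univ (fst_struct A) \<union> univ (snd_struct A) = univ A"
    by (auto simp: univ_fst_struct univ_snd_struct)
  show ?case
  proof (cases "[a] \<in> rel A Fresh")
    case True
    let ?B = "dstruct s (fst_struct A) a"
    have B: "univ ?B = univ (fst_struct A)" "represents (dty s) (val_of (dty s) ?B) ?B"
      using TProd.IH(1)[OF A(1)] True TProd.prems(2) by (auto simp: univ_fst_struct)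
    have "represents (dty (TProd s t)) (VInl (VPair (val_of (dty s) ?B) w')) (dstruct (TProd s t) A a)"
      using B A True by (auto intro!: represents_SumI represents_Pair)
    from represents_val_of[OF this] show ?thesis using True B(1) u by (simp del: dty.simps)
  next
    case False
    let ?B = "dstruct t (snd_struct A) a"
    have B: "univ ?B = univ (snd_struct A)" "represents (dty t) (val_of (dty t) ?B) ?B"
      using TProd.IH(2)[OF A(2)] False TProd.prems(2) by (auto simp: univ_snd_struct)
    have "represents (dty (TProd s t)) (VInr (VPair w (val_of (dty t) ?B))) (dstruct (TProd s t) A a)"
      using B A False by (auto intro!: represents_SumI represents_Pair)
    from represents_val_of[OF this] show ?thesis using False B(1) u by (simp del: dty.simps)
  qed
next
  case (TMul s)
  show ?case
  proof (cases "[a, a] \<in> rel A Fresh")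
    case True
    obtain r where r: "univ A = insert r (\<Union>c\<in>roots s A. univ (block (voc s) A c))"
      "[x, x] \<notin> rel A Fresh \<longleftrightarrow> x = r" if "x \<in> univ A" for x
      using represents_Mul_univ[OF TMul.prems(1)] by metis
    then obtain c where c: "c \<in> roots s A" "a \<in> univ (block (voc s) A c)"
      using True TMul.prems(2) by blast
    note e = represents_Mul_elem[OF TMul.prems(1) c]
    obtain w where w: "represents s w (block (voc s) A a)"
      using represents_Mul_roots[OF TMul.prems(1)] c e(1) by metis
    let ?B = "dstruct s (block (voc s) A a) a"
    have "a \<in> univ (block (voc s) A a)" using c e by simp
    from TMul.IH[OF w this] have B: "univ ?B = univ (block (voc s) A a)"
      "represents (dty s) (val_of (dty s) ?B) ?B" by auto
    have d: "univ (block (voc s) A a) \<inter> univ (rest A a) = {}" by (auto simp: univ_block univ_rest)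
    have "univ (block (voc s) A a) \<subseteq> univ A"
      using represents_rel[OF TMul.prems(1)] by (fastforce simp: univ_block)
    then have u: "univ (block (voc s) A a) \<union> univ (rest A a) = univ A"
      by (auto simp: univ_block univ_rest)
    have "represents (dty (TMul s)) (VInr (VPair (val_of (dty s) ?B)
        (VMul (elems v - {#val_of s (block (voc s) A c)#})))) (dstruct (TMul s) A a)"
      using True B d e(2) by (auto intro!: represents_SumI represents_Pair)
    from represents_val_of[OF this] show ?thesis using True B(1) u by (simp del: dty.simps)
  next
    case False
    then have "represents (dty (TMul s)) (VInl v) (dstruct (TMul s) A a)"
      using TMul.prems by (auto intro: represents_SumI)
    from represents_val_of[OF this] show ?thesis using False by (simp del: dty.simps)
  qed
qed

lemmas dstruct_univ = dstruct_represents[THEN conjunct1]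
lemmas dstruct_val = dstruct_represents[THEN conjunct2]

text \<open>A product rule. An element of a pair comes from the left or the right factor, and
  \<open>dv_strength\<close> attaches the other factor. An element of a multiset is the root or lies
  in a class; \<open>choices_fn\<close> splits off that class, and \<open>dv_strength\<close>
  attaches the remaining multiset to each of its points.\<close>

lemma dv_points:
  "\<exists>g. dv s (TMul (dty s)) (\<lambda>v. VMul (g v)) \<and>
    (\<forall>v (A :: (sym, 'a) struct). represents s v A \<longrightarrow> g v = (\<Sum>a\<in>univ A. {#val_of (dty s) (dstruct s A a)#}))"
proof (induction s)
  case TOne
  have "dv TOne (TMul TOne) (\<lambda>v. VMul {#v#})" by (intro dv_single dv_id)
  moreover have "{#v#} = (\<Sum>a\<in>univ A. {#val_of (dty TOne) (dstruct TOne A a)#})"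
    if "represents TOne v A" for v and A :: "(sym, 'a) struct"
    using that represents_OneD[OF that] by (auto simp: val_of_eq[OF that])
  ultimately show ?case by (intro exI[of _ "\<lambda>v. {#v#}"]) simp
next
  case (TSum s t)
  then obtain g h where
    g: "dv s (TMul (dty s)) (\<lambda>v. VMul (g v))"
      "\<And>v (A :: (sym, 'a) struct). represents s v A \<Longrightarrow> g v = (\<Sum>a\<in>univ A. {#val_of (dty s) (dstruct s A a)#})" and
    h: "dv t (TMul (dty t)) (\<lambda>v. VMul (h v))"
      "\<And>v (A :: (sym, 'a) struct). represents t v A \<Longrightarrow> h v = (\<Sum>a\<in>univ A. {#val_of (dty t) (dstruct t A a)#})"
    by blast
  define f where "f v = (case v of VInl x \<Rightarrow> image_mset VInl (g x) | VInr x \<Rightarrow> image_mset VInr (h x))" for v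
  have "dv (TSum s t) (TMul (dty (TSum s t))) (\<lambda>v. VMul (f v))"
    using dv_comp[OF g(1) dv_map[OF dv_inl[OF dv_id]]] dv_comp[OF h(1) dv_map[OF dv_inr[OF dv_id]]]
    by (intro dv_sum) (simp_all add: f_def)
  moreover have "f v = (\<Sum>a\<in>univ A. {#val_of (dty (TSum s t)) (dstruct (TSum s t) A a)#})"
    if "represents (TSum s t) v A" for v and A :: "(sym, 'a) struct"
    using that
  proof (cases rule: represents_SumD)
    case (Inl w)
    then have "f v = (\<Sum>a\<in>univ A. {#VInl (val_of (dty s) (dstruct s (unl A) a))#})"
      using g(2)[OF Inl(2)] by (simp add: f_def image_mset_sum_single)
    then show ?thesis using Inl(4) by (simp add: val_of_struct_rules(1)[OF dstruct_val[OF Inl(2)]])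
  next
    case (Inr w)
    then have "f v = (\<Sum>a\<in>univ A. {#VInr (val_of (dty t) (dstruct t (unr A) a))#})"
      using h(2)[OF Inr(2)] by (simp add: f_def image_mset_sum_single)
    then show ?thesis using Inr(4) by (simp add: val_of_struct_rules(2)[OF dstruct_val[OF Inr(2)]])
  qed
  ultimately show ?case by blast
next
  case (TProd s t)
  then obtain g h where
    g: "dv s (TMul (dty s)) (\<lambda>v. VMul (g v))"
      "\<And>v (A :: (sym, 'a) struct). represents s v A \<Longrightarrow> g v = (\<Sum>a\<in>univ A. {#val_of (dty s) (dstruct s A a)#})" and
    h: "dv t (TMul (dty t)) (\<lambda>v. VMul (h v))"
      "\<And>v (A :: (sym, 'a) struct). represents t v A \<Longrightarrow> h v = (\<Sum>a\<in>univ A. {#val_of (dty t) (dstruct t A a)#})"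
    by blast
  define f1 where "f1 v = image_mset (\<lambda>d. VInl (VPair d (vsnd v))) (g (vfst v))" for v
  define f2 where "f2 v = image_mset (\<lambda>d. VInr (VPair (vfst v) d)) (h (vsnd v))" for v
  let ?T = "dty (TProd s t)"
  have "dv (TProd s t) (TProd (TMul (dty s)) t) (\<lambda>v. VPair (VMul (g (vfst v))) (vsnd v))"
    by (intro dv_pair dv_comp[OF dv_fst[OF dv_id] g(1)] dv_snd[OF dv_id])
  from dv_comp[OF dv_comp[OF this dv_strength] dv_map[OF dv_inl[OF dv_id]]]
  have 1: "dv (TProd s t) (TMul ?T) (\<lambda>v. VMul (f1 v))"
    by (simp add: f1_def image_mset.compositionality comp_def)
  have "dv (TProd s t) (TProd (TMul (dty t)) s) (\<lambda>v. VPair (VMul (h (vsnd v))) (vfst v))"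
    by (intro dv_pair dv_comp[OF dv_snd[OF dv_id] h(1)] dv_fst[OF dv_id])
  from dv_comp[OF dv_comp[OF this dv_strength] dv_map[OF dv_inr[OF dv_pair[OF dv_snd[OF dv_id] dv_fst[OF dv_id]]]]]
  have 2: "dv (TProd s t) (TMul ?T) (\<lambda>v. VMul (f2 v))"
    by (simp add: f2_def image_mset.compositionality comp_def)
  have "f1 v + f2 v = (\<Sum>a\<in>univ A. {#val_of ?T (dstruct (TProd s t) A a)#})"
    if rep: "represents (TProd s t) v A" for v and A :: "(sym, 'a) struct"
  proof -
    let ?A = "fst_struct A" and ?B = "snd_struct A"
    from rep obtain w w' where A: "v = VPair w w'" "represents s w ?A" "represents t w' ?B"
      "univ ?A \<inter> univ ?B = {}" by (rule represents_ProdD)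
    have u: "univ A = univ ?A \<union> univ ?B" by (auto simp: univ_fst_struct univ_snd_struct)
    have "val_of ?T (dstruct (TProd s t) A a) = VInl (VPair (val_of (dty s) (dstruct s ?A a)) w')"
      if a: "a \<in> univ ?A" for a
      using a dstruct_represents[OF A(2) a] A
      by (intro val_of_eq) (auto simp: univ_fst_struct intro!: represents_SumI represents_Pair)
    moreover have "val_of ?T (dstruct (TProd s t) A a) = VInr (VPair w (val_of (dty t) (dstruct t ?B a)))"
      if a: "a \<in> univ ?B" for a
      using a dstruct_represents[OF A(3) a] A
      by (intro val_of_eq) (auto simp: univ_snd_struct intro!: represents_SumI represents_Pair)
    ultimately show ?thesis
      using represents_finite[OF A(2)] represents_finite[OF A(3)] A(4)
      by (simp add: u sum.union_disjoint f1_def f2_def A(1) g(2)[OF A(2)] h(2)[OF A(3)] image_mset_sum_single)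
  qed
  with dv_plus[OF 1 2] show ?case by (intro exI[of _ "\<lambda>v. f1 v + f2 v"]) blast
next
  case (TMul s)
  then obtain g where
    g: "dv s (TMul (dty s)) (\<lambda>v. VMul (g v))"
      "\<And>v (A :: (sym, 'a) struct). represents s v A \<Longrightarrow> g v = (\<Sum>a\<in>univ A. {#val_of (dty s) (dstruct s A a)#})"
    by blast
  let ?T = "dty (TMul s)"
  define f where "f v = image_mset (\<lambda>d. VInr (VPair d (vsnd v))) (g (vfst v))" for v
  have "dv (TProd s (TMul s)) (TProd (TMul (dty s)) (TMul s)) (\<lambda>v. VPair (VMul (g (vfst v))) (vsnd v))"
    by (intro dv_pair dv_comp[OF dv_fst[OF dv_id] g(1)] dv_snd[OF dv_id])
  from dv_comp[OF dv_comp[OF this dv_strength] dv_map[OF dv_inr[OF dv_id]]]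
  have 1: "dv (TProd s (TMul s)) (TMul ?T) (\<lambda>v. VMul (f v))"
    by (simp add: f_def image_mset.compositionality comp_def)
  have c: "dv (TMul s) (TMul (TProd s (TMul s))) choices_fn"
    unfolding dv_def by (rule derivable_choices)
  define F where "F v = (\<Sum>x\<in>#elems (choices_fn v). f x)" for v
  have 2: "dv (TMul s) (TMul ?T) (\<lambda>v. VMul (add_mset (VInl v) (F v)))"
    using dv_comp[OF c dv_bind[OF 1]] by (intro dv_add dv_inl) (simp_all add: F_def dv_inl dv_id)
  have "add_mset (VInl v) (F v) = (\<Sum>a\<in>univ A. {#val_of ?T (dstruct (TMul s) A a)#})"
    if rep: "represents (TMul s) v A" for v and A :: "(sym, 'a) struct"
  proof -
    define H where "H = block (voc s) A"
    define C where "C = roots s A"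
    have H: "finite C" "represents s (val_of s (H c)) (H c)" "disjoint_family_struct H C"
      "v = VMul (\<Sum>c\<in>C. {#val_of s (H c)#})" if "c \<in> C" for c
      using represents_Mul_roots[OF rep] that unfolding H_def C_def by metis+
    have H': "finite C" "disjoint_family_struct H C" "v = VMul (\<Sum>c\<in>C. {#val_of s (H c)#})"
      using represents_Mul_roots[OF rep] unfolding H_def C_def by metis+
    obtain r where r: "univ A = insert r (\<Union>c\<in>C. univ (H c))" "\<And>c. c \<in> C \<Longrightarrow> r \<notin> univ (H c)"
      "\<And>x. x \<in> univ A \<Longrightarrow> [x, x] \<notin> rel A Fresh \<longleftrightarrow> x = r"
      using represents_Mul_univ[OF rep] unfolding H_def C_def by metis
    have "val_of ?T (dstruct (TMul s) A r) = VInl v"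
      using r rep by (intro val_of_eq) (auto intro: represents_SumI)
    moreover have "val_of ?T (dstruct (TMul s) A a) =
        VInr (VPair (val_of (dty s) (dstruct s (H c) a)) (VMul (elems v - {#val_of s (H c)#})))"
      if ca: "c \<in> C" "a \<in> univ (H c)" for c a
    proof (rule val_of_eq)
      have 3: "H a = H c" "represents (TMul s) (VMul (elems v - {#val_of s (H c)#})) (rest A a)"
        "[a, a] \<in> rel A Fresh"
        using represents_Mul_elem[OF rep, of c a] ca unfolding H_def C_def by auto
      have 4: "univ (H c) \<inter> univ (rest A a) = {}"
        using 3(1)[symmetric] by (auto simp: univ_rest H_def univ_block)
      from 3 4 dstruct_represents[OF H(2)[OF ca(1)] ca(2)]
      show "represents ?T (VInr (VPair (val_of (dty s) (dstruct s (H c) a)) (VMul (elems v - {#val_of s (H c)#}))))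
          (dstruct (TMul s) A a)"
        by (auto simp: H_def[symmetric] intro!: represents_SumI represents_Pair)
    qed
    moreover have "finite (univ (H c))" if "c \<in> C" for c using H(2)[OF that] represents_finite by blast
    ultimately have "(\<Sum>a\<in>univ A. {#val_of ?T (dstruct (TMul s) A a)#}) = add_mset (VInl v)
        (\<Sum>c\<in>C. \<Sum>a\<in>univ (H c). {#VInr (VPair (val_of (dty s) (dstruct s (H c) a)) (VMul (elems v - {#val_of s (H c)#})))#})"
      using H'(1,2) r(2) unfolding r(1)
      by (subst sum.insert) (auto simp: sum.UNION_disjoint disjoint_family_struct_def)
    moreover have "F v = (\<Sum>c\<in>C. f (VPair (val_of s (H c)) (VMul (elems v - {#val_of s (H c)#}))))"
    proof -
      have "F v = (\<Sum>x\<in>#elems v. f (VPair x (VMul (elems v - {#x#}))))"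
        by (simp add: F_def choices_fn_def image_mset.compositionality comp_def)
      also have "elems v = (\<Sum>c\<in>C. {#val_of s (H c)#})" by (simp add: H'(3))
      finally show ?thesis by (simp add: sum_mset_sum_single H'(3))
    qed
    ultimately show ?thesis
      using g(2)[OF H(2)] by (simp add: f_def image_mset_sum_single)
  qed
  with 2 show ?case by (intro exI[of _ "\<lambda>v. add_mset (VInl v) (F v)"]) blast
qed

section \<open>Tuples of distinguished elements\<close>

primrec dtys :: "nat \<Rightarrow> mty \<Rightarrow> mty" where
  "dtys 0 s = s"
| "dtys (Suc n) s = dtys n (dty s)"

primrec dstructs :: "'a list \<Rightarrow> mty \<Rightarrow> (sym, 'a) struct \<Rightarrow> (sym, 'a) struct" where
  "dstructs [] s A = A"
| "dstructs (a # as) s A = dstructs as (dty s) (dstruct s A a)"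

lemma dtys_add: "dtys (m + n) s = dtys n (dtys m s)"
  by (induction m arbitrary: s) auto

lemma dstructs_append: "dstructs (as @ bs) s A = dstructs bs (dtys (length as) s) (dstructs as s A)"
  by (induction as arbitrary: s A) auto

lemma dstructs_represents:
  "represents s v A \<Longrightarrow> set as \<subseteq> univ A \<Longrightarrow> length as = n \<Longrightarrow>
    univ (dstructs as s A) = univ A \<and> represents (dtys n s) (val_of (dtys n s) (dstructs as s A)) (dstructs as s A)"
proof (induction as arbitrary: s v A n)
  case Nil
  from represents_val_of[OF Nil(1)] show ?case using Nil by simp
next
  case (Cons a as)
  have d: "univ (dstruct s A a) = univ A"
    "represents (dty s) (val_of (dty s) (dstruct s A a)) (dstruct s A a)"
    using dstruct_represents[OF Cons.prems(1)] Cons.prems(2) by auto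
  from Cons.IH[OF d(2)] d(1) Cons.prems show ?case by auto
qed

text \<open>Iterates \<open>dv_points\<close>. Each step keeps the whole universe, so an element may
  be distinguished again and all \<open>k\<close>-tuples occur, including those with
  repetitions.\<close>

lemma dv_tuples:
  "\<exists>g. dv s (TMul (dtys k s)) (\<lambda>v. VMul (g v)) \<and>
    (\<forall>v (A :: (sym, 'a) struct). represents s v A \<longrightarrow>
      g v = (\<Sum>as\<in>{as. set as \<subseteq> univ A \<and> length as = k}. {#val_of (dtys k s) (dstructs as s A)#}))"
proof (induction k arbitrary: s)
  case 0
  have "dv s (TMul (dtys 0 s)) (\<lambda>v. VMul {#v#})" by (simp add: dv_single dv_id)
  moreover have "{as. set as \<subseteq> univ A \<and> length as = 0} = {[]}" for A :: "(sym, 'a) struct" by auto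
  ultimately show ?case by (intro exI[of _ "\<lambda>v. {#v#}"]) (simp add: val_of_eq)
next
  case (Suc k)
  obtain g where g: "dv s (TMul (dty s)) (\<lambda>v. VMul (g v))"
      "\<And>v (A :: (sym, 'a) struct). represents s v A \<Longrightarrow> g v = (\<Sum>a\<in>univ A. {#val_of (dty s) (dstruct s A a)#})"
    using dv_points by blast
  obtain h where h: "dv (dty s) (TMul (dtys k (dty s))) (\<lambda>v. VMul (h v))"
      "\<And>v (A :: (sym, 'a) struct). represents (dty s) v A \<Longrightarrow>
        h v = (\<Sum>as\<in>{as. set as \<subseteq> univ A \<and> length as = k}. {#val_of (dtys k (dty s)) (dstructs as (dty s) A)#})"
    using Suc.IH by blast
  define f where "f v = (\<Sum>x\<in>#g v. h x)" for v
  have "dv s (TMul (dtys (Suc k) s)) (\<lambda>v. VMul (f v))"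
    using dv_comp[OF g(1) dv_bind[OF h(1)]] by (simp add: f_def)
  moreover have "f v = (\<Sum>as\<in>{as. set as \<subseteq> univ A \<and> length as = Suc k}. {#val_of (dtys (Suc k) s) (dstructs as s A)#})"
    if rep: "represents s v A" for v and A :: "(sym, 'a) struct"
  proof -
    let ?L = "\<lambda>k. {as. set as \<subseteq> univ A \<and> length as = k}"
    have fin: "finite (univ A)" "finite (?L k)" using represents_finite[OF rep] by (auto intro: finite_lists_length_eq)
    have "f v = (\<Sum>a\<in>univ A. h (val_of (dty s) (dstruct s A a)))"
      by (simp add: f_def g(2)[OF rep] sum_mset_sum_single)
    also have "\<dots> = (\<Sum>a\<in>univ A. \<Sum>as\<in>?L k. {#val_of (dtys (Suc k) s) (dstructs (a # as) s A)#})"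
      by (intro sum.cong refl) (simp add: h(2)[OF dstruct_val[OF rep]] dstruct_univ[OF rep])
    also have "\<dots> = (\<Sum>(a, as)\<in>univ A \<times> ?L k. {#val_of (dtys (Suc k) s) (dstructs (a # as) s A)#})"
      by (simp add: sum.cartesian_product)
    also have "\<dots> = (\<Sum>as\<in>?L (Suc k). {#val_of (dtys (Suc k) s) (dstructs as s A)#})"
      by (rule sum.reindex_bij_witness[of _ "\<lambda>as. (hd as, tl as)" "\<lambda>(a, as). a # as"])
        (auto simp: length_Suc_conv)
    finally show ?thesis .
  qed
  ultimately show ?case by blast
qed

section \<open>Deciding formulas by derivable functions\<close>

primrec qf :: "'s fo \<Rightarrow> bool" where
  "qf FFalse \<longleftrightarrow> True"
| "qf (FRel R xs) \<longleftrightarrow> True"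
| "qf (FEq x y) \<longleftrightarrow> True"
| "qf (FNot \<phi>) \<longleftrightarrow> qf \<phi>"
| "qf (FAnd \<phi> \<psi>) \<longleftrightarrow> qf \<phi> \<and> qf \<psi>"
| "qf (FEx x \<phi>) \<longleftrightarrow> False"

definition FTrue :: "'s fo" where "FTrue = FNot FFalse"

definition FOr :: "'s fo \<Rightarrow> 's fo \<Rightarrow> 's fo" where
  "FOr \<phi> \<psi> = FNot (FAnd (FNot \<phi>) (FNot \<psi>))"

definition FIf :: "'s fo \<Rightarrow> 's fo \<Rightarrow> 's fo \<Rightarrow> 's fo" where
  "FIf \<chi> \<phi> \<psi> = FOr (FAnd \<chi> \<phi>) (FAnd (FNot \<chi>) \<psi>)"

primrec FAll :: "(nat \<Rightarrow> 's fo) \<Rightarrow> nat list \<Rightarrow> 's fo" where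
  "FAll P [] = FTrue"
| "FAll P (x # xs) = FAnd (P x) (FAll P xs)"

lemma FTrue_simps [simp]: "sat A \<nu> FTrue" "qf FTrue" "free_vars FTrue = {}" "fo_over V FTrue"
  by (simp_all add: FTrue_def)

lemma FOr_simps [simp]: "sat A \<nu> (FOr \<phi> \<psi>) \<longleftrightarrow> sat A \<nu> \<phi> \<or> sat A \<nu> \<psi>"
  "qf (FOr \<phi> \<psi>) \<longleftrightarrow> qf \<phi> \<and> qf \<psi>" "free_vars (FOr \<phi> \<psi>) = free_vars \<phi> \<union> free_vars \<psi>"
  "fo_over V (FOr \<phi> \<psi>) \<longleftrightarrow> fo_over V \<phi> \<and> fo_over V \<psi>"
  by (simp_all add: FOr_def)

lemma FIf_simps [simp]: "sat A \<nu> (FIf \<chi> \<phi> \<psi>) \<longleftrightarrow> (if sat A \<nu> \<chi> then sat A \<nu> \<phi> else sat A \<nu> \<psi>)"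
  "qf (FIf \<chi> \<phi> \<psi>) \<longleftrightarrow> qf \<chi> \<and> qf \<phi> \<and> qf \<psi>"
  "free_vars (FIf \<chi> \<phi> \<psi>) = free_vars \<chi> \<union> free_vars \<phi> \<union> free_vars \<psi>"
  "fo_over V (FIf \<chi> \<phi> \<psi>) \<longleftrightarrow> fo_over V \<chi> \<and> fo_over V \<phi> \<and> fo_over V \<psi>"
  by (auto simp: FIf_def)

lemma FAll_simps [simp]: "sat A \<nu> (FAll P xs) \<longleftrightarrow> (\<forall>x \<in> set xs. sat A \<nu> (P x))"
  "qf (FAll P xs) \<longleftrightarrow> (\<forall>x \<in> set xs. qf (P x))"
  "free_vars (FAll P xs) = (\<Union>x \<in> set xs. free_vars (P x))"
  "fo_over V (FAll P xs) \<longleftrightarrow> (\<forall>x \<in> set xs. fo_over V (P x))"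
  by (induction xs) auto

lemma qf_map_fo [simp]: "qf (map_fo g \<phi>) \<longleftrightarrow> qf \<phi>"
  by (induction \<phi>) auto

lemma free_vars_map_fo [simp]: "free_vars (map_fo g \<phi>) = free_vars \<phi>"
  by (induction \<phi>) auto

lemma fo_over_map_fo: "fo_over W \<phi> \<Longrightarrow> (\<And>R n. W R = Some n \<Longrightarrow> V (g R) = Some n) \<Longrightarrow> fo_over V (map_fo g \<phi>)"
  by (induction \<phi>) auto

text \<open>\<open>A\<close> and \<open>B\<close> may have different universes, for instance a
  product and one of its factors; this is why quantifiers are excluded.\<close>

lemma sat_map_fo: "qf \<phi> \<Longrightarrow> (\<And>R. rel A (g R) = rel B R) \<Longrightarrow> sat A \<nu> (map_fo g \<phi>) \<longleftrightarrow> sat B \<nu> \<phi>"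
  by (induction \<phi>) auto

text \<open>Quantifier-free formulas over \<^const>\<open>dstruct\<close> that express the atoms of the original
  structure. The variables in \<open>Z\<close> stand for the distinguished element.\<close>

primrec eqf :: "mty \<Rightarrow> nat \<Rightarrow> sym fo" where
  "eqf TOne x = FTrue"
| "eqf (TSum s t) x = FIf (FRel Fresh []) (map_fo SymL (eqf s x)) (map_fo SymR (eqf t x))"
| "eqf (TProd s t) x = FIf (FRel Fresh [])
     (FAnd (FRel (SymL Fresh) [x]) (map_fo (SymL \<circ> SymL) (eqf s x)))
     (FAnd (FNot (FRel (SymR Fresh) [x])) (map_fo (SymR \<circ> SymR) (eqf t x)))"
| "eqf (TMul s) x = FIf (FRel Fresh []) (FNot (FRel (SymL Fresh) [x, x]))
     (FAnd (FRel (SymR Fresh) [x]) (map_fo (SymR \<circ> SymL) (eqf s x)))"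

text \<open>For relations of a part that does not contain the distinguished element: no tuple of
  such a relation can mention that element.\<close>

definition outside :: "nat set \<Rightarrow> nat list \<Rightarrow> 's fo \<Rightarrow> 's fo" where
  "outside Z xs \<phi> = (if set xs \<inter> Z = {} then \<phi> else FFalse)"

text \<open>The recursive formula is correct only for values inside the part that contains the
  distinguished element, so the guards confine the remaining variables to it. In the case of
  \<open>TMul\<close>, a symbol that was nullary in the class has become unary, and its argument is
  dropped again.\<close>

primrec relf :: "mty \<Rightarrow> sym \<Rightarrow> nat list \<Rightarrow> nat set \<Rightarrow> sym fo" where
  "relf TOne R xs Z = FFalse"
| "relf (TSum s t) R xs Z = (case R of Fresh \<Rightarrow> FRel Fresh []
     | SymL R \<Rightarrow> FAnd (FRel Fresh []) (map_fo SymL (relf s R xs Z))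
     | SymR R \<Rightarrow> FAnd (FNot (FRel Fresh [])) (map_fo SymR (relf t R xs Z)))"
| "relf (TProd s t) R xs Z = (case R of
       Fresh \<Rightarrow> if set xs \<subseteq> Z then FRel Fresh []
         else FIf (FRel Fresh []) (FRel (SymL Fresh) xs) (FRel (SymR Fresh) xs)
     | SymL R \<Rightarrow> FIf (FRel Fresh [])
         (FAnd (FAll (\<lambda>x. if x \<in> Z then FTrue else FRel (SymL Fresh) [x]) xs) (map_fo (SymL \<circ> SymL) (relf s R xs Z)))
         (outside Z xs (FRel (SymR (SymL R)) xs))
     | SymR R \<Rightarrow> FIf (FRel Fresh []) (outside Z xs (FRel (SymL (SymR R)) xs))
         (FAnd (FAll (\<lambda>x. if x \<in> Z then FTrue else FNot (FRel (SymR Fresh) [x])) xs)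
           (map_fo (SymR \<circ> SymR) (relf t R xs Z))))"
| "relf (TMul s) R xs Z = FIf (FRel Fresh []) (outside Z xs (FRel (SymL R) xs))
     (FOr (FAnd (FAll (\<lambda>x. if x \<in> Z then FTrue else FRel (SymR Fresh) [x]) xs)
            (case R of Fresh \<Rightarrow> FTrue
              | SymL R \<Rightarrow> map_fo (SymR \<circ> SymL) (relf s R (if voc s R = Some 0 then [] else xs) Z)
              | SymR R \<Rightarrow> FFalse))
       (outside Z xs (FRel (SymR (SymR R)) xs)))"

lemma outside_simps [simp]: "sat A \<nu> (outside Z xs \<phi>) \<longleftrightarrow> set xs \<inter> Z = {} \<and> sat A \<nu> \<phi>"
  "qf \<phi> \<Longrightarrow> qf (outside Z xs \<phi>)" "fo_over V \<phi> \<Longrightarrow> fo_over V (outside Z xs \<phi>)"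
  by (auto simp: outside_def)

lemma free_vars_outside: "free_vars (outside Z xs (FRel R xs)) \<subseteq> set xs - Z"
  by (auto simp: outside_def)

lemma free_vars_guard:
  "(\<Union>x \<in> set xs. free_vars (if x \<in> Z then FTrue else FRel S [x])) \<subseteq> set xs - Z"
  "(\<Union>x \<in> set xs. free_vars (if x \<in> Z then FTrue else FNot (FRel S [x]))) \<subseteq> set xs - Z"
  by (auto split: if_splits)

lemma qf_eqf [simp]: "qf (eqf s x)" and free_vars_eqf: "free_vars (eqf s x) \<subseteq> {x}"
  by (induction s) auto

lemma fo_over_eqf: "fo_over (voc (dty s)) (eqf s x)"
  by (induction s) (auto intro!: fo_over_map_fo)

lemma qf_relf [simp]: "qf (relf s R xs Z)"
  by (induction s arbitrary: R xs) (auto split: sym.split)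

lemma free_vars_relf: "voc s R = Some (length xs) \<Longrightarrow> free_vars (relf s R xs Z) \<subseteq> set xs - Z"
proof (induction s arbitrary: R xs)
  case (TSum s t)
  then show ?case by (cases R) auto
next
  case (TProd s t)
  note [simp] = free_vars_outside free_vars_guard
  show ?case
  proof (cases R)
    case Fresh
    then have "length xs = Suc 0" using TProd.prems by simp
    then obtain x where "xs = [x]" by (cases xs) auto
    then show ?thesis using Fresh by simp
  qed (use TProd in simp_all)
next
  case (TMul s)
  note [simp] = free_vars_outside free_vars_guard
  show ?case
  proof (cases R)
    case (SymL R')
    then show ?thesis using TMul.IH[of R' xs] TMul.IH[of R' "[]"] TMul.prems by (simp split: if_splits)
  qed (use TMul.prems in simp_all)
qed simp

lemma fo_over_relf: "voc s R = Some (length xs) \<Longrightarrow> fo_over (voc (dty s)) (relf s R xs Z)"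
proof (induction s arbitrary: R xs)
  case (TMul s)
  then show ?case
    by (cases R) (auto intro!: fo_over_map_fo split: if_splits)
qed (auto split: sym.splits intro!: fo_over_map_fo)

lemma sat_eqf:
  "represents s v A \<Longrightarrow> a \<in> univ A \<Longrightarrow> \<nu> x \<in> univ A \<Longrightarrow> sat (dstruct s A a) \<nu> (eqf s x) \<longleftrightarrow> \<nu> x = a"
proof (induction s arbitrary: v A)
  case TOne
  then show ?case by (auto dest: represents_OneD)
next
  case (TSum s t)
  from TSum.prems(1) show ?case
  proof (cases rule: represents_SumD)
    case (Inl w)
    show ?thesis using TSum.IH(1)[OF Inl(2)] TSum.prems Inl(4)
      by (simp add: sat_map_fo[where B = "dstruct s (unl A) a"])
  next
    case (Inr w)
    show ?thesis using TSum.IH(2)[OF Inr(2)] TSum.prems Inr(4)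
      by (simp add: sat_map_fo[where B = "dstruct t (unr A) a"])
  qed
next
  case (TProd s t)
  from TProd.prems(1) obtain w w' where A: "represents s w (fst_struct A)" "represents t w' (snd_struct A)"
    by (rule represents_ProdD)
  show ?case
  proof (cases "[a] \<in> rel A Fresh")
    case True
    then have "a \<in> univ (fst_struct A)" using TProd.prems by (simp add: univ_fst_struct)
    with True TProd.IH(1)[OF A(1)] TProd.prems dstruct_univ[OF A(1)] show ?thesis
      by (auto simp: sat_map_fo[where B = "dstruct s (fst_struct A) a"] univ_fst_struct)
  next
    case False
    then have "a \<in> univ (snd_struct A)" using TProd.prems by (simp add: univ_snd_struct)
    with False TProd.IH(2)[OF A(2)] TProd.prems dstruct_univ[OF A(2)] show ?thesis
      by (auto simp: sat_map_fo[where B = "dstruct t (snd_struct A) a"] univ_fst_struct univ_snd_struct)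
  qed
next
  case (TMul s)
  show ?case
  proof (cases "[a, a] \<in> rel A Fresh")
    case True
    obtain w where w: "represents s w (block (voc s) A a)"
      using represents_Mul_block[OF TMul.prems(1) True] by blast
    have a: "a \<in> univ (block (voc s) A a)" using True by (simp add: univ_block)
    show ?thesis using True TMul.IH[OF w a] a dstruct_univ[OF w a]
      by (auto simp: sat_map_fo[where B = "dstruct s (block (voc s) A a) a"])
  next
    case False
    obtain r where "\<And>x. x \<in> univ A \<Longrightarrow> [x, x] \<notin> rel A Fresh \<longleftrightarrow> x = r"
      using represents_Mul_univ[OF TMul.prems(1)] by metis
    with False TMul.prems show ?thesis by auto
  qed
qed

lemma sat_relf:
  assumes "represents s v A" "a \<in> univ A" "voc s R = Some (length xs)" "\<And>x. x \<in> set xs - Z \<Longrightarrow> \<nu> x \<in> univ A"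
  shows "sat (dstruct s A a) \<nu> (relf s R xs Z) \<longleftrightarrow> map (\<lambda>x. if x \<in> Z then a else \<nu> x) xs \<in> rel A R"
  using assms
proof (induction s arbitrary: v A R xs)
  case TOne
  then show ?case by simp
next
  case (TSum s t)
  from TSum.prems(1) show ?case
  proof (cases rule: represents_SumD)
    case (Inl w)
    have "rel A (SymR R) = {}" for R by (subst Inl(3)) simp
    then show ?thesis using TSum.IH(1)[OF Inl(2), of _ xs] TSum.prems(2-) Inl(4)
      by (cases R) (simp_all add: sat_map_fo[where B = "dstruct s (unl A) a"])
  next
    case (Inr w)
    have "rel A (SymL R) = {}" for R by (subst Inr(3)) simp
    then show ?thesis using TSum.IH(2)[OF Inr(2), of _ xs] TSum.prems(2-) Inr(4)
      by (cases R) (simp_all add: sat_map_fo[where B = "dstruct t (unr A) a"])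
  qed
next
  case (TProd s t)
  let ?f = "\<lambda>x. if x \<in> Z then a else \<nu> x"
  from TProd.prems(1) obtain w w' where A: "represents s w (fst_struct A)" "represents t w' (snd_struct A)"
    by (rule represents_ProdD)
  have relL: "set xs \<subseteq> univ (fst_struct A)" if "xs \<in> rel A (SymL R)" for xs R
    using represents_rel[OF A(1), of xs R] that by simp
  have relR: "set xs \<subseteq> univ (snd_struct A)" if "xs \<in> rel A (SymR R)" for xs R
    using represents_rel[OF A(2), of xs R] that by simp
  have disj: "univ (fst_struct A) \<inter> univ (snd_struct A) = {}"
    by (auto simp: univ_fst_struct univ_snd_struct)
  show ?case
  proof (cases "[a] \<in> rel A Fresh")
    case True
    then have a: "a \<in> univ (fst_struct A)" using TProd.prems by (simp add: univ_fst_struct)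
    show ?thesis
    proof (cases R)
      case Fresh
      then have "length xs = Suc 0" using TProd.prems by simp
      then obtain x where "xs = [x]" by (cases xs) auto
      then show ?thesis using Fresh True TProd.prems a dstruct_univ[OF A(1) a] by (auto simp: univ_fst_struct)
    next
      case (SymL R')
      have "sat (dstruct s (fst_struct A) a) \<nu> (relf s R' xs Z) \<longleftrightarrow> map ?f xs \<in> rel A (SymL R')"
        if "\<forall>x \<in> set xs. x \<notin> Z \<longrightarrow> \<nu> x \<in> univ (fst_struct A)"
        using TProd.IH(1)[OF A(1) a, of R' xs] TProd.prems(3) SymL that by simp
      moreover have "map ?f xs \<notin> rel A (SymL R')"
        if "\<not> (\<forall>x \<in> set xs. x \<notin> Z \<longrightarrow> \<nu> x \<in> univ (fst_struct A))"
        using relL[of "map ?f xs" R'] that by auto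
      ultimately show ?thesis using True SymL dstruct_univ[OF A(1) a]
        by (auto simp: sat_map_fo[where B = "dstruct s (fst_struct A) a"])
    next
      case (SymR R')
      have "map ?f xs \<notin> rel A (SymR R')" if "set xs \<inter> Z \<noteq> {}"
        using relR[of "map ?f xs" R'] that a disj by auto
      moreover have "map ?f xs = map \<nu> xs" if "set xs \<inter> Z = {}"
        using that by auto
      ultimately have "map ?f xs \<in> rel A (SymR R') \<longleftrightarrow> set xs \<inter> Z = {} \<and> map \<nu> xs \<in> rel A (SymR R')"
        by metis
      then show ?thesis using True SymR by simp
    qed
  next
    case False
    then have a: "a \<in> univ (snd_struct A)" using TProd.prems by (simp add: univ_snd_struct)
    show ?thesis
    proof (cases R)
      case Fresh
      then have "length xs = Suc 0" using TProd.prems by simp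
      then obtain x where "xs = [x]" by (cases xs) auto
      then show ?thesis using Fresh False TProd.prems a dstruct_univ[OF A(2) a] by (auto simp: univ_fst_struct)
    next
      case (SymR R')
      have "sat (dstruct t (snd_struct A) a) \<nu> (relf t R' xs Z) \<longleftrightarrow> map ?f xs \<in> rel A (SymR R')"
        if "\<forall>x \<in> set xs. x \<notin> Z \<longrightarrow> \<nu> x \<in> univ (snd_struct A)"
        using TProd.IH(2)[OF A(2) a, of R' xs] TProd.prems(3) SymR that by simp
      moreover have "map ?f xs \<notin> rel A (SymR R')"
        if "\<not> (\<forall>x \<in> set xs. x \<notin> Z \<longrightarrow> \<nu> x \<in> univ (snd_struct A))"
        using relR[of "map ?f xs" R'] that by auto
      moreover have "(\<forall>x \<in> set xs. x \<notin> Z \<longrightarrow> \<nu> x \<notin> univ (fst_struct A)) \<longleftrightarrow>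
          (\<forall>x \<in> set xs. x \<notin> Z \<longrightarrow> \<nu> x \<in> univ (snd_struct A))"
        using TProd.prems(4) by (auto simp: univ_fst_struct univ_snd_struct)
      ultimately show ?thesis using False SymR dstruct_univ[OF A(2) a]
        by (auto simp: sat_map_fo[where B = "dstruct t (snd_struct A) a"])
    next
      case (SymL R')
      have "map ?f xs \<notin> rel A (SymL R')" if "set xs \<inter> Z \<noteq> {}"
        using relL[of "map ?f xs" R'] that a disj by auto
      moreover have "map ?f xs = map \<nu> xs" if "set xs \<inter> Z = {}"
        using that by auto
      ultimately have "map ?f xs \<in> rel A (SymL R') \<longleftrightarrow> set xs \<inter> Z = {} \<and> map \<nu> xs \<in> rel A (SymL R')"
        by metis
      then show ?thesis using False SymL by simp
    qed
  qed
next
  case (TMul s)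
  let ?f = "\<lambda>x. if x \<in> Z then a else \<nu> x"
  have eq: "map ?f xs = map \<nu> xs" if "set xs \<inter> Z = {}" using that by auto
  show ?case
  proof (cases "[a, a] \<in> rel A Fresh")
    case True
    let ?B = "block (voc s) A a"
    obtain w where w: "represents s w ?B"
      using represents_Mul_block[OF TMul.prems(1) True] by blast
    have a: "a \<in> univ ?B" using True by (simp add: univ_block)
    have u: "univ (dstruct s ?B a) = univ ?B" by (rule dstruct_univ[OF w a])
    define All where "All \<longleftrightarrow> (\<forall>x \<in> set xs. x \<notin> Z \<longrightarrow> \<nu> x \<in> univ ?B)"
    \<comment> \<open>Multiset types have no nullary symbols. Hence a tuple cannot be inside the
      class of \<open>a\<close> and at the same time vacuously outside of it, which keeps the two
      disjuncts of \<open>relf\<close> apart.\<close>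
    have ne: "xs \<noteq> []" using TMul.prems(3) by (cases R) (auto split: if_splits)
    have split: "All \<or> (\<forall>x \<in> set xs. ?f x \<notin> univ ?B)" if "map ?f xs \<in> rel A R"
      using represents_Mul_rel[OF TMul.prems(1) True that] a unfolding All_def by auto
      have "sat (dstruct s ?B a) \<nu> (relf s R' (if voc s R' = Some 0 then [] else xs) Z) \<longleftrightarrow> map ?f xs \<in> rel A R"
      if R': "R = SymL R'" and all: "All" for R'
    proof (cases "voc s R' = Some 0")
      case True
      \<comment> \<open>The unary symbol stems from a nullary symbol of the class. Since
        \<open>?f x\<close> lies in the class of \<open>a\<close>, both elements have the same block
        and so the same truth value.\<close>
      then obtain x where x: "xs = [x]" using TMul.prems(3) R' by (cases xs) auto
      then have "?f x \<in> univ ?B" using all a by (auto simp: All_def)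
      then have "block (voc s) A (?f x) = ?B" using represents_Mul_block[OF TMul.prems(1) \<open>[a, a] \<in> rel A Fresh\<close>] by blast
      then have "[] \<in> rel ?B R' \<longleftrightarrow> [] \<in> rel (block (voc s) A (?f x)) R'" by simp
      also have "\<dots> \<longleftrightarrow> [?f x] \<in> rel A (SymL R')" using True by (simp add: block_def)
      finally show ?thesis using TMul.IH[OF w a, of R' "[]"] True x R' by simp
    next
      case False
      then have "map ?f xs \<in> rel ?B R' \<longleftrightarrow> map ?f xs \<in> rel A (SymL R')"
        using all a by (auto simp: block_def univ_block All_def)
      then show ?thesis using TMul.IH[OF w a, of R' xs] False TMul.prems(3) R' all by (simp add: All_def)
    qed
    moreover have "map ?f xs \<in> rel A Fresh" if R': "R = Fresh" and all: "All"
    proof -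
      obtain x y where xy: "xs = [x, y]" using R' TMul.prems(3)
        by (cases xs; cases "tl xs") (auto simp: Suc_length_conv)
      then have "?f x \<in> univ ?B" "?f y \<in> univ ?B" using all a by (auto simp: All_def)
      then have "block (voc s) A (?f x) = ?B" using represents_Mul_block[OF TMul.prems(1) True] by blast
      with \<open>?f y \<in> univ ?B\<close> have "?f y \<in> univ (block (voc s) A (?f x))" by simp
      then show ?thesis by (simp add: xy univ_block)
    qed
    moreover have "R = SymR R' \<Longrightarrow> False" for R' using TMul.prems(3) by simp
    ultimately have main: "sat (dstruct s ?B a) \<nu> (case R of Fresh \<Rightarrow> FTrue
              | SymL R \<Rightarrow> relf s R (if voc s R = Some 0 then [] else xs) Z | SymR R \<Rightarrow> FFalse)
        \<longleftrightarrow> map ?f xs \<in> rel A R" if "All"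
      using that by (cases R) auto
    have "sat (dstruct (TMul s) A a) \<nu> (relf (TMul s) R xs Z) \<longleftrightarrow>
       All \<and> sat (dstruct s ?B a) \<nu> (case R of Fresh \<Rightarrow> FTrue
              | SymL R \<Rightarrow> relf s R (if voc s R = Some 0 then [] else xs) Z | SymR R \<Rightarrow> FFalse)
       \<or> set xs \<inter> Z = {} \<and> map \<nu> xs \<in> rel (rest A a) R"
      using True u by (cases R) (auto simp: All_def sat_map_fo[where B = "dstruct s ?B a"])
    also have "\<dots> \<longleftrightarrow> map ?f xs \<in> rel A R"
    proof -
      have rest: "map g xs \<in> rel (rest A a) R \<longleftrightarrow> map g xs \<in> rel A R \<and> (\<forall>x \<in> set xs. g x \<notin> univ ?B)" for g
        by (auto simp: rest_def univ_block)
      have "set xs \<inter> Z = {} \<and> map \<nu> xs \<in> rel (rest A a) R \<longleftrightarrow>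
          map ?f xs \<in> rel A R \<and> (\<forall>x \<in> set xs. ?f x \<notin> univ ?B)"
      proof (cases "set xs \<inter> Z = {}")
        case True
        then show ?thesis using rest[of ?f] unfolding eq[OF True] by blast
      next
        case False
        then have "\<not> (\<forall>x \<in> set xs. ?f x \<notin> univ ?B)" using a by auto
        with False show ?thesis by blast
      qed
      moreover have "\<not> (\<forall>x \<in> set xs. ?f x \<notin> univ ?B)" if All
        using that ne a by (cases xs) (auto simp: All_def)
      ultimately show ?thesis using main split by blast
    qed
    finally show ?thesis .
  next
    case False
    have "map ?f xs \<notin> rel A R" if "set xs \<inter> Z \<noteq> {}"
      using represents_Mul_root[OF TMul.prems(1) False, of "map ?f xs" R] that by auto
    with eq have "set xs \<inter> Z = {} \<and> map \<nu> xs \<in> rel A R \<longleftrightarrow> map ?f xs \<in> rel A R" by metis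
    with False show ?thesis by simp
  qed
qed

text \<open>Replaces the variables in \<open>Z\<close> by the distinguished element. The clause for
  \<open>FEx\<close> is a dummy value, as correctness is claimed for quantifier-free formulas
  only.\<close>

primrec pointf :: "mty \<Rightarrow> nat set \<Rightarrow> sym fo \<Rightarrow> sym fo" where
  "pointf s Z FFalse = FFalse"
| "pointf s Z (FRel R xs) = relf s R xs Z"
| "pointf s Z (FEq x y) = (if x \<in> Z then if y \<in> Z then FTrue else eqf s y
     else if y \<in> Z then eqf s x else FEq x y)"
| "pointf s Z (FNot \<phi>) = FNot (pointf s Z \<phi>)"
| "pointf s Z (FAnd \<phi> \<psi>) = FAnd (pointf s Z \<phi>) (pointf s Z \<psi>)"
| "pointf s Z (FEx x \<phi>) = FFalse"

lemma pointf:
  assumes "qf \<phi>" "fo_over (voc s) \<phi>"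
  shows "qf (pointf s Z \<phi>)" "fo_over (voc (dty s)) (pointf s Z \<phi>)" "free_vars (pointf s Z \<phi>) \<subseteq> free_vars \<phi> - Z"
    "\<lbrakk>represents s v A; a \<in> univ A; \<And>x. x \<in> free_vars \<phi> - Z \<Longrightarrow> \<nu> x \<in> univ A\<rbrakk> \<Longrightarrow>
      sat (dstruct s A a) \<nu> (pointf s Z \<phi>) \<longleftrightarrow> sat A (\<lambda>x. if x \<in> Z then a else \<nu> x) \<phi>"
proof -
  show "qf (pointf s Z \<phi>)" using assms by (induction \<phi>) auto
  show "fo_over (voc (dty s)) (pointf s Z \<phi>)"
    using assms by (induction \<phi>) (auto simp: fo_over_eqf fo_over_relf)
  show "free_vars (pointf s Z \<phi>) \<subseteq> free_vars \<phi> - Z"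
    using assms
  proof (induction \<phi>)
    case (FRel R xs)
    then show ?case using free_vars_relf by simp
  next
    case (FEq x y)
    then show ?case using free_vars_eqf[of s x] free_vars_eqf[of s y] by auto
  qed auto
  assume "represents s v A" "a \<in> univ A" "\<And>x. x \<in> free_vars \<phi> - Z \<Longrightarrow> \<nu> x \<in> univ A"
  then show "sat (dstruct s A a) \<nu> (pointf s Z \<phi>) \<longleftrightarrow> sat A (\<lambda>x. if x \<in> Z then a else \<nu> x) \<phi>"
    using assms
  proof (induction \<phi>)
    case (FRel R xs)
    then show ?case using sat_relf[of s v A a R xs Z \<nu>] by simp
  next
    case (FEq x y)
    then show ?case using sat_eqf[OF FEq(1,2), of \<nu> x] sat_eqf[OF FEq(1,2), of \<nu> y] by auto
  qed auto
qed

lemma sat_cong: "(\<And>x. x \<in> free_vars \<phi> \<Longrightarrow> \<nu> x = \<nu>' x) \<Longrightarrow> sat A \<nu> \<phi> \<longleftrightarrow> sat A \<nu>' \<phi>"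
proof (induction \<phi> arbitrary: \<nu> \<nu>')
  case (FRel R xs)
  then have "map \<nu> xs = map \<nu>' xs" by simp
  then show ?case by (simp only: sat.simps)
next
  case (FAnd \<phi> \<psi>)
  from FAnd.IH[of \<nu> \<nu>'] FAnd.prems show ?case by simp
next
  case (FEx x \<phi>)
  have "sat A (\<nu>(x := a)) \<phi> \<longleftrightarrow> sat A (\<nu>'(x := a)) \<phi>" for a
    by (rule FEx.IH) (use FEx.prems in auto)
  then show ?case by simp
next
  case (FNot \<phi>)
  from FNot.IH[of \<nu> \<nu>'] FNot.prems show ?case by simp
qed auto

section \<open>Truth values of formulas\<close>

lemma dvp_nullary:
  "voc s R = Some 0 \<Longrightarrow>
    \<exists>P. dvp s P \<and> (\<forall>v (A :: (sym, 'a) struct). represents s v A \<longrightarrow> (P v \<longleftrightarrow> [] \<in> rel A R))"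
proof (induction s arbitrary: R)
  case (TSum s t)
  have const: "\<exists>P. dvp s' P \<and> (\<forall>v (A :: (sym, 'a) struct). represents s' v A \<longrightarrow> (P v \<longleftrightarrow> b))" for s' b
    by (rule exI[of _ "\<lambda>_. b"]) (simp add: dvp_const)
  have "\<exists>P. dvp s P \<and> (\<forall>v (A :: (sym, 'a) struct). represents s v A \<longrightarrow> (P v \<longleftrightarrow> [] \<in> rel (inl_struct A) R))"
    using TSum const[of s True] const[of s False] by (cases R) simp_all
  then obtain P where P: "dvp s P" "\<And>v (A :: (sym, 'a) struct). represents s v A \<Longrightarrow> P v \<longleftrightarrow> [] \<in> rel (inl_struct A) R"
    by blast
  have "\<exists>P. dvp t P \<and> (\<forall>v (A :: (sym, 'a) struct). represents t v A \<longrightarrow> (P v \<longleftrightarrow> [] \<in> rel (inr_struct A) R))"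
    using TSum const[of t False] by (cases R) simp_all
  then obtain Q where Q: "dvp t Q" "\<And>v (A :: (sym, 'a) struct). represents t v A \<Longrightarrow> Q v \<longleftrightarrow> [] \<in> rel (inr_struct A) R"
    by blast
  define F where "F v = (case v of VInl x \<Rightarrow> P x | VInr x \<Rightarrow> Q x)" for v
  have "dvp (TSum s t) F" by (rule dvp_sum) (simp_all add: F_def P Q)
  moreover have "F v \<longleftrightarrow> [] \<in> rel A R" if "represents (TSum s t) v A" for v and A :: "(sym, 'a) struct"
    using that by (elim represents_SumE) (auto simp: F_def P(2) Q(2))
  ultimately show ?case by blast
next
  case (TProd s t)
  obtain P Q where P: "dvp (TProd s t) P"
    "\<And>v w (A :: (sym, 'a) struct) B. represents s v A \<Longrightarrow> represents t w B \<Longrightarrow> P (VPair v w) \<longleftrightarrow> [] \<in> rel (prod_struct A B) R"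
  proof (cases R)
    case (SymL R')
    then obtain P where "dvp s P" "\<And>v (A :: (sym, 'a) struct). represents s v A \<Longrightarrow> P v \<longleftrightarrow> [] \<in> rel A R'"
      using TProd by fastforce
    then show ?thesis using that[OF dvp_comp[OF dv_fst[OF dv_id]], of P] SymL by simp
  next
    case (SymR R')
    then obtain P where "dvp t P" "\<And>v (A :: (sym, 'a) struct). represents t v A \<Longrightarrow> P v \<longleftrightarrow> [] \<in> rel A R'"
      using TProd by fastforce
    then show ?thesis using that[OF dvp_comp[OF dv_snd[OF dv_id]], of P] SymR by simp
  qed (use TProd.prems in simp)
  then show ?case by (intro exI[of _ P]) (auto elim!: represents_ProdE)
next
  case (TMul s)
  then show ?case by (cases R) (auto split: if_splits)
qed simp

text \<open>Without variables there are no equations, and the only relational atoms are nullary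
  ones.\<close>

lemma dvp_qf_sentence:
  assumes "qf \<phi>" "fo_over (voc s) \<phi>" "free_vars \<phi> = {}"
  shows "\<exists>P. dvp s P \<and> (\<forall>v (A :: (sym, 'a) struct) \<nu>. represents s v A \<longrightarrow> (P v \<longleftrightarrow> sat A \<nu> \<phi>))"
  using assms
proof (induction \<phi>)
  case FFalse
  show ?case by (intro exI[of _ "\<lambda>_. False"]) (simp add: dvp_const)
next
  case (FRel R xs)
  then show ?case using dvp_nullary[of s R] by simp
next
  case (FNot \<phi>)
  then obtain P where P: "dvp s P" "\<And>v (A :: (sym, 'a) struct) \<nu>. represents s v A \<Longrightarrow> P v \<longleftrightarrow> sat A \<nu> \<phi>" by auto
  then show ?case by (intro exI[of _ "\<lambda>v. \<not> P v"]) (simp add: dvp_not)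
next
  case (FAnd \<phi> \<psi>)
  then obtain P Q where P: "dvp s P" "\<And>v (A :: (sym, 'a) struct) \<nu>. represents s v A \<Longrightarrow> P v \<longleftrightarrow> sat A \<nu> \<phi>"
    and Q: "dvp s Q" "\<And>v (A :: (sym, 'a) struct) \<nu>. represents s v A \<Longrightarrow> Q v \<longleftrightarrow> sat A \<nu> \<psi>" by auto
  then show ?case by (intro exI[of _ "\<lambda>v. P v \<and> Q v"]) (simp add: dvp_conj)
qed auto

text \<open>The list of points is consumed from the front: \<open>pointf\<close> absorbs the
  variables sitting at position 0 into the derivative, until a sentence is left. The map
  \<open>pos\<close> may send several variables to one point.\<close>

lemma dvp_qf:
  assumes "qf \<phi>" "fo_over (voc s) \<phi>" "\<And>x. x \<in> free_vars \<phi> \<Longrightarrow> pos x < m"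
  shows "\<exists>P. dvp (dtys m s) P \<and> (\<forall>v (A :: (sym, 'a) struct) as. represents s v A \<longrightarrow> set as \<subseteq> univ A \<longrightarrow> length as = m \<longrightarrow>
    (P (val_of (dtys m s) (dstructs as s A)) \<longleftrightarrow> sat A (\<lambda>x. as ! pos x) \<phi>))"
  using assms
proof (induction m arbitrary: s \<phi> pos)
  case 0
  then have "free_vars \<phi> = {}" by auto
  from dvp_qf_sentence[OF 0(1,2) this] show ?case by (auto simp: val_of_eq)
next
  case (Suc m)
  \<comment> \<open>\<open>Z\<close> collects the variables that denote the first point; after its
    removal all other positions drop by one.\<close>
  define Z where "Z = {x. pos x = 0}"
  define pos' where "pos' x = pos x - 1" for x
  note p = pointf[OF Suc.prems(1,2), where Z = Z]
  have "pos' x < m" if "x \<in> free_vars (pointf s Z \<phi>)" for x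
    using Suc.prems(3)[of x] p(3) that by (auto simp: pos'_def Z_def)
  from Suc.IH[of _ _ pos', OF p(1,2) this] obtain P where P: "dvp (dtys m (dty s)) P"
    "\<And>v (A :: (sym, 'a) struct) as. represents (dty s) v A \<Longrightarrow> set as \<subseteq> univ A \<Longrightarrow> length as = m \<Longrightarrow>
      P (val_of (dtys m (dty s)) (dstructs as (dty s) A)) \<longleftrightarrow> sat A (\<lambda>x. as ! pos' x) (pointf s Z \<phi>)"
    by blast
  show ?case
  proof (intro exI[of _ P] conjI allI impI)
    show "dvp (dtys (Suc m) s) P" using P(1) by simp
    fix v as and A :: "(sym, 'a) struct" assume A: "represents s v A" "set as \<subseteq> univ A" "length as = Suc m"
    then obtain a as' where as: "as = a # as'" by (cases as) auto
    then have a: "a \<in> univ A" "length as' = m" "set as' \<subseteq> univ (dstruct s A a)"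
      using A dstruct_univ[OF A(1)] by auto
    have f: "(if x \<in> Z then a else as' ! pos' x) = as ! pos x" for x
      by (cases "pos x") (auto simp: Z_def pos'_def as)
    have "P (val_of (dtys (Suc m) s) (dstructs as s A)) \<longleftrightarrow> sat (dstruct s A a) (\<lambda>x. as' ! pos' x) (pointf s Z \<phi>)"
      using P(2)[OF dstruct_val[OF A(1) a(1)] a(3,2)] by (simp add: as)
    also have "\<dots> \<longleftrightarrow> sat A (\<lambda>x. if x \<in> Z then a else as' ! pos' x) \<phi>"
    proof (rule p(4)[OF A(1) a(1)])
      fix x assume "x \<in> free_vars \<phi> - Z"
      then have "pos' x < length as'" using Suc.prems(3)[of x] a(2) by (auto simp: pos'_def Z_def)
      then show "as' ! pos' x \<in> univ A" using A(2) as by auto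
    qed
    finally show "P (val_of (dtys (Suc m) s) (dstructs as s A)) \<longleftrightarrow> sat A (\<lambda>x. as ! pos x) \<phi>"
      by (simp only: f)
  qed
qed

lemma set_mset_sum_single: "finite X \<Longrightarrow> set_mset (\<Sum>a\<in>X. {#h a#}) = h ` X"
  by (induction X rule: finite_induct) auto

text \<open>A quantified variable becomes an additional point at the end of the list, at position
  \<open>m\<close>, so the positions of the other variables stay valid. No prenex form is needed:
  \<open>m\<close> and \<open>pos\<close> are generalised, and the atoms fall under
  \<open>dvp_qf\<close>.\<close>

lemma dvp_formula:
  assumes "fo_over (voc s) \<phi>" "\<And>x. x \<in> free_vars \<phi> \<Longrightarrow> pos x < m"
  shows "\<exists>P. dvp (dtys m s) P \<and> (\<forall>v (A :: (sym, 'a) struct) as. represents s v A \<longrightarrow> set as \<subseteq> univ A \<longrightarrow> length as = m \<longrightarrow>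
    (P (val_of (dtys m s) (dstructs as s A)) \<longleftrightarrow> sat A (\<lambda>x. as ! pos x) \<phi>))"
  using assms
proof (induction \<phi> arbitrary: m pos)
  case (FNot \<phi>)
  then obtain P where "dvp (dtys m s) P" "\<And>v (A :: (sym, 'a) struct) as. represents s v A \<Longrightarrow> set as \<subseteq> univ A \<Longrightarrow> length as = m \<Longrightarrow>
    (P (val_of (dtys m s) (dstructs as s A)) \<longleftrightarrow> sat A (\<lambda>x. as ! pos x) \<phi>)" by (metis fo_over.simps(4) free_vars.simps(4))
  then show ?case by (intro exI[of _ "\<lambda>v. \<not> P v"]) (simp add: dvp_not)
next
  case (FAnd \<phi> \<psi>)
  obtain P where "dvp (dtys m s) P" "\<And>v (A :: (sym, 'a) struct) as. represents s v A \<Longrightarrow> set as \<subseteq> univ A \<Longrightarrow> length as = m \<Longrightarrow>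
    (P (val_of (dtys m s) (dstructs as s A)) \<longleftrightarrow> sat A (\<lambda>x. as ! pos x) \<phi>)"
    using FAnd.IH(1)[of pos m] FAnd.prems by auto
  moreover obtain Q where "dvp (dtys m s) Q" "\<And>v (A :: (sym, 'a) struct) as. represents s v A \<Longrightarrow> set as \<subseteq> univ A \<Longrightarrow> length as = m \<Longrightarrow>
    (Q (val_of (dtys m s) (dstructs as s A)) \<longleftrightarrow> sat A (\<lambda>x. as ! pos x) \<psi>)"
    using FAnd.IH(2)[of pos m] FAnd.prems by auto
  ultimately show ?case by (intro exI[of _ "\<lambda>v. P v \<and> Q v"]) (simp add: dvp_conj)
next
  case (FEx x \<phi>)
  let ?t = "dtys m s"
  have t: "dtys (Suc m) s = dty ?t" using dtys_add[of m 1 s] by simp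
  have "(pos(x := m)) y < Suc m" if "y \<in> free_vars \<phi>" for y
    using FEx.prems(2)[of y] that by (auto simp: less_Suc_eq)
  then obtain P where P: "dvp (dty ?t) P" "\<And>v (A :: (sym, 'a) struct) as. represents s v A \<Longrightarrow> set as \<subseteq> univ A \<Longrightarrow>
      length as = Suc m \<Longrightarrow> P (val_of (dty ?t) (dstructs as s A)) \<longleftrightarrow> sat A (\<lambda>y. as ! (pos(x := m)) y) \<phi>"
    using FEx.IH[of "pos(x := m)" "Suc m"] FEx.prems(1) unfolding t fo_over.simps by blast
  obtain g where g: "dv ?t (TMul (dty ?t)) (\<lambda>v. VMul (g v))"
    "\<And>v (A :: (sym, 'a) struct). represents ?t v A \<Longrightarrow> g v = (\<Sum>a\<in>univ A. {#val_of (dty ?t) (dstruct ?t A a)#})"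
    using dv_points by blast
  show ?case
  proof (intro exI[of _ "\<lambda>w. \<exists>z\<in>#g w. P z"] conjI allI impI)
    show "dvp ?t (\<lambda>w. \<exists>z\<in>#g w. P z)" using dvp_comp[OF g(1) dvp_any[OF P(1)]] by simp
    fix v as and A :: "(sym, 'a) struct" assume A: "represents s v A" "set as \<subseteq> univ A" "length as = m"
    let ?B = "dstructs as s A"
    have B: "univ ?B = univ A" "represents ?t (val_of ?t ?B) ?B" using dstructs_represents[OF A] by auto
    have fin: "finite (univ A)" using represents_finite[OF A(1)] .
    have "dstruct ?t ?B a = dstructs (as @ [a]) s A" for a
      by (simp add: dstructs_append A(3))
    then have "(\<exists>z\<in>#g (val_of ?t ?B). P z) \<longleftrightarrow> (\<exists>a\<in>univ A. P (val_of (dty ?t) (dstructs (as @ [a]) s A)))"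
      using fin by (simp add: g(2)[OF B(2)] B(1) set_mset_sum_single)
    also have "\<dots> \<longleftrightarrow> (\<exists>a\<in>univ A. sat A (\<lambda>y. (as @ [a]) ! (pos(x := m)) y) \<phi>)"
      using P(2)[OF A(1)] A(2,3) by (intro bex_cong refl) simp
    also have "\<dots> \<longleftrightarrow> (\<exists>a\<in>univ A. sat A ((\<lambda>y. as ! pos y)(x := a)) \<phi>)"
      by (intro bex_cong refl sat_cong) (use FEx.prems(2) A(3) in \<open>auto simp: nth_append\<close>)
    finally show "(\<exists>z\<in>#g (val_of ?t ?B). P z) \<longleftrightarrow> sat A (\<lambda>y. as ! pos y) (FEx x \<phi>)" by simp
  qed
qed (rule dvp_qf; simp)+

section \<open>Definable predicates on tuples\<close>

text \<open>\<open>\<rho>\<close> need not be injective, so bound variables have to be renamed as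
  well: a fresh \<open>z\<close> outside the image of the free variables prevents capture.\<close>

lemma fo_rename:
  "\<exists>\<phi>'. fo_over V \<phi>' = fo_over V \<phi> \<and> free_vars \<phi>' \<subseteq> \<rho> ` free_vars \<phi> \<and>
    (\<forall>(A :: ('s, 'a) struct) \<nu>. sat A \<nu> \<phi>' \<longleftrightarrow> sat A (\<lambda>x. \<nu> (\<rho> x)) \<phi>)"
proof (induction \<phi> arbitrary: \<rho>)
  case FFalse
  show ?case by (intro exI[of _ FFalse]) simp
next
  case (FRel R xs)
  show ?case by (intro exI[of _ "FRel R (map \<rho> xs)"]) (simp add: comp_def)
next
  case (FEq x y)
  show ?case by (intro exI[of _ "FEq (\<rho> x) (\<rho> y)"]) simp
next
  case (FNot \<phi>)
  then obtain \<phi>' where "fo_over V \<phi>' = fo_over V \<phi>" "free_vars \<phi>' \<subseteq> \<rho> ` free_vars \<phi>"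
    "\<And>(A :: ('s, 'a) struct) \<nu>. sat A \<nu> \<phi>' \<longleftrightarrow> sat A (\<lambda>x. \<nu> (\<rho> x)) \<phi>" by blast
  then show ?case by (intro exI[of _ "FNot \<phi>'"]) simp
next
  case (FAnd \<phi> \<psi>)
  obtain \<phi>' where "fo_over V \<phi>' = fo_over V \<phi>" "free_vars \<phi>' \<subseteq> \<rho> ` free_vars \<phi>"
    "\<And>(A :: ('s, 'a) struct) \<nu>. sat A \<nu> \<phi>' \<longleftrightarrow> sat A (\<lambda>x. \<nu> (\<rho> x)) \<phi>" using FAnd.IH(1) by blast
  moreover obtain \<psi>' where "fo_over V \<psi>' = fo_over V \<psi>" "free_vars \<psi>' \<subseteq> \<rho> ` free_vars \<psi>"
    "\<And>(A :: ('s, 'a) struct) \<nu>. sat A \<nu> \<psi>' \<longleftrightarrow> sat A (\<lambda>x. \<nu> (\<rho> x)) \<psi>" using FAnd.IH(2) by blast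
  ultimately show ?case by (intro exI[of _ "FAnd \<phi>' \<psi>'"]) auto
next
  case (FEx x \<phi>)
  have fin: "finite (free_vars \<phi>)" for \<phi> :: "'s fo" by (induction \<phi>) auto
  obtain z where z: "z \<notin> \<rho> ` free_vars \<phi>"
    using fin infinite_UNIV_nat ex_new_if_finite finite_imageI by metis
  obtain \<phi>' where p: "fo_over V \<phi>' = fo_over V \<phi>" "free_vars \<phi>' \<subseteq> (\<rho>(x := z)) ` free_vars \<phi>"
    "\<And>(A :: ('s, 'a) struct) \<nu>. sat A \<nu> \<phi>' \<longleftrightarrow> sat A (\<lambda>y. \<nu> ((\<rho>(x := z)) y)) \<phi>" using FEx.IH by blast
  show ?case
  proof (intro exI[of _ "FEx z \<phi>'"] conjI allI)
    show "free_vars (FEx z \<phi>') \<subseteq> \<rho> ` free_vars (FEx x \<phi>)" using p(2) by (auto split: if_splits)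
    fix A :: "('s, 'a) struct" and \<nu>
    have "sat A (\<nu>(z := a)) \<phi>' \<longleftrightarrow> sat A ((\<lambda>y. \<nu> (\<rho> y))(x := a)) \<phi>" for a
      unfolding p(3) using z by (intro sat_cong) auto
    then show "sat A \<nu> (FEx z \<phi>') \<longleftrightarrow> sat A (\<lambda>x. \<nu> (\<rho> x)) (FEx x \<phi>)" by simp
  qed (use p in simp)
qed

lemma fo_finite_free_vars: "finite (free_vars \<phi>)"
  by (induction \<phi>) auto

lemma fo_ex_tuple:
  "\<exists>\<phi>'. fo_over V \<phi>' = fo_over V \<phi> \<and> free_vars \<phi>' = free_vars \<phi> - {N..<N + k} \<and>
    (\<forall>(A :: ('s, 'a) struct) \<nu>. sat A \<nu> \<phi>' \<longleftrightarrow>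
      (\<exists>as. set as \<subseteq> univ A \<and> length as = k \<and> sat A (\<lambda>v. if N \<le> v \<and> v < N + k then as ! (v - N) else \<nu> v) \<phi>))"
proof (induction k arbitrary: \<phi>)
  case 0
  have "(\<lambda>v. if N \<le> v \<and> v < N + 0 then f v else \<nu> v) = \<nu>" for f \<nu> :: "nat \<Rightarrow> 'a"
    by (rule ext) (auto split: if_splits)
  then show ?case by (intro exI[of _ \<phi>]) auto
next
  case (Suc k)
  \<comment> \<open>The last variable of the block is quantified innermost; the remaining block then
    starts at the same \<open>N\<close>.\<close>
  from Suc.IH[of "FEx (N + k) \<phi>"] obtain \<phi>' where p: "fo_over V \<phi>' = fo_over V \<phi>"
    "free_vars \<phi>' = free_vars \<phi> - {N + k} - {N..<N + k}"
    "\<And>(A :: ('s, 'a) struct) \<nu>. sat A \<nu> \<phi>' \<longleftrightarrow> (\<exists>as. set as \<subseteq> univ A \<and> length as = k \<and>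
      sat A (\<lambda>v. if N \<le> v \<and> v < N + k then as ! (v - N) else \<nu> v) (FEx (N + k) \<phi>))"
    by auto
  have "sat A \<nu> \<phi>' \<longleftrightarrow> (\<exists>as. set as \<subseteq> univ A \<and> length as = Suc k \<and>
    sat A (\<lambda>v. if N \<le> v \<and> v < N + Suc k then as ! (v - N) else \<nu> v) \<phi>)" for \<nu> and A :: "('s, 'a) struct"
  proof -
    define upd where "upd n as v = (if N \<le> v \<and> v < N + n then as ! (v - N) else \<nu> v)" for n as v
    have e: "(upd k as)(N + k := a) = upd (Suc k) (as @ [a])" if "length as = k" for as a
      using that by (auto simp: fun_eq_iff nth_append upd_def)
    have "(\<exists>as. set as \<subseteq> univ A \<and> length as = k \<and> sat A (upd k as) (FEx (N + k) \<phi>)) \<longleftrightarrow>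
        (\<exists>as a. set (as @ [a]) \<subseteq> univ A \<and> length as = k \<and> sat A (upd (Suc k) (as @ [a])) \<phi>)"
      by (simp add: e cong: conj_cong) blast
    also have "\<dots> \<longleftrightarrow> (\<exists>bs. set bs \<subseteq> univ A \<and> length bs = Suc k \<and> sat A (upd (Suc k) bs) \<phi>)"
    proof
      assume "\<exists>bs. set bs \<subseteq> univ A \<and> length bs = Suc k \<and> sat A (upd (Suc k) bs) \<phi>"
      then obtain bs where bs: "set bs \<subseteq> univ A" "length bs = Suc k" "sat A (upd (Suc k) bs) \<phi>" by blast
      then obtain as a where "bs = as @ [a]" by (cases bs rule: rev_cases) auto
      with bs show "\<exists>as a. set (as @ [a]) \<subseteq> univ A \<and> length as = k \<and> sat A (upd (Suc k) (as @ [a])) \<phi>" by auto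
    qed (metis length_append_singleton)
    finally show ?thesis unfolding p(3) upd_def .
  qed
  moreover have "{N..<N + Suc k} = insert (N + k) {N..<N + k}" by (simp add: atLeastLessThanSuc)
  then have "free_vars \<phi>' = free_vars \<phi> - {N..<N + Suc k}" unfolding p(2) by (simp only:) blast
  ultimately show ?case using p(1) by (intro exI[of _ \<phi>'] conjI allI)
qed

text \<open>Elements of the structures produced by an interpretation: a component and a tuple. Formulas
  speak about environments of such elements; variable \<open>prod_encode (x, j)\<close> is the \<open>j\<close>-th entry of
  the tuple of \<open>\<mu> x\<close>. A predicate is definable if, for every choice of components and dimensions
  in the environment, a formula defines it.\<close>

type_synonym elem = "nat \<times> nat list"
type_synonym env = "nat \<Rightarrow> elem"

definition shape :: "elem \<Rightarrow> nat \<times> nat" where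
  "shape e = (fst e, length (snd e))"

definition has_shape :: "nat set \<Rightarrow> (nat \<Rightarrow> nat \<times> nat) \<Rightarrow> env \<Rightarrow> bool" where
  "has_shape X sh \<mu> \<longleftrightarrow> (\<forall>x. shape (\<mu> x) = sh x \<and> set (snd (\<mu> x)) \<subseteq> X)"

definition flat :: "env \<Rightarrow> nat \<Rightarrow> nat" where
  "flat \<mu> v = snd (\<mu> (fst (prod_decode v))) ! snd (prod_decode v)"

definition slots :: "(nat \<Rightarrow> nat \<times> nat) \<Rightarrow> nat set" where
  "slots sh = {prod_encode (x, j) | x j. j < snd (sh x)}"

definition fdef :: "mty \<Rightarrow> (nat \<Rightarrow> nat \<times> nat) \<Rightarrow> ((sym, nat) struct \<Rightarrow> env \<Rightarrow> bool) \<Rightarrow> bool" where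
  "fdef s sh Q \<longleftrightarrow> (\<exists>\<phi>. fo_over (voc s) \<phi> \<and> free_vars \<phi> \<subseteq> slots sh \<and>
     (\<forall>A \<mu> u. represents s u A \<longrightarrow> has_shape (univ A) sh \<mu> \<longrightarrow> (Q A \<mu> \<longleftrightarrow> sat A (flat \<mu>) \<phi>)))"

definition edef :: "mty \<Rightarrow> ((sym, nat) struct \<Rightarrow> env \<Rightarrow> bool) \<Rightarrow> bool" where
  "edef s Q \<longleftrightarrow> (\<forall>sh. fdef s sh Q)"

text \<open>Terms create no new entries: for a fixed shape of the environment the component and the
  dimension are fixed, and each entry is copied from a slot.\<close>

definition eterm :: "(env \<Rightarrow> elem) \<Rightarrow> bool" where
  "eterm t \<longleftrightarrow> (\<forall>sh. \<exists>c vs. set vs \<subseteq> slots sh \<and> (\<forall>\<mu> X. has_shape X sh \<mu> \<longrightarrow> t \<mu> = (c, map (flat \<mu>) vs)))"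

definition eenv :: "(env \<Rightarrow> env) \<Rightarrow> bool" where
  "eenv F \<longleftrightarrow> (\<forall>x. eterm (\<lambda>\<mu>. F \<mu> x))"

text \<open>The finite set of shapes is what makes quantification over the set expressible. In the
  definability clause, place 0 holds the candidate element and the proper environment is shifted by
  one, in the style of de Bruijn indices.\<close>

definition eset :: "mty \<Rightarrow> ((sym, nat) struct \<Rightarrow> env \<Rightarrow> elem set) \<Rightarrow> bool" where
  "eset s X \<longleftrightarrow> (\<forall>sh. \<exists>S. finite S \<and> (\<forall>A \<mu> u e. represents s u A \<longrightarrow> has_shape (univ A) sh \<mu> \<longrightarrow> e \<in> X A \<mu> \<longrightarrow>
       shape e \<in> S \<and> set (snd e) \<subseteq> univ A)) \<and>
     edef s (\<lambda>A \<mu>. \<mu> 0 \<in> X A (\<lambda>x. \<mu> (Suc x)))"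

lemma prod_encode_in_slots [simp]: "prod_encode (x, j) \<in> slots sh \<longleftrightarrow> j < snd (sh x)"
  by (auto simp: slots_def)

lemma slotsE: "v \<in> slots sh \<Longrightarrow> (\<And>x j. v = prod_encode (x, j) \<Longrightarrow> j < snd (sh x) \<Longrightarrow> thesis) \<Longrightarrow> thesis"
  by (auto simp: slots_def)

lemma flat_encode [simp]: "flat \<mu> (prod_encode (x, j)) = snd (\<mu> x) ! j"
  by (simp add: flat_def)

lemma has_shapeD: "has_shape X sh \<mu> \<Longrightarrow> length (snd (\<mu> x)) = snd (sh x)"
  "has_shape X sh \<mu> \<Longrightarrow> fst (\<mu> x) = fst (sh x)"
  "has_shape X sh \<mu> \<Longrightarrow> set (snd (\<mu> x)) \<subseteq> X"
  "has_shape X sh \<mu> \<Longrightarrow> (\<lambda>x. shape (\<mu> x)) = sh"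
  unfolding has_shape_def shape_def by (auto simp: prod_eq_iff)

lemma flat_in: "has_shape X sh \<mu> \<Longrightarrow> v \<in> slots sh \<Longrightarrow> flat \<mu> v \<in> X"
  using has_shapeD(1,3)[of X sh \<mu>] by (metis flat_encode nth_mem slotsE subsetD)

lemma has_shape_case: "has_shape X sh \<mu> \<Longrightarrow> shape e = p \<Longrightarrow> set (snd e) \<subseteq> X \<Longrightarrow>
    has_shape X (case_nat p sh) (case_nat e \<mu>)"
  by (auto simp: has_shape_def split: nat.split)

lemma fdefI:
  assumes "fo_over (voc s) \<phi>" "free_vars \<phi> \<subseteq> slots sh"
    "\<And>A \<mu> u. represents s u A \<Longrightarrow> has_shape (univ A) sh \<mu> \<Longrightarrow> Q A \<mu> \<longleftrightarrow> sat A (flat \<mu>) \<phi>"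
  shows "fdef s sh Q"
  using assms unfolding fdef_def by blast

lemma fdefE:
  assumes "fdef s sh Q"
  obtains \<phi> where "fo_over (voc s) \<phi>" "free_vars \<phi> \<subseteq> slots sh"
    "\<And>A \<mu> u. represents s u A \<Longrightarrow> has_shape (univ A) sh \<mu> \<Longrightarrow> Q A \<mu> \<longleftrightarrow> sat A (flat \<mu>) \<phi>"
  using assms unfolding fdef_def by blast

lemma fdef_cong:
  assumes "fdef s sh Q" "\<And>A \<mu> u. represents s u A \<Longrightarrow> has_shape (univ A) sh \<mu> \<Longrightarrow> Q A \<mu> \<longleftrightarrow> Q' A \<mu>"
  shows "fdef s sh Q'"
  using assms unfolding fdef_def by metis

lemma edef_cong:
  assumes "edef s Q" "\<And>A \<mu> u. represents s u A \<Longrightarrow> (\<And>x. set (snd (\<mu> x)) \<subseteq> univ A) \<Longrightarrow> Q A \<mu> \<longleftrightarrow> Q' A \<mu>"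
  shows "edef s Q'"
  unfolding edef_def
proof
  fix sh show "fdef s sh Q'"
    by (rule fdef_cong[of s sh Q]) (use assms has_shapeD(3) in \<open>auto simp: edef_def\<close>)
qed

lemma fdef_const: "fdef s sh (\<lambda>A \<mu>. b)"
  by (rule fdefI[of _ "if b then FTrue else FFalse"]) auto

lemma fdef_not: "fdef s sh Q \<Longrightarrow> fdef s sh (\<lambda>A \<mu>. \<not> Q A \<mu>)"
  unfolding fdef_def by (metis fo_over.simps(4) free_vars.simps(4) sat.simps(4))

lemma fdef_conj: "fdef s sh Q \<Longrightarrow> fdef s sh Q' \<Longrightarrow> fdef s sh (\<lambda>A \<mu>. Q A \<mu> \<and> Q' A \<mu>)"
  unfolding fdef_def by (metis fo_over.simps(5) free_vars.simps(5) sat.simps(5) Un_least)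

lemma fdef_disj: "fdef s sh Q \<Longrightarrow> fdef s sh Q' \<Longrightarrow> fdef s sh (\<lambda>A \<mu>. Q A \<mu> \<or> Q' A \<mu>)"
  using fdef_not[OF fdef_conj[OF fdef_not fdef_not]] by simp

lemma fdef_Bex: "finite S \<Longrightarrow> (\<And>p. p \<in> S \<Longrightarrow> fdef s sh (Q p)) \<Longrightarrow> fdef s sh (\<lambda>A \<mu>. \<exists>p\<in>S. Q p A \<mu>)"
  by (induction S rule: finite_induct) (auto intro: fdef_const fdef_disj)

lemma edef_const: "edef s (\<lambda>A \<mu>. b)"
  and edef_not: "edef s Q \<Longrightarrow> edef s (\<lambda>A \<mu>. \<not> Q A \<mu>)"
  and edef_conj: "edef s Q \<Longrightarrow> edef s Q' \<Longrightarrow> edef s (\<lambda>A \<mu>. Q A \<mu> \<and> Q' A \<mu>)"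
  and edef_disj: "edef s Q \<Longrightarrow> edef s Q' \<Longrightarrow> edef s (\<lambda>A \<mu>. Q A \<mu> \<or> Q' A \<mu>)"
  by (simp_all add: edef_def fdef_const fdef_not fdef_conj fdef_disj)

lemma edef_if: "edef s P \<Longrightarrow> edef s Q \<Longrightarrow> edef s Q' \<Longrightarrow> edef s (\<lambda>A \<mu>. if P A \<mu> then Q A \<mu> else Q' A \<mu>)"
  using edef_disj[OF edef_conj[of s P Q] edef_conj[OF edef_not[of s P], of Q']]
  by (rule edef_cong) auto

text \<open>Definability is required for each shape separately, so a dependence on the shape can be
  resolved before the formula is chosen.\<close>

lemma edef_shape: "(\<And>sh. edef s (Q sh)) \<Longrightarrow> edef s (\<lambda>A \<mu>. Q (\<lambda>x. shape (\<mu> x)) A \<mu>)"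
  unfolding edef_def
proof
  fix sh assume "\<And>sh'. \<forall>sh. fdef s sh (Q sh')"
  then have "fdef s sh (Q sh)" by blast
  then show "fdef s sh (\<lambda>A \<mu>. Q (\<lambda>x. shape (\<mu> x)) A \<mu>)"
    by (rule fdef_cong) (simp only: has_shapeD(4))
qed

lemma edef_shape_const: "edef s (\<lambda>A \<mu>. P (\<lambda>x. shape (\<mu> x)))"
  by (rule edef_shape) (rule edef_const)

lemma etermE:
  assumes "eterm t"
  obtains c vs where "set vs \<subseteq> slots sh" "\<And>\<mu> X. has_shape X sh \<mu> \<Longrightarrow> t \<mu> = (c, map (flat \<mu>) vs)"
  using assms unfolding eterm_def by blast

lemma etermI:
  assumes "\<And>sh. \<exists>c vs. set vs \<subseteq> slots sh \<and> (\<forall>\<mu> X. has_shape X sh \<mu> \<longrightarrow> t \<mu> = (c, map (flat \<mu>) vs))"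
  shows "eterm t"
  using assms unfolding eterm_def by blast

lemma eterm_var: "eterm (\<lambda>\<mu>. \<mu> x)"
proof (rule etermI)
  fix sh :: "nat \<Rightarrow> nat \<times> nat"
  show "\<exists>c vs. set vs \<subseteq> slots sh \<and> (\<forall>\<mu> X. has_shape X sh \<mu> \<longrightarrow> \<mu> x = (c, map (flat \<mu>) vs))"
    by (intro exI[of _ "fst (sh x)"] exI[of _ "map (\<lambda>j. prod_encode (x, j)) [0..<snd (sh x)]"])
      (auto simp: prod_eq_iff has_shapeD(1,2) intro!: nth_equalityI)
qed

lemma eterm_const: "eterm (\<lambda>\<mu>. (c, []))"
  by (rule etermI) (auto intro!: exI[of _ c] exI[of _ "[]"])

text \<open>The component \<open>0\<close> is left free for the roots of new multisets.\<close>

definition pair_elem :: "elem \<Rightarrow> elem \<Rightarrow> elem" where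
  "pair_elem c e = (Suc (prod_encode (prod_encode (shape c), fst e)), snd c @ snd e)"

text \<open>The component of the pair contains the dimension of \<open>c\<close>, which determines
  where the concatenated tuple splits.\<close>

lemma pair_elem_inject [simp]: "pair_elem c e = pair_elem c' e' \<longleftrightarrow> c = c' \<and> e = e'"
  by (cases c; cases c'; cases e; cases e') (auto simp: pair_elem_def shape_def prod_encode_eq)

lemma pair_elem_neq [simp]: "pair_elem c e \<noteq> (0, xs)" "(0, xs) \<noteq> pair_elem c e"
  by (simp_all add: pair_elem_def)

lemma eterm_append:
  assumes "eterm t" "eterm t'"
  shows "eterm (\<lambda>\<mu>. (f (shape (t \<mu>)) (shape (t' \<mu>)), snd (t \<mu>) @ snd (t' \<mu>)))"
proof (rule etermI)
  fix sh :: "nat \<Rightarrow> nat \<times> nat"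
  obtain c vs where 1: "set vs \<subseteq> slots sh" "\<And>\<mu> X. has_shape X sh \<mu> \<Longrightarrow> t \<mu> = (c, map (flat \<mu>) vs)"
    by (rule etermE[OF assms(1), of sh]) (rule that; assumption)
  obtain c' vs' where 2: "set vs' \<subseteq> slots sh" "\<And>\<mu> X. has_shape X sh \<mu> \<Longrightarrow> t' \<mu> = (c', map (flat \<mu>) vs')"
    by (rule etermE[OF assms(2), of sh]) (rule that; assumption)
  show "\<exists>c vs. set vs \<subseteq> slots sh \<and> (\<forall>\<mu> X. has_shape X sh \<mu> \<longrightarrow>
      (f (shape (t \<mu>)) (shape (t' \<mu>)), snd (t \<mu>) @ snd (t' \<mu>)) = (c, map (flat \<mu>) vs))"
  proof (intro exI[of _ "f (c, length vs) (c', length vs')"] exI[of _ "vs @ vs'"] conjI allI impI)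
    show "set (vs @ vs') \<subseteq> slots sh" using 1(1) 2(1) by simp
    fix \<mu> X assume "has_shape X sh \<mu>"
    then show "(f (shape (t \<mu>)) (shape (t' \<mu>)), snd (t \<mu>) @ snd (t' \<mu>)) =
        (f (c, length vs) (c', length vs'), map (flat \<mu>) (vs @ vs'))"
      by (simp only: 1(2) 2(2)) (simp add: shape_def)
  qed
qed

lemma eterm_pair: "eterm t \<Longrightarrow> eterm t' \<Longrightarrow> eterm (\<lambda>\<mu>. pair_elem (t \<mu>) (t' \<mu>))"
  using eterm_append[of t t' "\<lambda>p q. Suc (prod_encode (prod_encode p, fst q))"]
  by (simp add: pair_elem_def shape_def)

text \<open>Substituting definable terms permutes and duplicates the entries of the environment, so on
  formulas it is a renaming of variables.\<close>

lemma eenv_shape: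
  assumes "eenv F"
  obtains sh' \<rho> where "\<And>v. v \<in> slots sh' \<Longrightarrow> \<rho> v \<in> slots sh"
    "\<And>\<mu> X. has_shape X sh \<mu> \<Longrightarrow> has_shape X sh' (F \<mu>)"
    "\<And>\<mu> X v. has_shape X sh \<mu> \<Longrightarrow> v \<in> slots sh' \<Longrightarrow> flat (F \<mu>) v = flat \<mu> (\<rho> v)"
proof -
  have "\<forall>x. \<exists>c vs. set vs \<subseteq> slots sh \<and> (\<forall>\<mu> X. has_shape X sh \<mu> \<longrightarrow> F \<mu> x = (c, map (flat \<mu>) vs))"
    using assms unfolding eenv_def eterm_def by blast
  then obtain c vs where vs: "\<And>x. set (vs x) \<subseteq> slots sh"
    "\<And>x \<mu> X. has_shape X sh \<mu> \<Longrightarrow> F \<mu> x = (c x, map (flat \<mu>) (vs x))" by metis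
  define sh' where "sh' x = (c x, length (vs x))" for x
  define \<rho> where "\<rho> v = (let (x, j) = prod_decode v in vs x ! j)" for v
  have r: "\<rho> (prod_encode (x, j)) = vs x ! j" for x j by (simp add: \<rho>_def)
  show ?thesis
  proof (rule that[of sh' \<rho>])
    show "\<rho> v \<in> slots sh" if "v \<in> slots sh'" for v
      using that vs(1) nth_mem by (fastforce elim!: slotsE simp: r sh'_def)
    show "has_shape X sh' (F \<mu>)" if h: "has_shape X sh \<mu>" for \<mu> X
      using vs(1) flat_in[OF h] by (fastforce simp: has_shape_def shape_def sh'_def vs(2)[OF h])
    show "flat (F \<mu>) v = flat \<mu> (\<rho> v)" if h: "has_shape X sh \<mu>" and v: "v \<in> slots sh'" for \<mu> X v
      using v by (auto elim!: slotsE simp: r vs(2)[OF h] sh'_def)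
  qed
qed

lemma eterm_subst:
  assumes "eterm t" "eenv F"
  shows "eterm (\<lambda>\<mu>. t (F \<mu>))"
proof (rule etermI)
  fix sh :: "nat \<Rightarrow> nat \<times> nat"
  obtain sh' \<rho> where F: "\<And>v. v \<in> slots sh' \<Longrightarrow> \<rho> v \<in> slots sh"
    "\<And>\<mu> X. has_shape X sh \<mu> \<Longrightarrow> has_shape X sh' (F \<mu>)"
    "\<And>\<mu> X v. has_shape X sh \<mu> \<Longrightarrow> v \<in> slots sh' \<Longrightarrow> flat (F \<mu>) v = flat \<mu> (\<rho> v)"
    by (rule eenv_shape[OF assms(2), of sh]) (rule that; assumption)
  obtain c vs where t: "set vs \<subseteq> slots sh'" "\<And>\<mu> X. has_shape X sh' \<mu> \<Longrightarrow> t \<mu> = (c, map (flat \<mu>) vs)"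
    by (rule etermE[OF assms(1), of sh']) (rule that; assumption)
  show "\<exists>c vs. set vs \<subseteq> slots sh \<and> (\<forall>\<mu> X. has_shape X sh \<mu> \<longrightarrow> t (F \<mu>) = (c, map (flat \<mu>) vs))"
    using t F by (intro exI[of _ c] exI[of _ "map \<rho> vs"]) (fastforce intro!: map_cong)
qed

lemma edef_subst:
  assumes "edef s Q" "eenv F"
  shows "edef s (\<lambda>A \<mu>. Q A (F \<mu>))"
  unfolding edef_def
proof
  fix sh
  obtain sh' \<rho> where F: "\<And>v. v \<in> slots sh' \<Longrightarrow> \<rho> v \<in> slots sh"
    "\<And>\<mu> X. has_shape X sh \<mu> \<Longrightarrow> has_shape X sh' (F \<mu>)"
    "\<And>\<mu> X v. has_shape X sh \<mu> \<Longrightarrow> v \<in> slots sh' \<Longrightarrow> flat (F \<mu>) v = flat \<mu> (\<rho> v)"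
    by (rule eenv_shape[OF assms(2), of sh]) (rule that; assumption)
  obtain \<phi> where p: "fo_over (voc s) \<phi>" "free_vars \<phi> \<subseteq> slots sh'"
    "\<And>A \<mu> u. represents s u A \<Longrightarrow> has_shape (univ A) sh' \<mu> \<Longrightarrow> Q A \<mu> \<longleftrightarrow> sat A (flat \<mu>) \<phi>"
    by (rule fdefE[OF assms(1)[unfolded edef_def, rule_format, of sh']]) (rule that; assumption)
  obtain \<phi>' where p': "fo_over (voc s) \<phi>'" "free_vars \<phi>' \<subseteq> \<rho> ` free_vars \<phi>"
    "\<And>(A :: (sym, nat) struct) \<nu>. sat A \<nu> \<phi>' \<longleftrightarrow> sat A (\<lambda>x. \<nu> (\<rho> x)) \<phi>"
    using fo_rename[of "voc s" \<phi> \<rho>] p(1) by blast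
  show "fdef s sh (\<lambda>A \<mu>. Q A (F \<mu>))"
  proof (rule fdefI[OF p'(1)])
    show "free_vars \<phi>' \<subseteq> slots sh" using p'(2) p(2) F(1) by blast
    fix A :: "(sym, nat) struct" and \<mu> u assume A: "represents s u A" "has_shape (univ A) sh \<mu>"
    have "Q A (F \<mu>) \<longleftrightarrow> sat A (flat (F \<mu>)) \<phi>" using p(3) A F(2) by blast
    also have "\<dots> \<longleftrightarrow> sat A (\<lambda>x. flat \<mu> (\<rho> x)) \<phi>"
      by (rule sat_cong) (use p(2) F(3)[OF A(2)] in blast)
    finally show "Q A (F \<mu>) \<longleftrightarrow> sat A (flat \<mu>) \<phi>'" using p'(3) by simp
  qed
qed

lemma eenv_rename: "eenv (\<lambda>\<mu> x. \<mu> (f x))"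
  by (simp add: eenv_def eterm_var)

lemma eenv_case: "eterm t \<Longrightarrow> eenv F \<Longrightarrow> eenv (\<lambda>\<mu>. case_nat (t \<mu>) (F \<mu>))"
  unfolding eenv_def
proof
  fix x assume "eterm t" "\<forall>x. eterm (\<lambda>\<mu>. F \<mu> x)"
  then show "eterm (\<lambda>\<mu>. case_nat (t \<mu>) (F \<mu>) x)" by (cases x) auto
qed

lemma eenv_comp: "eenv F \<Longrightarrow> eenv (\<lambda>\<mu>. F (\<lambda>x. \<mu> (f x)))"
  unfolding eenv_def using eterm_subst[OF _ eenv_rename] by blast

lemma edef_eq: "eterm t \<Longrightarrow> eterm t' \<Longrightarrow> edef s (\<lambda>A \<mu>. t \<mu> = t' \<mu>)"
  unfolding edef_def
proof
  fix sh :: "nat \<Rightarrow> nat \<times> nat" assume t: "eterm t" and t': "eterm t'"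
  obtain c vs where t: "set vs \<subseteq> slots sh" "\<And>\<mu> X. has_shape X sh \<mu> \<Longrightarrow> t \<mu> = (c, map (flat \<mu>) vs)"
    by (rule etermE[OF t, of sh]) (rule that; assumption)
  obtain c' vs' where t': "set vs' \<subseteq> slots sh" "\<And>\<mu> X. has_shape X sh \<mu> \<Longrightarrow> t' \<mu> = (c', map (flat \<mu>) vs')"
    by (rule etermE[OF t', of sh]) (rule that; assumption)
  show "fdef s sh (\<lambda>A \<mu>. t \<mu> = t' \<mu>)"
  proof (cases "c = c' \<and> length vs = length vs'")
    case True
    show ?thesis
    proof (rule fdefI[of _ "FAll (\<lambda>j. FEq (vs ! j) (vs' ! j)) [0..<length vs]"])
      show "free_vars (FAll (\<lambda>j. FEq (vs ! j) (vs' ! j)) [0..<length vs] :: sym fo) \<subseteq> slots sh"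
        using t(1) t'(1) True by (auto simp: subset_iff)
      fix A :: "(sym, nat) struct" and \<mu> u assume "has_shape (univ A) sh \<mu>"
      then have e: "t \<mu> = (c, map (flat \<mu>) vs)" "t' \<mu> = (c', map (flat \<mu>) vs')" by (rule t(2), rule t'(2))
      have "map (flat \<mu>) vs = map (flat \<mu>) vs' \<longleftrightarrow> (\<forall>j < length vs. flat \<mu> (vs ! j) = flat \<mu> (vs' ! j))"
        unfolding list_eq_iff_nth_eq using True by (metis length_map nth_map)
      then show "t \<mu> = t' \<mu> \<longleftrightarrow> sat A (flat \<mu>) (FAll (\<lambda>j. FEq (vs ! j) (vs' ! j)) [0..<length vs])"
        unfolding e using True by (simp add: Ball_def)
    qed simp
  next
    case False
    show ?thesis
    proof (rule fdef_cong[OF fdef_const[of s sh False]])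
      fix A :: "(sym, nat) struct" and \<mu> u assume "has_shape (univ A) sh \<mu>"
      then have e: "t \<mu> = (c, map (flat \<mu>) vs)" "t' \<mu> = (c', map (flat \<mu>) vs')" by (rule t(2), rule t'(2))
      show "False \<longleftrightarrow> t \<mu> = t' \<mu>" unfolding e using False by (metis length_map prod.inject)
    qed
  qed
qed

lemma edef_mem: "eset s X \<Longrightarrow> eterm t \<Longrightarrow> edef s (\<lambda>A \<mu>. t \<mu> \<in> X A \<mu>)"
proof -
  assume "eset s X" "eterm t"
  then have "edef s (\<lambda>A \<mu>. \<mu> 0 \<in> X A (\<lambda>x. \<mu> (Suc x)))" "eenv (\<lambda>\<mu>. case_nat (t \<mu>) (\<lambda>x. \<mu> x))"
    by (simp_all add: eset_def) (rule eenv_case, simp_all add: eenv_rename)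
  from edef_subst[OF this] show ?thesis by simp
qed

text \<open>A quantifier over elements becomes a finite disjunction over the possible shapes and,
  for each shape, a block of ordinary quantifiers over the entries of the tuple.\<close>

lemma edef_ex:
  assumes X: "eset s X" and Q: "edef s (\<lambda>A \<mu>. Q A (\<lambda>x. \<mu> (Suc x)) (\<mu> 0))"
  shows "edef s (\<lambda>A \<mu>. \<exists>e \<in> X A \<mu>. Q A \<mu> e)"
  unfolding edef_def
proof
  fix sh
  obtain S where S: "finite S" "\<And>A \<mu> u e. represents s u A \<Longrightarrow> has_shape (univ A) sh \<mu> \<Longrightarrow> e \<in> X A \<mu> \<Longrightarrow>
       shape e \<in> S \<and> set (snd e) \<subseteq> univ A"
    using X unfolding eset_def by metis
  define P where "P A \<mu> \<longleftrightarrow> \<mu> 0 \<in> X A (\<lambda>x. \<mu> (Suc x)) \<and> Q A (\<lambda>x. \<mu> (Suc x)) (\<mu> 0)" for A \<mu>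
  have P: "edef s P" unfolding P_def by (rule edef_conj) (use X Q in \<open>simp_all add: eset_def\<close>)
  have "fdef s sh (\<lambda>A \<mu>. \<exists>as. set as \<subseteq> univ A \<and> length as = snd p \<and> P A (case_nat (fst p, as) \<mu>))" for p
  proof -
    obtain i k where p: "p = (i, k)" by (cases p)
    obtain \<phi> where f: "fo_over (voc s) \<phi>" "free_vars \<phi> \<subseteq> slots (case_nat p sh)"
      "\<And>A \<mu> u. represents s u A \<Longrightarrow> has_shape (univ A) (case_nat p sh) \<mu> \<Longrightarrow> P A \<mu> \<longleftrightarrow> sat A (flat \<mu>) \<phi>"
      by (rule fdefE[OF P[unfolded edef_def, rule_format, of "case_nat p sh"]]) (rule that; assumption)
    \<comment> \<open>Place 0 of the environment is the quantified element. Its entries move to the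
      variables from \<open>N\<close> on, where \<open>N\<close> lies above all variables in use;
      the other places shift down by one.\<close>
    define \<rho>' where "\<rho>' v = (let (x, j) = prod_decode v in prod_encode (x - 1, j))" for v
    obtain N where N: "\<And>v. v \<in> free_vars \<phi> \<Longrightarrow> \<rho>' v < N"
      using finite_nat_set_iff_bounded[of "\<rho>' ` free_vars \<phi>"] fo_finite_free_vars by blast
    define \<rho> where "\<rho> v = (if fst (prod_decode v) = 0 then N + snd (prod_decode v) else \<rho>' v)" for v
    have r: "\<rho> (prod_encode (0, j)) = N + j" "\<rho> (prod_encode (Suc x, j)) = prod_encode (x, j)" for x j
      by (simp_all add: \<rho>_def \<rho>'_def)
    obtain \<phi>1 where 1: "fo_over (voc s) \<phi>1" "free_vars \<phi>1 \<subseteq> \<rho> ` free_vars \<phi>"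
      "\<And>(A :: (sym, nat) struct) \<nu>. sat A \<nu> \<phi>1 \<longleftrightarrow> sat A (\<lambda>x. \<nu> (\<rho> x)) \<phi>"
      using fo_rename[of "voc s" \<phi> \<rho>] f(1) by blast
    obtain \<phi>2 where 2: "fo_over (voc s) \<phi>2" "free_vars \<phi>2 = free_vars \<phi>1 - {N..<N + k}"
      "\<And>(A :: (sym, nat) struct) \<nu>. sat A \<nu> \<phi>2 \<longleftrightarrow> (\<exists>as. set as \<subseteq> univ A \<and> length as = k \<and>
        sat A (\<lambda>v. if N \<le> v \<and> v < N + k then as ! (v - N) else \<nu> v) \<phi>1)"
      using fo_ex_tuple[of "voc s" \<phi>1 N k] 1(1) by blast
    have cases: "(\<exists>j < k. v = prod_encode (0, j)) \<or> (\<exists>x j. v = prod_encode (Suc x, j) \<and> j < snd (sh x) \<and> \<rho> v < N)"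
      if "v \<in> free_vars \<phi>" for v
    proof -
      have "v \<in> slots (case_nat p sh)" using f(2) that by blast
      then obtain x j where v: "v = prod_encode (x, j)" "j < snd (case_nat p sh x)" by (rule slotsE)
      then show ?thesis using N[OF that] p by (cases x) (auto simp: r \<rho>'_def)
    qed
    show ?thesis
    proof (rule fdefI[OF 2(1)])
      show "free_vars \<phi>2 \<subseteq> slots sh"
      proof
        fix w assume "w \<in> free_vars \<phi>2"
        then obtain v where "v \<in> free_vars \<phi>" "w = \<rho> v" "w \<notin> {N..<N + k}" using 2(2) 1(2) by blast
        then show "w \<in> slots sh" using cases[of v] by (auto simp: r)
      qed
      fix A :: "(sym, nat) struct" and \<mu> u assume A: "represents s u A" "has_shape (univ A) sh \<mu>"
      have "P A (case_nat (i, as) \<mu>) \<longleftrightarrow> sat A (\<lambda>v. if N \<le> v \<and> v < N + k then as ! (v - N) else flat \<mu> v) \<phi>1"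
        if as: "set as \<subseteq> univ A" "length as = k" for as
      proof -
        have "has_shape (univ A) (case_nat p sh) (case_nat (i, as) \<mu>)"
          by (rule has_shape_case[OF A(2)]) (use as p in \<open>auto simp: shape_def\<close>)
        from f(3)[OF A(1) this] show ?thesis unfolding 1(3)
          by (simp only:, intro sat_cong) (use cases in \<open>fastforce simp: r\<close>)
      qed
      then show "(\<exists>as. set as \<subseteq> univ A \<and> length as = snd p \<and> P A (case_nat (fst p, as) \<mu>)) \<longleftrightarrow> sat A (flat \<mu>) \<phi>2"
        unfolding 2(3) p by auto
    qed
  qed
  from fdef_Bex[OF S(1) this] show "fdef s sh (\<lambda>A \<mu>. \<exists>e \<in> X A \<mu>. Q A \<mu> e)"
  proof (rule fdef_cong)
    fix A :: "(sym, nat) struct" and \<mu> u assume A: "represents s u A" "has_shape (univ A) sh \<mu>"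
    have P': "P A (case_nat e \<mu>) \<longleftrightarrow> e \<in> X A \<mu> \<and> Q A \<mu> e" for e by (simp add: P_def)
    show "(\<exists>p\<in>S. \<exists>as. set as \<subseteq> univ A \<and> length as = snd p \<and> P A (case_nat (fst p, as) \<mu>)) \<longleftrightarrow>
        (\<exists>e \<in> X A \<mu>. Q A \<mu> e)"
    proof
      assume "\<exists>p\<in>S. \<exists>as. set as \<subseteq> univ A \<and> length as = snd p \<and> P A (case_nat (fst p, as) \<mu>)"
      then show "\<exists>e \<in> X A \<mu>. Q A \<mu> e" unfolding P' by blast
    next
      assume "\<exists>e \<in> X A \<mu>. Q A \<mu> e"
      then obtain e where e: "e \<in> X A \<mu>" "Q A \<mu> e" by blast
      from S(2)[OF A e(1)] have "shape e \<in> S" "set (snd e) \<subseteq> univ A" by auto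
      then show "\<exists>p\<in>S. \<exists>as. set as \<subseteq> univ A \<and> length as = snd p \<and> P A (case_nat (fst p, as) \<mu>)"
        unfolding P' using e by (intro bexI[of _ "shape e"] exI[of _ "snd e"]) (auto simp: shape_def)
    qed
  qed
qed

section \<open>Interpretations with parameters\<close>

lemma edef_imp: "edef s P \<Longrightarrow> edef s Q \<Longrightarrow> edef s (\<lambda>A \<mu>. P A \<mu> \<longrightarrow> Q A \<mu>)"
  using edef_disj[OF edef_not, of s P Q] by (rule edef_cong) auto

lemma edef_all:
  assumes "eset s X" "edef s (\<lambda>A \<mu>. Q A (\<lambda>x. \<mu> (Suc x)) (\<mu> 0))"
  shows "edef s (\<lambda>A \<mu>. \<forall>e \<in> X A \<mu>. Q A \<mu> e)"
  using edef_not[OF edef_ex[OF assms(1) edef_not[OF assms(2)]]] by (rule edef_cong) auto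

lemma eenv_step: "eenv F \<Longrightarrow> eenv (\<lambda>\<mu>. case_nat (\<mu> 0) (F (\<lambda>x. \<mu> (Suc x))))"
  by (rule eenv_case[OF eterm_var eenv_comp])

section \<open>Bounded and definable sets of elements\<close>

definition within :: "mty \<Rightarrow> (nat \<Rightarrow> nat \<times> nat) \<Rightarrow> ((sym, nat) struct \<Rightarrow> env \<Rightarrow> elem set) \<Rightarrow> (nat \<times> nat) set \<Rightarrow> bool" where
  "within s sh X S \<longleftrightarrow> (\<forall>A \<mu> u e. represents s u A \<longrightarrow> has_shape (univ A) sh \<mu> \<longrightarrow> e \<in> X A \<mu> \<longrightarrow>
     shape e \<in> S \<and> set (snd e) \<subseteq> univ A)"

lemma withinD: "within s sh X S \<Longrightarrow> represents s u A \<Longrightarrow> has_shape (univ A) sh \<mu> \<Longrightarrow> e \<in> X A \<mu> \<Longrightarrow>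
    shape e \<in> S \<and> set (snd e) \<subseteq> univ A"
  and withinI: "(\<And>A \<mu> u e. represents s u A \<Longrightarrow> has_shape (univ A) sh \<mu> \<Longrightarrow> e \<in> X A \<mu> \<Longrightarrow>
    shape e \<in> S \<and> set (snd e) \<subseteq> univ A) \<Longrightarrow> within s sh X S"
  unfolding within_def by metis+

text \<open>Separated from \<open>eset\<close> because boundedness passes to subsets, while
  definability does not.\<close>

definition ebound :: "mty \<Rightarrow> ((sym, nat) struct \<Rightarrow> env \<Rightarrow> elem set) \<Rightarrow> bool" where
  "ebound s X \<longleftrightarrow> (\<forall>sh. \<exists>S. finite S \<and> within s sh X S)"

lemma eset_iff: "eset s X \<longleftrightarrow> ebound s X \<and> edef s (\<lambda>A \<mu>. \<mu> 0 \<in> X A (\<lambda>x. \<mu> (Suc x)))"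
  by (simp only: eset_def ebound_def within_def)

lemma ebound_subset:
  assumes "ebound s X" "\<And>A \<mu> u. represents s u A \<Longrightarrow> Y A \<mu> \<subseteq> X A \<mu>"
  shows "ebound s Y"
proof -
  have "within s sh Y S" if "within s sh X S" for sh S
    by (rule withinI) (use withinD[OF that] assms(2) in blast)
  with assms(1) show ?thesis unfolding ebound_def by metis
qed

lemma ebound_Un:
  assumes "ebound s X" "ebound s Y"
  shows "ebound s (\<lambda>A \<mu>. X A \<mu> \<union> Y A \<mu>)"
  unfolding ebound_def
proof
  fix sh
  obtain S T where S: "finite S" "within s sh X S" and T: "finite T" "within s sh Y T"
    using assms unfolding ebound_def by metis
  have "within s sh (\<lambda>A \<mu>. X A \<mu> \<union> Y A \<mu>) (S \<union> T)"
    by (rule withinI) (use withinD[OF S(2)] withinD[OF T(2)] in blast)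
  moreover have "finite (S \<union> T)" using S(1) T(1) by simp
  ultimately show "\<exists>S. finite S \<and> within s sh (\<lambda>A \<mu>. X A \<mu> \<union> Y A \<mu>) S" by (intro exI conjI)
qed

lemma ebound_single:
  assumes "eterm t"
  shows "ebound s (\<lambda>A \<mu>. {t \<mu>})"
  unfolding ebound_def
proof
  fix sh
  obtain c vs where t: "set vs \<subseteq> slots sh" "\<And>\<mu> X. has_shape X sh \<mu> \<Longrightarrow> t \<mu> = (c, map (flat \<mu>) vs)"
    by (rule etermE[OF assms, of sh]) (rule that; assumption)
  have "within s sh (\<lambda>A \<mu>. {t \<mu>}) {(c, length vs)}"
  proof (rule withinI)
    fix A :: "(sym, nat) struct" and \<mu> u e assume h: "has_shape (univ A) sh \<mu>" and e: "e \<in> {t \<mu>}"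
    have e: "e = (c, map (flat \<mu>) vs)" using e t(2)[OF h] by simp
    show "shape e \<in> {(c, length vs)} \<and> set (snd e) \<subseteq> univ A"
      unfolding e using t(1) flat_in[OF h] by (auto simp: shape_def)
  qed
  moreover have "finite {(c, length vs)}" by simp
  ultimately show "\<exists>S. finite S \<and> within s sh (\<lambda>A \<mu>. {t \<mu>}) S" by (intro exI conjI)
qed

lemma ebound_UN:
  assumes X: "ebound s X" and Y: "ebound s (\<lambda>A \<mu>. Y A (\<lambda>x. \<mu> (Suc x)) (\<mu> 0))"
  shows "ebound s (\<lambda>A \<mu>. \<Union>e \<in> X A \<mu>. Y A \<mu> e)"
  unfolding ebound_def
proof
  fix sh
  obtain S where S: "finite S" "within s sh X S" using X unfolding ebound_def by metis
  have "\<exists>T. finite T \<and> within s (case_nat p sh) (\<lambda>A \<mu>. Y A (\<lambda>x. \<mu> (Suc x)) (\<mu> 0)) T" for p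
    using Y unfolding ebound_def by (rule spec)
  then have "\<exists>T. \<forall>p. finite (T p) \<and> within s (case_nat p sh) (\<lambda>A \<mu>. Y A (\<lambda>x. \<mu> (Suc x)) (\<mu> 0)) (T p)"
    by (intro choice allI)
  then obtain T where "\<forall>p. finite (T p) \<and> within s (case_nat p sh) (\<lambda>A \<mu>. Y A (\<lambda>x. \<mu> (Suc x)) (\<mu> 0)) (T p)" ..
  note T = this[rule_format]
  then have T: "\<And>p. finite (T p)" "\<And>p. within s (case_nat p sh) (\<lambda>A \<mu>. Y A (\<lambda>x. \<mu> (Suc x)) (\<mu> 0)) (T p)" by (rule conjunct1, rule conjunct2)
  have "within s sh (\<lambda>A \<mu>. \<Union>e \<in> X A \<mu>. Y A \<mu> e) (\<Union>p\<in>S. T p)"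
  proof (rule withinI)
    fix A :: "(sym, nat) struct" and \<mu> u e assume A: "represents s u A" and h: "has_shape (univ A) sh \<mu>"
      and "e \<in> (\<Union>e \<in> X A \<mu>. Y A \<mu> e)"
    then obtain d where d: "d \<in> X A \<mu>" "e \<in> Y A \<mu> d" by blast
    from withinD[OF S(2) A h d(1)] have 1: "shape d \<in> S" "set (snd d) \<subseteq> univ A" by auto
    from withinD[OF T(2) A has_shape_case[OF h refl 1(2)], of e] d(2)
    have "shape e \<in> T (shape d)" "set (snd e) \<subseteq> univ A" by auto
    with 1 show "shape e \<in> (\<Union>p\<in>S. T p) \<and> set (snd e) \<subseteq> univ A" by auto
  qed
  moreover have "finite (\<Union>p\<in>S. T p)" using S(1) T(1) by blast
  ultimately show "\<exists>S. finite S \<and> within s sh (\<lambda>A \<mu>. \<Union>e \<in> X A \<mu>. Y A \<mu> e) S" by (intro exI conjI)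
qed

lemma ebound_subst:
  assumes "ebound s X" "eenv F"
  shows "ebound s (\<lambda>A \<mu>. X A (F \<mu>))"
  unfolding ebound_def
proof
  fix sh
  obtain sh' \<rho> where F: "\<And>v. v \<in> slots sh' \<Longrightarrow> \<rho> v \<in> slots sh"
    "\<And>\<mu> X. has_shape X sh \<mu> \<Longrightarrow> has_shape X sh' (F \<mu>)"
    "\<And>\<mu> X v. has_shape X sh \<mu> \<Longrightarrow> v \<in> slots sh' \<Longrightarrow> flat (F \<mu>) v = flat \<mu> (\<rho> v)"
    by (rule eenv_shape[OF assms(2), of sh]) (rule that; assumption)
  obtain S where S: "finite S" "within s sh' X S" using assms(1) unfolding ebound_def by metis
  have "within s sh (\<lambda>A \<mu>. X A (F \<mu>)) S"
    by (rule withinI) (rule withinD[OF S(2) _ F(2)])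
  with S(1) show "\<exists>S. finite S \<and> within s sh (\<lambda>A \<mu>. X A (F \<mu>)) S" by (intro exI conjI)
qed

lemma eset_subst: "eset s X \<Longrightarrow> eenv F \<Longrightarrow> eset s (\<lambda>A \<mu>. X A (F \<mu>))"
  using edef_subst[OF _ eenv_step, of s "\<lambda>A \<mu>. \<mu> 0 \<in> X A (\<lambda>x. \<mu> (Suc x))" F]
  by (simp add: eset_iff ebound_subst)

lemma eset_shift: "eset s X \<Longrightarrow> eset s (\<lambda>A \<mu>. X A (\<lambda>x. \<mu> (f x)))"
  using eset_subst[OF _ eenv_rename] .

lemma eterm_shift: "eterm t \<Longrightarrow> eterm (\<lambda>\<mu>. t (\<lambda>x. \<mu> (f x)))"
  using eterm_subst[OF _ eenv_rename] .

lemma edef_shift: "edef s Q \<Longrightarrow> edef s (\<lambda>A \<mu>. Q A (\<lambda>x. \<mu> (f x)))"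
  using edef_subst[OF _ eenv_rename] .

lemma eset_Un: "eset s X \<Longrightarrow> eset s Y \<Longrightarrow> eset s (\<lambda>A \<mu>. X A \<mu> \<union> Y A \<mu>)"
  by (simp add: eset_iff ebound_Un edef_disj)

lemma eset_single: "eterm t \<Longrightarrow> eset s (\<lambda>A \<mu>. {t \<mu>})"
  by (simp add: eset_iff ebound_single edef_eq eterm_var eterm_shift)

lemma eset_insert: "eterm t \<Longrightarrow> eset s X \<Longrightarrow> eset s (\<lambda>A \<mu>. insert (t \<mu>) (X A \<mu>))"
  using eset_Un[OF eset_single] by simp

lemma eset_Collect:
  assumes "eset s X" "edef s (\<lambda>A \<mu>. P A (\<lambda>x. \<mu> (Suc x)) (\<mu> 0))"
  shows "eset s (\<lambda>A \<mu>. {x \<in> X A \<mu>. P A \<mu> x})"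
  using assms ebound_subset[of s X "\<lambda>A \<mu>. {x \<in> X A \<mu>. P A \<mu> x}"] by (auto simp: eset_iff edef_conj)

lemma eset_UN:
  assumes X: "eset s X" and Y: "eset s (\<lambda>A \<mu>. Y A (\<lambda>x. \<mu> (Suc x)) (\<mu> 0))"
  shows "eset s (\<lambda>A \<mu>. \<Union>e \<in> X A \<mu>. Y A \<mu> e)"
proof -
  \<comment> \<open>Inside the quantifier, the index element occupies place 0 and the element tested
    for membership has moved to place 1; the substitution hides place 1 from
    \<open>Y\<close>.\<close>
  have "edef s (\<lambda>A \<mu>. \<mu> (Suc 0) \<in> Y A (\<lambda>x. \<mu> (Suc (Suc x))) (\<mu> 0))"
    using edef_mem[OF eset_subst[OF Y, of "\<lambda>\<mu>. case_nat (\<mu> 0) (\<lambda>x. \<mu> (Suc (Suc x)))"], of "\<lambda>\<mu>. \<mu> (Suc 0)"]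
    by (simp add: eenv_case eterm_var eenv_rename)
  from edef_ex[OF eset_shift[OF X] this] show ?thesis
    using ebound_UN[of s X Y] X Y by (simp add: eset_iff)
qed

lemma eset_if:
  assumes "edef s P" "eset s X" "eset s Y"
  shows "eset s (\<lambda>A \<mu>. if P A \<mu> then X A \<mu> else Y A \<mu>)"
proof -
  have "ebound s (\<lambda>A \<mu>. if P A \<mu> then X A \<mu> else Y A \<mu>)"
    by (rule ebound_subset[OF ebound_Un[of s X Y]]) (use assms in \<open>auto simp: eset_iff\<close>)
  moreover have "edef s (\<lambda>A \<mu>. if P A (\<lambda>x. \<mu> (Suc x)) then \<mu> 0 \<in> X A (\<lambda>x. \<mu> (Suc x)) else \<mu> 0 \<in> Y A (\<lambda>x. \<mu> (Suc x)))"
    using assms by (intro edef_if edef_shift[OF assms(1)]) (auto simp: eset_iff)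
  ultimately show ?thesis by (simp add: eset_iff if_distrib[of "\<lambda>X. _ \<in> X"])
qed

text \<open>Arities in the vocabularies of types are at most two.\<close>

definition eint :: "mty \<Rightarrow> ((sym, nat) struct \<Rightarrow> env \<Rightarrow> (sym, elem) struct) \<Rightarrow> bool" where
  "eint s G \<longleftrightarrow> eset s (\<lambda>A \<mu>. univ (G A \<mu>)) \<and>
     (\<forall>R. edef s (\<lambda>A \<mu>. [] \<in> rel (G A \<mu>) R) \<and>
       edef s (\<lambda>A \<mu>. [\<mu> 0] \<in> rel (G A (\<lambda>x. \<mu> (Suc x))) R) \<and>
       edef s (\<lambda>A \<mu>. [\<mu> 0, \<mu> (Suc 0)] \<in> rel (G A (\<lambda>x. \<mu> (Suc (Suc x)))) R))"

lemma eintI: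
  assumes "eset s (\<lambda>A \<mu>. univ (G A \<mu>))" "\<And>R. edef s (\<lambda>A \<mu>. [] \<in> rel (G A \<mu>) R)"
    "\<And>R. edef s (\<lambda>A \<mu>. [\<mu> 0] \<in> rel (G A (\<lambda>x. \<mu> (Suc x))) R)"
    "\<And>R. edef s (\<lambda>A \<mu>. [\<mu> 0, \<mu> (Suc 0)] \<in> rel (G A (\<lambda>x. \<mu> (Suc (Suc x)))) R)"
  shows "eint s G"
  using assms by (simp add: eint_def)

lemma eint_subst:
  assumes "eint s G" "eenv F"
  shows "eint s (\<lambda>A \<mu>. G A (F \<mu>))"
proof (rule eintI)
  show "eset s (\<lambda>A \<mu>. univ (G A (F \<mu>)))" using assms eset_subst[of s "\<lambda>A \<mu>. univ (G A \<mu>)" F] by (simp add: eint_def)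
  fix R
  show "edef s (\<lambda>A \<mu>. [] \<in> rel (G A (F \<mu>)) R)"
    using assms edef_subst[of s "\<lambda>A \<mu>. [] \<in> rel (G A \<mu>) R" F] by (simp add: eint_def)
  show "edef s (\<lambda>A \<mu>. [\<mu> 0] \<in> rel (G A (F (\<lambda>x. \<mu> (Suc x)))) R)"
    using assms edef_subst[OF _ eenv_step, of s "\<lambda>A \<mu>. [\<mu> 0] \<in> rel (G A (\<lambda>x. \<mu> (Suc x))) R" F] by (simp add: eint_def)
  show "edef s (\<lambda>A \<mu>. [\<mu> 0, \<mu> (Suc 0)] \<in> rel (G A (F (\<lambda>x. \<mu> (Suc (Suc x))))) R)"
    using assms edef_subst[OF _ eenv_step[OF eenv_step],
        of s "\<lambda>A \<mu>. [\<mu> 0, \<mu> (Suc 0)] \<in> rel (G A (\<lambda>x. \<mu> (Suc (Suc x)))) R" F] by (simp add: eint_def)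
qed

lemma eint_shift: "eint s G \<Longrightarrow> eint s (\<lambda>A \<mu>. G A (\<lambda>x. \<mu> (f x)))"
  using eint_subst[OF _ eenv_rename] .

lemma eset_univ: "eint s G \<Longrightarrow> eset s (\<lambda>A \<mu>. univ (G A \<mu>))"
  and edef_rel0: "eint s G \<Longrightarrow> edef s (\<lambda>A \<mu>. [] \<in> rel (G A \<mu>) R)"
  by (simp_all add: eint_def)

lemma edef_univ: "eint s G \<Longrightarrow> eterm t \<Longrightarrow> edef s (\<lambda>A \<mu>. t \<mu> \<in> univ (G A \<mu>))"
  by (intro edef_mem eset_univ)

lemma edef_rel1: "eint s G \<Longrightarrow> eterm t \<Longrightarrow> edef s (\<lambda>A \<mu>. [t \<mu>] \<in> rel (G A \<mu>) R)"
  using edef_subst[of s "\<lambda>A \<mu>. [\<mu> 0] \<in> rel (G A (\<lambda>x. \<mu> (Suc x))) R" "\<lambda>\<mu>. case_nat (t \<mu>) (\<lambda>x. \<mu> x)"]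
  by (simp add: eint_def eenv_case eenv_rename)

lemma edef_rel2: "eint s G \<Longrightarrow> eterm t \<Longrightarrow> eterm t' \<Longrightarrow> edef s (\<lambda>A \<mu>. [t \<mu>, t' \<mu>] \<in> rel (G A \<mu>) R)"
  using edef_subst[of s "\<lambda>A \<mu>. [\<mu> 0, \<mu> (Suc 0)] \<in> rel (G A (\<lambda>x. \<mu> (Suc (Suc x)))) R"
      "\<lambda>\<mu>. case_nat (t \<mu>) (case_nat (t' \<mu>) (\<lambda>x. \<mu> x))"]
  by (simp add: eint_def eenv_case eenv_rename)

lemmas edef_rules = edef_const edef_not edef_conj edef_disj edef_imp edef_if edef_eq edef_univ
  edef_rel0 edef_rel1 edef_rel2 eterm_var eterm_const eterm_pair

lemma eint_if:
  assumes "edef s P" "eint s G" "eint s G'"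
  shows "eint s (\<lambda>A \<mu>. if P A \<mu> then G A \<mu> else G' A \<mu>)"
proof (rule eintI)
  have u: "univ (if b then B else B') = (if b then univ B else univ B')"
    and r: "xs \<in> rel (if b then B else B') R \<longleftrightarrow> (if b then xs \<in> rel B R else xs \<in> rel B' R)"
    for b and B B' :: "(sym, elem) struct" and xs R by auto
  show "eset s (\<lambda>A \<mu>. univ (if P A \<mu> then G A \<mu> else G' A \<mu>))"
    unfolding u by (intro eset_if eset_univ assms)
  fix R
  show "edef s (\<lambda>A \<mu>. [] \<in> rel (if P A \<mu> then G A \<mu> else G' A \<mu>) R)"
    unfolding r by (intro edef_rules edef_shift[OF assms(1)] eint_shift[OF assms(2)] eint_shift[OF assms(3)])
  show "edef s (\<lambda>A \<mu>. [\<mu> 0] \<in> rel (if P A (\<lambda>x. \<mu> (Suc x)) then G A (\<lambda>x. \<mu> (Suc x)) else G' A (\<lambda>x. \<mu> (Suc x))) R)"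
    unfolding r by (intro edef_rules edef_shift[OF assms(1)] eint_shift[OF assms(2)] eint_shift[OF assms(3)])
  show "edef s (\<lambda>A \<mu>. [\<mu> 0, \<mu> (Suc 0)] \<in> rel (if P A (\<lambda>x. \<mu> (Suc (Suc x))) then G A (\<lambda>x. \<mu> (Suc (Suc x)))
      else G' A (\<lambda>x. \<mu> (Suc (Suc x)))) R)"
    unfolding r by (intro edef_rules edef_shift[OF assms(1)] eint_shift[OF assms(2)] eint_shift[OF assms(3)])
qed

lemma eint_inl: "eint s G \<Longrightarrow> eint s (\<lambda>A \<mu>. inl_struct (G A \<mu>))"
proof (rule eintI)
  assume G: "eint s G"
  show "eset s (\<lambda>A \<mu>. univ (inl_struct (G A \<mu>)))" using eset_univ[OF G] by simp
  fix R
  show "edef s (\<lambda>A \<mu>. [] \<in> rel (inl_struct (G A \<mu>)) R)"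
    "edef s (\<lambda>A \<mu>. [\<mu> 0] \<in> rel (inl_struct (G A (\<lambda>x. \<mu> (Suc x)))) R)"
    "edef s (\<lambda>A \<mu>. [\<mu> 0, \<mu> (Suc 0)] \<in> rel (inl_struct (G A (\<lambda>x. \<mu> (Suc (Suc x))))) R)"
    by (cases R; simp; intro edef_rules eint_shift[OF G])+
qed

lemma eint_inr: "eint s G \<Longrightarrow> eint s (\<lambda>A \<mu>. inr_struct (G A \<mu>))"
proof (rule eintI)
  assume G: "eint s G"
  show "eset s (\<lambda>A \<mu>. univ (inr_struct (G A \<mu>)))" using eset_univ[OF G] by simp
  fix R
  show "edef s (\<lambda>A \<mu>. [] \<in> rel (inr_struct (G A \<mu>)) R)"
    "edef s (\<lambda>A \<mu>. [\<mu> 0] \<in> rel (inr_struct (G A (\<lambda>x. \<mu> (Suc x)))) R)"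
    "edef s (\<lambda>A \<mu>. [\<mu> 0, \<mu> (Suc 0)] \<in> rel (inr_struct (G A (\<lambda>x. \<mu> (Suc (Suc x))))) R)"
    by (cases R; simp; intro edef_rules eint_shift[OF G])+
qed

lemma eint_prod:
  assumes G: "eint s G" and H: "eint s H"
  shows "eint s (\<lambda>A \<mu>. prod_struct (G A \<mu>) (H A \<mu>))"
proof (rule eintI)
  show "eset s (\<lambda>A \<mu>. univ (prod_struct (G A \<mu>) (H A \<mu>)))"
    unfolding univ_prod_struct by (intro eset_Un eset_univ G H)
  fix R
  show "edef s (\<lambda>A \<mu>. [] \<in> rel (prod_struct (G A \<mu>) (H A \<mu>)) R)"
    "edef s (\<lambda>A \<mu>. [\<mu> 0] \<in> rel (prod_struct (G A (\<lambda>x. \<mu> (Suc x))) (H A (\<lambda>x. \<mu> (Suc x)))) R)"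
    "edef s (\<lambda>A \<mu>. [\<mu> 0, \<mu> (Suc 0)] \<in> rel (prod_struct (G A (\<lambda>x. \<mu> (Suc (Suc x)))) (H A (\<lambda>x. \<mu> (Suc (Suc x))))) R)"
    by (cases R; simp; intro edef_rules eint_shift[OF G] eint_shift[OF H])+
qed

lemma eint_unl: "eint s G \<Longrightarrow> eint s (\<lambda>A \<mu>. unl (G A \<mu>))"
  and eint_unr: "eint s G \<Longrightarrow> eint s (\<lambda>A \<mu>. unr (G A \<mu>))"
  by (simp_all add: eint_def)

lemma eint_fst:
  assumes "eint s G" shows "eint s (\<lambda>A \<mu>. fst_struct (G A \<mu>))"
  unfolding eint_def univ_fst_struct rel_destr
  by (intro conjI allI eset_Collect eset_univ edef_rules eint_shift[OF assms])

lemma eint_snd: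
  assumes "eint s G" shows "eint s (\<lambda>A \<mu>. snd_struct (G A \<mu>))"
  unfolding eint_def univ_snd_struct rel_destr
  by (intro conjI allI eset_Collect eset_univ edef_rules eint_shift[OF assms])

lemma eint_point: "eint s (\<lambda>A \<mu>. \<lparr>univ = {(c, [])}, rel = (\<lambda>_. {})\<rparr>)"
  unfolding eint_def by (simp add: eset_single[OF eterm_const] edef_const)

text \<open>\<^const>\<open>block\<close> collects elements from \<open>\<sim>\<close> without intersecting with the universe;
  removing tuples outside the universe first keeps its universe bounded for arbitrary structures.\<close>

definition clean :: "(sym, 'a) struct \<Rightarrow> (sym, 'a) struct" where
  "clean A = \<lparr>univ = univ A, rel = (\<lambda>R. {xs \<in> rel A R. set xs \<subseteq> univ A})\<rparr>"

lemma univ_clean [simp]: "univ (clean A) = univ A"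
  by (simp add: clean_def)

lemma clean_eq: "represents t v A \<Longrightarrow> clean A = A"
  using represents_rel[of t v A] by (intro struct.equality) (auto simp: clean_def fun_eq_iff)

lemma eint_clean:
  assumes "eint s G" shows "eint s (\<lambda>A \<mu>. clean (G A \<mu>))"
  unfolding eint_def clean_def
  by (simp del: subset_insertI2 split del: if_split) (intro conjI allI eset_univ edef_rules eint_shift[OF assms] assms)

lemma eint_block:
  assumes G: "eint s G" and t: "eterm t"
  shows "eint s (\<lambda>A \<mu>. block V (clean (G A \<mu>)) (t \<mu>))"
proof -
  note C = eint_clean[OF G]
  have u: "univ (block V (clean B) a) = {b \<in> univ B. [a, b] \<in> rel (clean B) Fresh}" for B :: "(sym, elem) struct" and a
    by (auto simp: univ_block clean_def)
  show ?thesis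
  proof (rule eintI)
    show "eset s (\<lambda>A \<mu>. univ (block V (clean (G A \<mu>)) (t \<mu>)))" unfolding u
      by (intro eset_Collect eset_univ edef_rules eint_shift[OF C] G eterm_shift[OF t])
    fix R
    show "edef s (\<lambda>A \<mu>. [] \<in> rel (block V (clean (G A \<mu>)) (t \<mu>)) R)"
      "edef s (\<lambda>A \<mu>. [\<mu> 0] \<in> rel (block V (clean (G A (\<lambda>x. \<mu> (Suc x)))) (t (\<lambda>x. \<mu> (Suc x)))) R)"
      "edef s (\<lambda>A \<mu>. [\<mu> 0, \<mu> (Suc 0)] \<in>
        rel (block V (clean (G A (\<lambda>x. \<mu> (Suc (Suc x))))) (t (\<lambda>x. \<mu> (Suc (Suc x))))) R)"
      by (cases "V R = Some 0"; simp add: block_def; intro edef_rules eint_shift[OF C] eterm_shift[OF t])+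
  qed
qed

lemma eint_rest:
  assumes G: "eint s G" and t: "eterm t"
  shows "eint s (\<lambda>A \<mu>. rest (G A \<mu>) (t \<mu>))"
proof (rule eintI)
  show "eset s (\<lambda>A \<mu>. univ (rest (G A \<mu>) (t \<mu>)))" unfolding univ_rest
    by (intro eset_Collect eset_univ edef_rules eint_shift[OF G] eterm_shift[OF t])
  fix R
  show "edef s (\<lambda>A \<mu>. [] \<in> rel (rest (G A \<mu>) (t \<mu>)) R)"
    "edef s (\<lambda>A \<mu>. [\<mu> 0] \<in> rel (rest (G A (\<lambda>x. \<mu> (Suc x))) (t (\<lambda>x. \<mu> (Suc x)))) R)"
    "edef s (\<lambda>A \<mu>. [\<mu> 0, \<mu> (Suc 0)] \<in>
      rel (rest (G A (\<lambda>x. \<mu> (Suc (Suc x)))) (t (\<lambda>x. \<mu> (Suc (Suc x))))) R)"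
    by (simp add: rest_def; intro edef_rules eint_shift[OF G] eterm_shift[OF t])+
qed

lemma edef_is_root:
  assumes t: "eterm t" shows "eint s G \<Longrightarrow> edef s (\<lambda>A \<mu>. is_root ty (G A \<mu>) (t \<mu>))"
proof (induction ty arbitrary: G)
  case (TSum ty1 ty2)
  then show ?case by (simp only: is_root.simps) (intro edef_if edef_rel0 TSum.IH eint_unl eint_unr)
next
  case (TProd ty1 ty2)
  then show ?case by (simp only: is_root.simps) (intro edef_rules TProd.IH eint_fst t)
next
  case (TMul ty)
  then show ?case by (simp only: is_root.simps) (intro edef_rules t)
qed (simp add: edef_const)

lemma eset_roots:
  assumes G: "eint s G" shows "eset s (\<lambda>A \<mu>. roots ty (clean (G A \<mu>)))"
  unfolding roots_def
  by (intro eset_Collect eset_univ eint_clean G edef_conj edef_rel2 edef_is_root eterm_var eint_block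
      eint_shift[OF G] eint_shift[OF eint_clean[OF G]])

text \<open>The class with index \<open>c\<close> is the interpretation \<open>G\<close> with
  \<open>c\<close> as an extra parameter in place 0. This is where an interpretation of one class
  yields an interpretation of the whole multiset.\<close>

lemma eint_mulf:
  assumes C: "eset s C" and G: "eint s G" and r: "eterm r"
  shows "eint s (\<lambda>A \<mu>. mulf V (r \<mu>) (\<lambda>c. G A (case_nat c \<mu>)) (C A \<mu>))"
proof -
  have G': "eterm t \<Longrightarrow> eenv F \<Longrightarrow> eint s (\<lambda>A \<mu>. G A (case_nat (t \<mu>) (F \<mu>)))" for t F
    by (intro eint_subst[OF G] eenv_case)
  show ?thesis
  proof (rule eintI)
    show "eset s (\<lambda>A \<mu>. univ (mulf V (r \<mu>) (\<lambda>c. G A (case_nat c \<mu>)) (C A \<mu>)))"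
      unfolding univ_mulf by (intro eset_insert r eset_UN C eset_univ G' eterm_var eenv_rename)
    have C': "eset s (\<lambda>A \<mu>. C A (\<lambda>x. \<mu> (f x)))" for f by (rule eset_shift[OF C])
    have U: "eset s (\<lambda>A \<mu>. univ (G A (case_nat (\<mu> n) (\<lambda>x. \<mu> (f x)))))" for f n
      by (intro eset_univ G' eterm_var eenv_rename)
    fix R
    show "edef s (\<lambda>A \<mu>. [] \<in> rel (mulf V (r \<mu>) (\<lambda>c. G A (case_nat c \<mu>)) (C A \<mu>)) R)"
    proof (cases R)
      case (SymL R')
      show ?thesis
        by (cases "V R' = Some 0") (simp_all add: SymL rel_mulf_SymL edef_const,
          intro edef_ex C edef_rules G' eenv_rename)
    qed (simp_all add: rel_mulf_Fresh rel_mulf_SymR edef_const)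
    show "edef s (\<lambda>A \<mu>. [\<mu> 0] \<in> rel (mulf V (r (\<lambda>x. \<mu> (Suc x))) (\<lambda>c. G A (case_nat c (\<lambda>x. \<mu> (Suc x)))) (C A (\<lambda>x. \<mu> (Suc x)))) R)"
    proof (cases R)
      case (SymL R')
      have "edef s (\<lambda>A \<mu>. \<exists>c\<in>C A (\<lambda>x. \<mu> (Suc x)). \<exists>a\<in>univ (G A (case_nat c (\<lambda>x. \<mu> (Suc x)))).
         \<mu> 0 = a \<and> [] \<in> rel (G A (case_nat c (\<lambda>x. \<mu> (Suc x)))) R')"
        by (intro edef_ex C' U edef_rules G' eenv_rename)
      moreover have "edef s (\<lambda>A \<mu>. \<exists>c\<in>C A (\<lambda>x. \<mu> (Suc x)). [\<mu> 0] \<in> rel (G A (case_nat c (\<lambda>x. \<mu> (Suc x)))) R')"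
        by (intro edef_ex C' U edef_rules G' eenv_rename)
      ultimately show ?thesis
        by (cases "V R' = Some 0") (simp_all add: SymL rel_mulf_SymL)
    qed (simp_all add: rel_mulf_Fresh rel_mulf_SymR edef_const)
    show "edef s (\<lambda>A \<mu>. [\<mu> 0, \<mu> (Suc 0)] \<in> rel (mulf V (r (\<lambda>x. \<mu> (Suc (Suc x))))
        (\<lambda>c. G A (case_nat c (\<lambda>x. \<mu> (Suc (Suc x))))) (C A (\<lambda>x. \<mu> (Suc (Suc x))))) R)"
    proof (cases R)
      case Fresh
      have "edef s (\<lambda>A \<mu>. \<exists>c\<in>C A (\<lambda>x. \<mu> (Suc (Suc x))). \<mu> 0 \<in> univ (G A (case_nat c (\<lambda>x. \<mu> (Suc (Suc x))))) \<and>
          \<mu> (Suc 0) \<in> univ (G A (case_nat c (\<lambda>x. \<mu> (Suc (Suc x))))))"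
        by (intro edef_ex C' U edef_rules G' eenv_rename)
      then show ?thesis by (simp add: Fresh rel_mulf_Fresh)
    next
      case (SymL R')
      have "edef s (\<lambda>A \<mu>. \<exists>c\<in>C A (\<lambda>x. \<mu> (Suc (Suc x))). [\<mu> 0, \<mu> (Suc 0)] \<in> rel (G A (case_nat c (\<lambda>x. \<mu> (Suc (Suc x))))) R')"
        by (intro edef_ex C' U edef_rules G' eenv_rename)
      then show ?thesis
        by (cases "V R' = Some 0") (simp_all add: SymL rel_mulf_SymL edef_const)
    qed (simp_all add: rel_mulf_SymR edef_const)
  qed
qed

text \<open>Cleaning forces the preimages of the entries of a tuple into the universe, so that the
  image relations are expressed with quantifiers bounded by a definable set.\<close>

lemma map_struct_pair_elem:
  "univ (map_struct (pair_elem c) B) = (\<Union>e \<in> univ B. {pair_elem c e})"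
  "[] \<in> rel (map_struct (pair_elem c) B) R \<longleftrightarrow> [] \<in> rel B R"
  "[x] \<in> rel (map_struct (pair_elem c) (clean B)) R \<longleftrightarrow> (\<exists>e \<in> univ B. x = pair_elem c e \<and> [e] \<in> rel B R)"
  "[x, y] \<in> rel (map_struct (pair_elem c) (clean B)) R \<longleftrightarrow>
    (\<exists>e \<in> univ B. \<exists>e' \<in> univ B. x = pair_elem c e \<and> y = pair_elem c e' \<and> [e, e'] \<in> rel B R)"
proof -
  show "univ (map_struct (pair_elem c) B) = (\<Union>e \<in> univ B. {pair_elem c e})" by (auto simp: map_struct_def)
  show "[] \<in> rel (map_struct (pair_elem c) B) R \<longleftrightarrow> [] \<in> rel B R" by (auto simp: map_struct_def)
  show "[x] \<in> rel (map_struct (pair_elem c) (clean B)) R \<longleftrightarrow> (\<exists>e \<in> univ B. x = pair_elem c e \<and> [e] \<in> rel B R)"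
    by (auto simp: map_struct_def clean_def image_iff Cons_eq_map_conv)
  show "[x, y] \<in> rel (map_struct (pair_elem c) (clean B)) R \<longleftrightarrow>
    (\<exists>e \<in> univ B. \<exists>e' \<in> univ B. x = pair_elem c e \<and> y = pair_elem c e' \<and> [e, e'] \<in> rel B R)"
    by (auto simp: map_struct_def clean_def image_iff Cons_eq_map_conv)
qed

text \<open>Tags a copy of the structure with a parameter; copies with different tags are disjoint,
  since \<open>pair_elem\<close> is injective in both arguments.\<close>

lemma eint_pair_elem:
  assumes G: "eint s G" and t: "eterm t"
  shows "eint s (\<lambda>A \<mu>. map_struct (pair_elem (t \<mu>)) (clean (G A \<mu>)))"
  unfolding eint_def map_struct_pair_elem univ_clean
  by (intro conjI allI eset_UN eset_single edef_ex eset_univ edef_rules eint_shift[OF G]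
      eint_shift[OF eint_clean[OF G]] eterm_shift[OF t] G)

section \<open>Derivable functions preserve interpretations\<close>

lemma voc_Mul_neq_0: "voc (TMul t) R \<noteq> Some 0"
  by (cases R) auto

text \<open>Deletes the roots of the inner multisets: these are the elements related to themselves
  by the outer but not by the inner equivalence. The outer root stays and becomes the root of the
  union.\<close>

definition union_struct :: "(sym, 'a) struct \<Rightarrow> (sym, 'a) struct" where
  "union_struct B = \<lparr>univ = {x \<in> univ B. [x, x] \<notin> rel B Fresh \<or> [x, x] \<in> rel B (SymL Fresh)},
     rel = (\<lambda>R. rel B (SymL R))\<rparr>"

text \<open>The classes of the union are the inner classes \<open>K c d\<close>, indexed by
  \<open>Sigma C D\<close>. The outer multiset passes the inner relations on unchanged, because
  \<open>TMul t\<close> has no nullary symbols that would have to become unary.\<close>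

lemma represents_union:
  assumes B: "represents (TMul (TMul t)) v B"
  shows "represents (TMul t) (union_fn v) (union_struct B)"
proof -
  define H where "H = block (voc (TMul t)) B"
  define C where "C = roots (TMul t) B"
  define K where "K c = block (voc t) (H c)" for c
  define D where "D c = roots t (H c)" for c
  from represents_Mul_roots[OF B] obtain r where
    H: "finite C" "\<And>c. c \<in> C \<Longrightarrow> represents (TMul t) (val_of (TMul t) (H c)) (H c)"
      "disjoint_family_struct H C" "\<And>c. c \<in> C \<Longrightarrow> r \<notin> univ (H c)"
      "B = mulf (voc (TMul t)) r H C" "v = VMul (\<Sum>c\<in>C. {#val_of (TMul t) (H c)#})"
    unfolding H_def C_def by (metis (no_types, lifting))
  have "\<exists>rr. finite (D c) \<and> (\<forall>d\<in>D c. represents t (val_of t (K c d)) (K c d)) \<and>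
      disjoint_family_struct (K c) (D c) \<and> H c = mulf (voc t) rr (K c) (D c) \<and> (\<forall>d\<in>D c. rr \<notin> univ (K c d)) \<and>
      val_of (TMul t) (H c) = VMul (\<Sum>d\<in>D c. {#val_of t (K c d)#})" if "c \<in> C" for c
    using represents_Mul_roots[OF H(2)[OF that]] unfolding D_def K_def by (metis (no_types, lifting))
  then have "\<exists>rr. \<forall>c\<in>C. finite (D c) \<and> (\<forall>d\<in>D c. represents t (val_of t (K c d)) (K c d)) \<and>
      disjoint_family_struct (K c) (D c) \<and> H c = mulf (voc t) (rr c) (K c) (D c) \<and> (\<forall>d\<in>D c. rr c \<notin> univ (K c d)) \<and>
      val_of (TMul t) (H c) = VMul (\<Sum>d\<in>D c. {#val_of t (K c d)#})" by (intro bchoice ballI)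
  then obtain rr where rr: "\<forall>c\<in>C. finite (D c) \<and> (\<forall>d\<in>D c. represents t (val_of t (K c d)) (K c d)) \<and>
      disjoint_family_struct (K c) (D c) \<and> H c = mulf (voc t) (rr c) (K c) (D c) \<and> (\<forall>d\<in>D c. rr c \<notin> univ (K c d)) \<and>
      val_of (TMul t) (H c) = VMul (\<Sum>d\<in>D c. {#val_of t (K c d)#})"
    ..
  then have K: "\<And>c. c \<in> C \<Longrightarrow> finite (D c)"
    "\<And>c d. c \<in> C \<Longrightarrow> d \<in> D c \<Longrightarrow> represents t (val_of t (K c d)) (K c d)"
    "\<And>c. c \<in> C \<Longrightarrow> disjoint_family_struct (K c) (D c)"
    "\<And>c. c \<in> C \<Longrightarrow> H c = mulf (voc t) (rr c) (K c) (D c)"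
    "\<And>c d. c \<in> C \<Longrightarrow> d \<in> D c \<Longrightarrow> rr c \<notin> univ (K c d)"
    "\<And>c. c \<in> C \<Longrightarrow> val_of (TMul t) (H c) = VMul (\<Sum>d\<in>D c. {#val_of t (K c d)#})" by blast+
  let ?M = "mulf (voc t) r (\<lambda>(c, d). K c d) (Sigma C D)"
  have sub: "univ (K c d) \<subseteq> univ (H c)" if "c \<in> C" "d \<in> D c" for c d
    using that(2) by (subst K(4)[OF that(1)]) (auto simp: univ_mulf)
  have relB: "xs \<in> rel B (SymL R) \<longleftrightarrow> (\<exists>c\<in>C. xs \<in> rel (H c) R)" for xs R
    unfolding H(5) by (simp add: rel_mulf_SymL voc_Mul_neq_0 del: voc.simps)
  have relH: "xs \<in> rel (H c) R \<longleftrightarrow> xs \<in> rel (mulf (voc t) (rr c) (K c) (D c)) R" if "c \<in> C" for c xs R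
    by (subst K(4)[OF that]) simp
  have bex: "(\<exists>x\<in>Sigma C D. P x) \<longleftrightarrow> (\<exists>c\<in>C. \<exists>d\<in>D c. P (c, d))" for P by auto
  have "xs \<in> rel B (SymL R) \<longleftrightarrow> xs \<in> rel ?M R" for xs R
    by (cases R) (simp_all add: relB relH rel_mulf_Fresh rel_mulf_SymL rel_mulf_SymR bex cong: bex_cong)
  then have "rel B (SymL R) = rel ?M R" for R by blast
  moreover have "univ (union_struct B) = univ ?M"
  proof -
    have "[x, x] \<in> rel B (SymL Fresh) \<longleftrightarrow> (\<exists>c\<in>C. \<exists>d\<in>D c. x \<in> univ (K c d))" for x
      unfolding relB by (auto simp: relH rel_mulf_Fresh)
    moreover have "[x, x] \<in> rel B Fresh \<longleftrightarrow> (\<exists>c\<in>C. x \<in> univ (H c))" for x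
      unfolding H(5) by (auto simp: rel_mulf_Fresh)
    moreover have "univ B = insert r (\<Union>c\<in>C. univ (H c))" unfolding H(5) univ_mulf ..
    ultimately show ?thesis using H(4) sub by (fastforce simp: union_struct_def univ_mulf)
  qed
  ultimately have eq: "union_struct B = ?M"
    by (intro struct.equality) (auto simp: union_struct_def fun_eq_iff)
  have "represents (TMul t) (VMul (\<Sum>x\<in>Sigma C D. {#case x of (c, d) \<Rightarrow> val_of t (K c d)#})) ?M"
  proof (rule represents_mulf)
    show "finite (Sigma C D)" using H(1) K(1) by blast
    show "disjoint_family_struct (\<lambda>(c, d). K c d) (Sigma C D)"
      unfolding disjoint_family_struct_def
    proof (intro ballI impI)
      fix x y assume xy: "x \<in> Sigma C D" "y \<in> Sigma C D" "x \<noteq> y"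
      obtain c d c' d' where [simp]: "x = (c, d)" "y = (c', d')" by (cases x, cases y)
      have c: "c \<in> C" "d \<in> D c" "c' \<in> C" "d' \<in> D c'" using xy by auto
      show "univ (case x of (c, d) \<Rightarrow> K c d) \<inter> univ (case y of (c, d) \<Rightarrow> K c d) = {}"
      proof (cases "c = c'")
        case True
        then show ?thesis using xy K(3)[OF c(1)] by (auto simp: disjoint_family_struct_def)
      next
        case False
        then have "univ (H c) \<inter> univ (H c') = {}" using H(3) c by (auto simp: disjoint_family_struct_def)
        then show ?thesis using sub[OF c(1,2)] sub[OF c(3,4)] by auto
      qed
    qed
    show "r \<notin> univ (case x of (c, d) \<Rightarrow> K c d)" if x: "x \<in> Sigma C D" for x
    proof -
      obtain c d where x: "x = (c, d)" "c \<in> C" "d \<in> D c" using x by blast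
      show ?thesis using H(4)[OF x(2)] sub[OF x(2,3)] x(1) by auto
    qed
  qed (use K(2) in auto)
  moreover have "union_fn v = VMul (\<Sum>x\<in>Sigma C D. {#case x of (c, d) \<Rightarrow> val_of t (K c d)#})"
  proof -
    have "union_fn v = VMul (\<Sum>c\<in>C. elems (val_of (TMul t) (H c)))"
      unfolding H(6) by (simp add: union_fn_def sum_mset_sum_single)
    also have "(\<Sum>c\<in>C. elems (val_of (TMul t) (H c))) = (\<Sum>c\<in>C. \<Sum>d\<in>D c. {#val_of t (K c d)#})"
      using K(6) by (intro sum.cong) auto
    also have "\<dots> = (\<Sum>x\<in>Sigma C D. {#case x of (c, d) \<Rightarrow> val_of t (K c d)#})"
      using H(1) K(1) by (subst sum.Sigma) (auto simp: case_prod_unfold)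
    finally show ?thesis .
  qed
  ultimately show ?thesis unfolding eq by simp
qed

text \<open>The left factor of the product becomes one more class, so its nullary symbols turn into
  unary ones that hold on all of it. The root of the right factor serves as root of the
  result.\<close>

definition add_struct :: "sym vocab \<Rightarrow> (sym, 'a) struct \<Rightarrow> (sym, 'a) struct" where
  "add_struct V B = \<lparr>univ = univ B, rel = case_sym
     ({[x, y] | x y. x \<in> univ B \<and> y \<in> univ B \<and> [x] \<in> rel B Fresh \<and> [y] \<in> rel B Fresh} \<union> rel B (SymR Fresh))
     (\<lambda>R. (if V R = Some 0 then {[x] | x. x \<in> univ B \<and> [x] \<in> rel B Fresh \<and> [] \<in> rel B (SymL R)}
        else rel B (SymL R)) \<union> rel B (SymR (SymL R)))
     (\<lambda>_. {})\<rparr>"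

lemma represents_add:
  assumes "represents (TProd t (TMul t)) v B"
  shows "represents (TMul t) (add_fn v) (add_struct (voc t) B)"
proof -
  let ?A = "fst_struct B" and ?M = "snd_struct B"
  from assms obtain w w' where v: "v = VPair w w'" "represents t w ?A" "represents (TMul t) w' ?M"
    "univ ?A \<inter> univ ?M = {}" by (rule represents_ProdD)
  define H where "H = block (voc t) ?M"
  define C where "C = roots t ?M"
  from represents_Mul_roots[OF v(3)] obtain r where
    H: "finite C" "\<And>c. c \<in> C \<Longrightarrow> represents t (val_of t (H c)) (H c)"
      "disjoint_family_struct H C" "\<And>c. c \<in> C \<Longrightarrow> r \<notin> univ (H c)"
      "?M = mulf (voc t) r H C" "w' = VMul (\<Sum>c\<in>C. {#val_of t (H c)#})"
    unfolding H_def C_def by (metis (no_types, lifting))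
  \<comment> \<open>\<open>None\<close> indexes the added class, and \<open>Some c\<close> the old
    class of \<open>c\<close>.\<close>
  define K where "K = case_option ?A H"
  define D where "D = insert None (Some ` C)"
  have uM: "univ ?M = insert r (\<Union>c\<in>C. univ (H c))" unfolding H(5) univ_mulf ..
  have K: "K None = ?A" "\<And>c. K (Some c) = H c" by (simp_all add: K_def)
  have uB: "univ B = univ ?A \<union> univ ?M" by (auto simp: univ_fst_struct univ_snd_struct)
  have uA: "x \<in> univ B \<and> [x] \<in> rel B Fresh \<longleftrightarrow> x \<in> univ ?A" for x by (auto simp: univ_fst_struct)
  have relA: "rel B (SymL R) = rel ?A R" for R by simp
  have relM: "xs \<in> rel B (SymR R) \<longleftrightarrow> xs \<in> rel (mulf (voc t) r H C) R" for xs R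
    unfolding H(5)[symmetric] by simp
  have "add_struct (voc t) B = mulf (voc t) r K D"
  proof (rule struct.equality)
    show "univ (add_struct (voc t) B) = univ (mulf (voc t) r K D)"
      using uB uM by (auto simp: add_struct_def univ_mulf D_def K)
    have "xs \<in> rel (add_struct (voc t) B) R \<longleftrightarrow> xs \<in> rel (mulf (voc t) r K D) R" for xs R
    proof (cases R)
      case Fresh
      have "xs \<in> rel (add_struct (voc t) B) Fresh \<longleftrightarrow> (\<exists>x\<in>univ ?A. \<exists>y\<in>univ ?A. xs = [x, y]) \<or> xs \<in> rel B (SymR Fresh)"
        using uA by (auto simp: add_struct_def)
      then show ?thesis by (simp add: Fresh relM rel_mulf_Fresh D_def K)
    next
      case (SymL R')
      have "xs \<in> rel (add_struct (voc t) B) (SymL R') \<longleftrightarrow>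
        (if voc t R' = Some 0 then \<exists>x\<in>univ ?A. xs = [x] \<and> [] \<in> rel ?A R' else xs \<in> rel ?A R') \<or> xs \<in> rel B (SymR (SymL R'))"
        using uA by (auto simp: add_struct_def)
      then show ?thesis by (simp add: SymL relM rel_mulf_SymL D_def K)
    qed (simp add: add_struct_def rel_mulf_SymR)
    then show "rel (add_struct (voc t) B) = rel (mulf (voc t) r K D)" by blast
  qed simp
  moreover have "represents (TMul t) (VMul (\<Sum>c\<in>D. {#val_of t (K c)#})) (mulf (voc t) r K D)"
  proof (rule represents_mulf)
    show "disjoint_family_struct K D"
      using H(3) v(4) uM unfolding disjoint_family_struct_def D_def by (auto simp: K)
    show "represents t (val_of t (K c)) (K c)" if "c \<in> D" for c
      using that H(2) represents_val_of[OF v(2)] by (auto simp: D_def K)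
    show "r \<notin> univ (K c)" if "c \<in> D" for c
      using that H(4) v(4) uM by (auto simp: D_def K)
  qed (simp add: D_def H(1))
  moreover have "(\<Sum>c\<in>D. {#val_of t (K c)#}) = add_mset w (\<Sum>c\<in>C. {#val_of t (H c)#})"
    using H(1) by (simp add: D_def sum.reindex K val_of_eq[OF v(2)])
  ultimately show ?thesis by (simp add: add_fn_def v(1) H(6))
qed

text \<open>Meant for a multiset with a single class: the root is dropped, and a nullary symbol is
  recovered from its unary version as "holds somewhere", which is correct because the class is
  nonempty.\<close>

definition only_struct :: "sym vocab \<Rightarrow> (sym, 'a) struct \<Rightarrow> (sym, 'a) struct" where
  "only_struct V B = \<lparr>univ = {x \<in> univ B. [x, x] \<in> rel B Fresh},
     rel = (\<lambda>R. if V R = Some 0 then {xs. xs = [] \<and> (\<exists>x \<in> univ B. [x] \<in> rel B (SymL R))} else rel B (SymL R))\<rparr>"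

lemma represents_only:
  assumes B: "represents (TMul t) v B" and c: "roots t B = {c}"
  shows "represents t (val_of t (block (voc t) B c)) (only_struct (voc t) B)" "v = VMul {#val_of t (block (voc t) B c)#}"
proof -
  define H where "H = block (voc t) B"
  from represents_Mul_roots[OF B] obtain r where
    H: "represents t (val_of t (H c)) (H c)" "r \<notin> univ (H c)" "B = mulf (voc t) r H {c}"
      "v = VMul (\<Sum>c\<in>{c}. {#val_of t (H c)#})"
    unfolding H_def c by (metis (no_types, lifting) singletonI)
  have "only_struct (voc t) B = H c"
  proof (rule struct.equality)
    show "univ (only_struct (voc t) B) = univ (H c)"
      unfolding H(3) by (auto simp: only_struct_def rel_mulf_Fresh univ_mulf)
    have "rel (only_struct (voc t) B) R = rel (H c) R" for R
    proof (cases "voc t R = Some 0")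
      case True
      have "(\<exists>x \<in> univ B. [x] \<in> rel B (SymL R)) \<longleftrightarrow> [] \<in> rel (H c) R"
        unfolding H(3) using represents_nonempty[OF H(1)] True by (auto simp: rel_mulf_SymL univ_mulf)
      moreover have "xs = []" if "xs \<in> rel (H c) R" for xs
        using represents_rel[OF H(1) that] True by simp
      ultimately show ?thesis using True by (auto simp: only_struct_def)
    next
      case False
      then have "rel (only_struct (voc t) B) R = rel (mulf (voc t) r H {c}) (SymL R)"
        unfolding H(3)[symmetric] by (simp add: only_struct_def)
      also have "\<dots> = rel (H c) R" using False by (intro set_eqI) (simp add: rel_mulf_SymL)
      finally show ?thesis .
    qed
    then show "rel (only_struct (voc t) B) = rel (H c)" by blast
  qed simp
  then show "represents t (val_of t (block (voc t) B c)) (only_struct (voc t) B)" using H(1) by (simp add: H_def)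
  show "v = VMul {#val_of t (block (voc t) B c)#}" using H(4) by (simp add: H_def)
qed

lemma size_sum_single: "finite C \<Longrightarrow> size (\<Sum>c\<in>C. {#h c#}) = card C"
  by (induction C rule: finite_induct) auto

text \<open>The tags make the classes disjoint, whatever the universes of the \<open>K c\<close>
  are. The element \<open>(0, [])\<close> is a fresh root, because \<open>pair_elem\<close> only
  yields nonzero components.\<close>

lemma represents_mulf_pair:
  assumes "finite C" "\<And>c. c \<in> C \<Longrightarrow> represents t (val c) (K c)"
  shows "represents (TMul t) (VMul (\<Sum>c\<in>C. {#val c#}))
    (mulf (voc t) (0, []) (\<lambda>c. map_struct (pair_elem c) (clean (K c))) C)"
proof (rule represents_mulf)
  show "represents t (val c) (map_struct (pair_elem c) (clean (K c)))" if "c \<in> C" for c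
    unfolding clean_eq[OF assms(2)[OF that]]
    by (rule represents_map_struct[OF assms(2)[OF that]]) (simp add: inj_on_def)
qed (use assms(1) in \<open>auto simp: disjoint_family_struct_def map_struct_def\<close>)

lemma eint_union: "eint s G \<Longrightarrow> eint s (\<lambda>A \<mu>. union_struct (G A \<mu>))"
proof -
  assume G: "eint s G"
  show ?thesis unfolding eint_def union_struct_def
    by (simp, intro conjI allI eset_Collect eset_univ edef_rules eint_shift[OF G] G)
qed

lemma rel_add_struct:
  "[x] \<in> rel (add_struct V B) (SymL R) \<longleftrightarrow>
      (if V R = Some 0 then x \<in> univ B \<and> [x] \<in> rel B Fresh \<and> [] \<in> rel B (SymL R) else [x] \<in> rel B (SymL R)) \<or>
      [x] \<in> rel B (SymR (SymL R))"
  "[x, y] \<in> rel (add_struct V B) (SymL R) \<longleftrightarrow> V R \<noteq> Some 0 \<and> [x, y] \<in> rel B (SymL R) \<or> [x, y] \<in> rel B (SymR (SymL R))"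
  "[] \<in> rel (add_struct V B) (SymL R) \<longleftrightarrow> V R \<noteq> Some 0 \<and> [] \<in> rel B (SymL R) \<or> [] \<in> rel B (SymR (SymL R))"
  "[x, y] \<in> rel (add_struct V B) Fresh \<longleftrightarrow> x \<in> univ B \<and> y \<in> univ B \<and> [x] \<in> rel B Fresh \<and> [y] \<in> rel B Fresh \<or>
      [x, y] \<in> rel B (SymR Fresh)"
  "[x] \<in> rel (add_struct V B) Fresh \<longleftrightarrow> [x] \<in> rel B (SymR Fresh)"
  "[] \<in> rel (add_struct V B) Fresh \<longleftrightarrow> [] \<in> rel B (SymR Fresh)"
  "rel (add_struct V B) (SymR R) = {}"
  by (auto simp: add_struct_def)

lemma eint_add: "eint s G \<Longrightarrow> eint s (\<lambda>A \<mu>. add_struct V (G A \<mu>))"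
proof (rule eintI)
  assume G: "eint s G"
  show "eset s (\<lambda>A \<mu>. univ (add_struct V (G A \<mu>)))" using eset_univ[OF G] by (simp add: add_struct_def)
  fix R
  show "edef s (\<lambda>A \<mu>. [] \<in> rel (add_struct V (G A \<mu>)) R)"
    "edef s (\<lambda>A \<mu>. [\<mu> 0] \<in> rel (add_struct V (G A (\<lambda>x. \<mu> (Suc x)))) R)"
    "edef s (\<lambda>A \<mu>. [\<mu> 0, \<mu> (Suc 0)] \<in> rel (add_struct V (G A (\<lambda>x. \<mu> (Suc (Suc x))))) R)"
    by (cases R; simp add: rel_add_struct; intro edef_rules eint_shift[OF G])+
qed

lemma eint_only: "eint s G \<Longrightarrow> eint s (\<lambda>A \<mu>. only_struct V (G A \<mu>))"
proof (rule eintI)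
  assume G: "eint s G"
  have U: "eset s (\<lambda>A \<mu>. univ (G A (\<lambda>x. \<mu> (f x))))" for f by (rule eset_univ[OF eint_shift[OF G]])
  show "eset s (\<lambda>A \<mu>. univ (only_struct V (G A \<mu>)))" unfolding only_struct_def
    by (simp, intro eset_Collect eset_univ edef_rules eint_shift[OF G] G)
  fix R
  show "edef s (\<lambda>A \<mu>. [] \<in> rel (only_struct V (G A \<mu>)) R)"
    "edef s (\<lambda>A \<mu>. [\<mu> 0] \<in> rel (only_struct V (G A (\<lambda>x. \<mu> (Suc x)))) R)"
    "edef s (\<lambda>A \<mu>. [\<mu> 0, \<mu> (Suc 0)] \<in> rel (only_struct V (G A (\<lambda>x. \<mu> (Suc (Suc x))))) R)"
    by (cases "V R = Some 0"; simp add: only_struct_def; intro edef_ex U edef_rules eint_shift[OF G] eset_univ[OF G])+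
qed

lemma mulf_empty: "mulf V r H {} = \<lparr>univ = {r}, rel = (\<lambda>_. {})\<rparr>"
  by (auto simp: mulf_def fun_eq_iff split: sym.split)

lemma eint_exI:
  assumes "eint s G'" "\<And>A \<mu> v. represents t v (G A \<mu>) \<Longrightarrow> represents u (g v) (G' A \<mu>)"
  shows "\<exists>G'. eint s G' \<and> (\<forall>A \<mu> v w. represents s w A \<longrightarrow> represents t v (G A \<mu>) \<longrightarrow>
    represents u (restrict g (vals t) v) (G' A \<mu>))"
proof (intro exI[of _ G'] conjI allI impI assms(1))
  fix A \<mu> v assume "represents t v (G A \<mu>)"
  then show "represents u (restrict g (vals t) v) (G' A \<mu>)"
    using assms(2) represents_vals by (metis restrict_apply')
qed

text \<open>\<open>G'\<close> has to be definable for all environments, but is claimed to be correct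
  only where \<open>G\<close> represents a value. This permits applying an induction hypothesis to
  \<open>unl\<close> of a right injection, or to the block of an element that is no root.\<close>

lemma derivable_eint:
  "derivable t u g \<Longrightarrow> eint s G \<Longrightarrow> \<exists>G'. eint s G' \<and>
    (\<forall>A \<mu> v w. represents s w A \<longrightarrow> represents t v (G A \<mu>) \<longrightarrow> represents u (g v) (G' A \<mu>))"
proof (induction arbitrary: G rule: derivable.induct)
  case (derivable_union t)
  show ?case by (rule eint_exI[OF eint_union[OF derivable_union] represents_union])
next
  case (derivable_add t)
  show ?case by (rule eint_exI[OF eint_add[OF derivable_add] represents_add])
next
  case (derivable_choices t)
  \<comment> \<open>Place 0 holds the root of the chosen class. Every choice carries its own copy of
    the class and of the remaining multiset, and the tag in \<open>K'\<close> keeps these copies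
    disjoint.\<close>
  define K where "K A \<mu> = prod_struct (block (voc t) (clean (G A (\<lambda>x. \<mu> (Suc x)))) (\<mu> 0)) (rest (G A (\<lambda>x. \<mu> (Suc x))) (\<mu> 0))" for A \<mu>
  define K' where "K' A \<mu> = map_struct (pair_elem (\<mu> 0)) (clean (K A \<mu>))" for A \<mu>
  have "eint s K" unfolding K_def
    by (intro eint_prod eint_block eint_rest eint_shift[OF derivable_choices] eterm_var)
  then have "eint s K'" unfolding K'_def by (intro eint_pair_elem eterm_var)
  then have "eint s (\<lambda>A \<mu>. mulf (voc (TProd t (TMul t))) (0, []) (\<lambda>c. K' A (case_nat c \<mu>)) (roots t (clean (G A \<mu>))))"
    by (intro eint_mulf eset_roots derivable_choices eterm_const)
  moreover have "represents (TMul (TProd t (TMul t))) (restrict choices_fn (vals (TMul t)) v)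
      (mulf (voc (TProd t (TMul t))) (0, []) (\<lambda>c. K' A (case_nat c \<mu>)) (roots t (clean (G A \<mu>))))"
    if B: "represents (TMul t) v (G A \<mu>)" for A \<mu> v
  proof -
    let ?B = "G A \<mu>"
    let ?b = "\<lambda>c. val_of t (block (voc t) ?B c)"
    let ?val = "\<lambda>c. VPair (?b c) (VMul (elems v - {#?b c#}))"
    obtain r where C: "finite (roots t ?B)" "\<And>c. c \<in> roots t ?B \<Longrightarrow> represents t (?b c) (block (voc t) ?B c)"
      "\<And>c. c \<in> roots t ?B \<Longrightarrow> c \<in> univ (block (voc t) ?B c)"
      "v = VMul (\<Sum>c\<in>roots t ?B. {#?b c#})"
      using represents_Mul_roots[OF B] by (metis (no_types, lifting))
    have K: "K A (case_nat c \<mu>) = prod_struct (block (voc t) ?B c) (rest ?B c)" for c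
      by (simp add: K_def clean_eq[OF B])
    have "represents (TProd t (TMul t)) (?val c) (K A (case_nat c \<mu>))" if c: "c \<in> roots t ?B" for c
      unfolding K using C(2)[OF c] represents_Mul_elem(2)[OF B c C(3)[OF c]]
      by (intro represents_Pair) (auto simp: univ_block univ_rest)
    from represents_mulf_pair[OF C(1) this]
    have "represents (TMul (TProd t (TMul t))) (VMul (\<Sum>c\<in>roots t ?B. {#?val c#}))
      (mulf (voc (TProd t (TMul t))) (0, []) (\<lambda>c. K' A (case_nat c \<mu>)) (roots t (clean ?B)))"
      by (simp add: K'_def clean_eq[OF B] del: voc.simps)
    moreover have "choices_fn v = VMul (\<Sum>c\<in>roots t ?B. {#?val c#})"
    proof -
      have "choices_fn v = VMul (image_mset (\<lambda>a. VPair a (VMul (elems v - {#a#}))) (elems v))"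
        by (simp add: choices_fn_def)
      also have "elems v = (\<Sum>c\<in>roots t ?B. {#?b c#})" by (simp add: C(4))
      finally show ?thesis by (simp add: image_mset_sum_single C(4))
    qed
    ultimately show ?thesis using represents_vals[OF B] by (simp del: vals.simps voc.simps)
  qed
  ultimately show ?case by (intro exI conjI allI impI)
next
  case (derivable_de_singleton t)
  \<comment> \<open>There is exactly one root, that is, exactly one class.\<close>
  define P where "P A \<mu> \<longleftrightarrow> (\<exists>c \<in> roots t (clean (G A \<mu>)). \<forall>d \<in> roots t (clean (G A \<mu>)). d = c)" for A \<mu>
  define G' where "G' A \<mu> = (if P A \<mu> then inr_struct (only_struct (voc t) (G A \<mu>))
    else inl_struct \<lparr>univ = {(0, [])}, rel = (\<lambda>_. {})\<rparr>)" for A \<mu>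
  note C = eset_roots[OF derivable_de_singleton, of t]
  have "edef s P" unfolding P_def
    by (intro edef_ex edef_all C eset_shift[OF C] edef_eq eterm_var)
  then have "eint s G'" unfolding G'_def
    by (intro eint_if eint_inr eint_inl eint_only derivable_de_singleton eint_point)
  moreover have "represents (TSum TOne t) (restrict de_singleton_fn (vals (TMul t)) v) (G' A \<mu>)"
    if B: "represents (TMul t) v (G A \<mu>)" for A \<mu> v
  proof (cases "P A \<mu>")
    case True
    then obtain c where c: "roots t (G A \<mu>) = {c}" unfolding P_def clean_eq[OF B] by blast
    from represents_only[OF B this] True represents_vals[OF B] show ?thesis
      by (auto simp: G'_def intro: represents_Inr simp del: vals.simps)
  next
    case False
    obtain r where C: "finite (roots t (G A \<mu>))" "v = VMul (\<Sum>c\<in>roots t (G A \<mu>). {#val_of t (block (voc t) (G A \<mu>) c)#})"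
      using represents_Mul_roots[OF B] by (metis (no_types, lifting))
    \<comment> \<open>Isomorphic classes have different roots, so the number of roots is the size of
      the multiset and not just the number of different values in it.\<close>
    have "card (roots t (G A \<mu>)) \<noteq> 1"
      using False unfolding P_def clean_eq[OF B] by (auto simp: card_1_singleton_iff)
    then have "(\<Sum>c\<in>roots t (G A \<mu>). {#val_of t (block (voc t) (G A \<mu>) c)#}) \<noteq> {#a#}" for a
      using size_sum_single[OF C(1), of "\<lambda>c. val_of t (block (voc t) (G A \<mu>) c)"] by (metis size_single)
    then have "de_singleton_fn v = VInl VUnit" by (simp add: C(2))
    with False represents_vals[OF B] show ?thesis
      by (auto simp: G'_def intro: represents_Inl represents_One simp del: vals.simps)
  qed
  ultimately show ?case by (intro exI conjI allI impI)
next
  case derivable_empty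
  have "represents (TMul TOne) (VMul {#}) \<lparr>univ = {r}, rel = (\<lambda>_. {})\<rparr>" for r :: elem
    using represents_mulf[of "{}" TOne "\<lambda>_. undefined" "\<lambda>_. undefined" r]
    by (simp add: mulf_empty disjoint_family_struct_def)
  then show ?case by (intro eint_exI[OF eint_point]) (simp add: empty_fn_def)
next
  case (derivable_id t)
  show ?case by (rule eint_exI[OF derivable_id]) simp
next
  case (derivable_fst t u)
  show ?case
  proof (rule eint_exI[OF eint_fst[OF derivable_fst]])
    fix A \<mu> v assume "represents (TProd t u) v (G A \<mu>)"
    then show "represents t (vfst v) (fst_struct (G A \<mu>))" by (rule represents_ProdD) simp
  qed
next
  case (derivable_snd t u)
  show ?case
  proof (rule eint_exI[OF eint_snd[OF derivable_snd]])
    fix A \<mu> v assume "represents (TProd t u) v (G A \<mu>)"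
    then show "represents u (vsnd v) (snd_struct (G A \<mu>))" by (rule represents_ProdD) simp
  qed
next
  case (derivable_inl t u)
  show ?case by (rule eint_exI[OF eint_inl[OF derivable_inl] represents_SumI(1)])
next
  case (derivable_inr t u)
  show ?case by (rule eint_exI[OF eint_inr[OF derivable_inr] represents_SumI(2)])
next
  case (derivable_dist t1 t2 t3)
  define G' where "G' A \<mu> = (if [] \<in> rel (snd_struct (G A \<mu>)) Fresh
    then inl_struct (prod_struct (fst_struct (G A \<mu>)) (unl (snd_struct (G A \<mu>))))
    else inr_struct (prod_struct (fst_struct (G A \<mu>)) (unr (snd_struct (G A \<mu>)))))" for A \<mu>
  have "eint s G'" unfolding G'_def
    by (intro eint_if edef_rel0 eint_inl eint_inr eint_prod eint_fst eint_snd eint_unl eint_unr derivable_dist)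
  moreover have "represents (TSum (TProd t1 t2) (TProd t1 t3)) (restrict dist_fn (vals (TProd t1 (TSum t2 t3))) v) (G' A \<mu>)"
    if B: "represents (TProd t1 (TSum t2 t3)) v (G A \<mu>)" for A \<mu> v
  proof -
    obtain w w' where w: "v = VPair w w'" "represents t1 w (fst_struct (G A \<mu>))"
      "represents (TSum t2 t3) w' (snd_struct (G A \<mu>))" "univ (fst_struct (G A \<mu>)) \<inter> univ (snd_struct (G A \<mu>)) = {}"
      using B by (rule represents_ProdD)
    from w(3) show ?thesis
    proof (cases rule: represents_SumD)
      case (Inl x)
      have "represents (TSum (TProd t1 t2) (TProd t1 t3)) (VInl (VPair w x)) (G' A \<mu>)"
        using w(2,4) Inl(2,4) unfolding G'_def by (auto intro!: represents_SumI represents_Pair simp del: rel_destr)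
      then show ?thesis using represents_vals[OF B] w(1) Inl(1) by (simp del: vals.simps)
    next
      case (Inr x)
      have "represents (TSum (TProd t1 t2) (TProd t1 t3)) (VInr (VPair w x)) (G' A \<mu>)"
        using w(2,4) Inr(2,4) unfolding G'_def by (auto intro!: represents_SumI represents_Pair simp del: rel_destr)
      then show ?thesis using represents_vals[OF B] w(1) Inr(1) by (simp del: vals.simps)
    qed
  qed
  ultimately show ?case by (intro exI conjI allI impI)
next
  case (derivable_pair t u1 f u2 g)
  obtain G1 where G1: "eint s G1" "\<And>A \<mu> v w. represents s w A \<Longrightarrow> represents t v (G A \<mu>) \<Longrightarrow> represents u1 (f v) (G1 A \<mu>)"
    using derivable_pair.IH(1)[OF derivable_pair.prems] by metis
  obtain G2 where G2: "eint s G2" "\<And>A \<mu> v w. represents s w A \<Longrightarrow> represents t v (G A \<mu>) \<Longrightarrow> represents u2 (g v) (G2 A \<mu>)"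
    using derivable_pair.IH(2)[OF derivable_pair.prems] by metis
  \<comment> \<open>\<open>G1\<close> and \<open>G2\<close> may share elements; the two distinct
    tags make the union disjoint.\<close>
  define G' where "G' A \<mu> = prod_struct (map_struct (pair_elem (0, [])) (clean (G1 A \<mu>)))
    (map_struct (pair_elem (Suc 0, [])) (clean (G2 A \<mu>)))" for A \<mu>
  have "eint s G'" unfolding G'_def
    by (intro eint_prod eint_pair_elem G1(1) G2(1) eterm_const)
  moreover have "represents (TProd u1 u2) ((\<lambda>v\<in>vals t. VPair (f v) (g v)) v) (G' A \<mu>)"
    if A: "represents s w A" and B: "represents t v (G A \<mu>)" for A \<mu> v w
  proof -
    note 1 = G1(2)[OF A B] and 2 = G2(2)[OF A B]
    have "represents u1 (f v) (map_struct (pair_elem (0, [])) (G1 A \<mu>))"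
      by (rule represents_map_struct[OF 1]) (simp add: inj_on_def)
    moreover have "represents u2 (g v) (map_struct (pair_elem (Suc 0, [])) (G2 A \<mu>))"
      by (rule represents_map_struct[OF 2]) (simp add: inj_on_def)
    ultimately have "represents (TProd u1 u2) (VPair (f v) (g v)) (G' A \<mu>)"
      unfolding G'_def clean_eq[OF 1] clean_eq[OF 2] by (rule represents_Pair) (auto simp: map_struct_def)
    then show ?thesis using represents_vals[OF B] by simp
  qed
  ultimately show ?case by (intro exI conjI allI impI)
next
  case (derivable_copair t1 u f t2 g)
  obtain G1 where G1: "eint s G1" "\<And>A \<mu> v w. represents s w A \<Longrightarrow> represents t1 v (unl (G A \<mu>)) \<Longrightarrow> represents u (f v) (G1 A \<mu>)"
    using derivable_copair.IH(1)[OF eint_unl[OF derivable_copair.prems]] by metis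
  obtain G2 where G2: "eint s G2" "\<And>A \<mu> v w. represents s w A \<Longrightarrow> represents t2 v (unr (G A \<mu>)) \<Longrightarrow> represents u (g v) (G2 A \<mu>)"
    using derivable_copair.IH(2)[OF eint_unr[OF derivable_copair.prems]] by metis
  define G' where "G' A \<mu> = (if [] \<in> rel (G A \<mu>) Fresh then G1 A \<mu> else G2 A \<mu>)" for A \<mu>
  have "eint s G'" unfolding G'_def by (intro eint_if edef_rel0 derivable_copair.prems G1(1) G2(1))
  moreover have "represents u (restrict (copair_fn f g) (vals (TSum t1 t2)) v) (G' A \<mu>)"
    if A: "represents s w A" and B: "represents (TSum t1 t2) v (G A \<mu>)" for A \<mu> v w
    using B
  proof (cases rule: represents_SumD)
    case (Inl x)
    show ?thesis using G1(2)[OF A Inl(2)] Inl(1,4) represents_vals[OF B] by (simp add: G'_def del: vals.simps)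
  next
    case (Inr x)
    show ?thesis using G2(2)[OF A Inr(2)] Inr(1,4) represents_vals[OF B] by (simp add: G'_def del: vals.simps)
  qed
  ultimately show ?case by (intro exI conjI allI impI)
next
  case (derivable_map t u f)
  \<comment> \<open>The induction hypothesis is applied to a single class, named by the parameter in
    place 0.\<close>
  have "eint s (\<lambda>A \<mu>. block (voc t) (clean (G A (\<lambda>x. \<mu> (Suc x)))) (\<mu> 0))"
    by (intro eint_block eint_shift[OF derivable_map.prems] eterm_var)
  from derivable_map.IH[OF this] obtain K where K: "eint s K"
    "\<And>A \<mu> v w. represents s w A \<Longrightarrow> represents t v (block (voc t) (clean (G A (\<lambda>x. \<mu> (Suc x)))) (\<mu> 0)) \<Longrightarrow>
      represents u (f v) (K A \<mu>)" by metis
  define K' where "K' A \<mu> = map_struct (pair_elem (\<mu> 0)) (clean (K A \<mu>))" for A \<mu>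
  have "eint s K'" unfolding K'_def by (intro eint_pair_elem eterm_var K(1))
  then have "eint s (\<lambda>A \<mu>. mulf (voc u) (0, []) (\<lambda>c. K' A (case_nat c \<mu>)) (roots t (clean (G A \<mu>))))"
    by (intro eint_mulf eset_roots derivable_map.prems eterm_const)
  moreover have "represents (TMul u) (restrict (map_fn f) (vals (TMul t)) v)
      (mulf (voc u) (0, []) (\<lambda>c. K' A (case_nat c \<mu>)) (roots t (clean (G A \<mu>))))"
    if A: "represents s w A" and B: "represents (TMul t) v (G A \<mu>)" for A \<mu> v w
  proof -
    let ?B = "G A \<mu>"
    let ?b = "\<lambda>c. val_of t (block (voc t) ?B c)"
    obtain r where C: "finite (roots t ?B)" "\<And>c. c \<in> roots t ?B \<Longrightarrow> represents t (?b c) (block (voc t) ?B c)"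
      "v = VMul (\<Sum>c\<in>roots t ?B. {#?b c#})"
      using represents_Mul_roots[OF B] by (metis (no_types, lifting))
    have "represents u (f (?b c)) (K A (case_nat c \<mu>))" if c: "c \<in> roots t ?B" for c
      by (rule K(2)[OF A]) (simp add: clean_eq[OF B] C(2)[OF c])
    from represents_mulf_pair[OF C(1) this]
    have "represents (TMul u) (VMul (\<Sum>c\<in>roots t ?B. {#f (?b c)#}))
      (mulf (voc u) (0, []) (\<lambda>c. K' A (case_nat c \<mu>)) (roots t (clean ?B)))"
      by (simp add: K'_def clean_eq[OF B])
    moreover have "map_fn f v = VMul (\<Sum>c\<in>roots t ?B. {#f (?b c)#})"
      unfolding map_fn_def by (subst C(3)) (simp add: image_mset_sum_single)
    ultimately show ?thesis using represents_vals[OF B] by (simp del: vals.simps)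
  qed
  ultimately show ?case by (intro exI conjI allI impI)
next
  case (derivable_compose t1 t2 f t3 g)
  obtain G1 where G1: "eint s G1" "\<And>A \<mu> v w. represents s w A \<Longrightarrow> represents t1 v (G A \<mu>) \<Longrightarrow> represents t2 (f v) (G1 A \<mu>)"
    using derivable_compose.IH(1)[OF derivable_compose.prems] by metis
  obtain G2 where G2: "eint s G2" "\<And>A \<mu> v w. represents s w A \<Longrightarrow> represents t2 v (G1 A \<mu>) \<Longrightarrow> represents t3 (g v) (G2 A \<mu>)"
    using derivable_compose.IH(2)[OF G1(1)] by metis
  show ?case
    by (rule exI[of _ G2]) (use G1 G2 represents_vals in \<open>fastforce simp: compose_def\<close>)
qed

section \<open>Equivalence of interpretations and derivable functions\<close>

lemma edef_formula:
  assumes "edef s Q"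
  shows "\<exists>\<phi>. formula_in (voc s) (k + l) \<phi> \<and> (\<forall>A u as bs. represents s u A \<longrightarrow> set as \<subseteq> univ A \<longrightarrow> set bs \<subseteq> univ A \<longrightarrow>
    length as = k \<longrightarrow> length bs = l \<longrightarrow>
    (sat_tuple A (as @ bs) \<phi> \<longleftrightarrow> Q A (case_nat (i, as) (case_nat (j, bs) (\<lambda>_. (0, []))))))"
proof -
  define sh where "sh = case_nat (i, k) (case_nat (j, l) (\<lambda>_. (0, 0)))"
  obtain \<phi> where f: "fo_over (voc s) \<phi>" "free_vars \<phi> \<subseteq> slots sh"
    "\<And>A \<mu> u. represents s u A \<Longrightarrow> has_shape (univ A) sh \<mu> \<Longrightarrow> Q A \<mu> \<longleftrightarrow> sat A (flat \<mu>) \<phi>"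
    by (rule fdefE[OF assms[unfolded edef_def, rule_format, of sh]]) (rule that; assumption)
  define \<rho> where "\<rho> v = (let (x, y) = prod_decode v in if x = 0 then y else k + y)" for v
  have r: "\<rho> (prod_encode (0, y)) = y" "\<rho> (prod_encode (Suc x, y)) = k + y" for x y by (simp_all add: \<rho>_def)
  have slot: "(\<exists>y<k. v = prod_encode (0, y)) \<or> (\<exists>y<l. v = prod_encode (Suc 0, y))" if v: "v \<in> slots sh" for v
  proof -
    obtain x y where x: "v = prod_encode (x, y)" "y < snd (sh x)" by (rule slotsE[OF v])
    show ?thesis
    proof (cases x)
      case (Suc x')
      with x show ?thesis by (cases x') (auto simp: sh_def)
    qed (use x in \<open>auto simp: sh_def\<close>)
  qed
  obtain \<phi>' where f': "fo_over (voc s) \<phi>'" "free_vars \<phi>' \<subseteq> \<rho> ` free_vars \<phi>"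
    "\<And>(A :: (sym, nat) struct) \<nu>. sat A \<nu> \<phi>' \<longleftrightarrow> sat A (\<lambda>x. \<nu> (\<rho> x)) \<phi>"
    using fo_rename[of "voc s" \<phi> \<rho>] f(1) by blast
  show ?thesis
  proof (intro exI[of _ \<phi>'] conjI allI impI)
    have "\<rho> v < k + l" if v: "v \<in> slots sh" for v using slot[OF v] by (auto simp: r)
    then show "formula_in (voc s) (k + l) \<phi>'"
      using f'(1,2) f(2) by (fastforce simp: formula_in_def)
    fix A :: "(sym, nat) struct" and u as bs
    assume A: "represents s u A" "set as \<subseteq> univ A" "set bs \<subseteq> univ A" "length as = k" "length bs = l"
    let ?\<mu> = "case_nat (i, as) (case_nat (j, bs) (\<lambda>_. (0, [])))"
    have "has_shape (univ A) sh ?\<mu>"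
      using A by (auto simp: has_shape_def sh_def shape_def split: nat.split)
    then have "Q A ?\<mu> \<longleftrightarrow> sat A (flat ?\<mu>) \<phi>" using f(3) A(1) by blast
    also have "\<dots> \<longleftrightarrow> sat A (\<lambda>x. (as @ bs) ! \<rho> x) \<phi>"
    proof (rule sat_cong)
      fix v assume "v \<in> free_vars \<phi>"
      then have "v \<in> slots sh" using f(2) by blast
      from slot[OF this] show "flat ?\<mu> v = (as @ bs) ! \<rho> v" using A by (auto simp: r nth_append)
    qed
    finally show "sat_tuple A (as @ bs) \<phi>' \<longleftrightarrow> Q A ?\<mu>" by (simp add: sat_tuple_def f'(3))
  qed
qed

abbreviation empty_env :: env where "empty_env \<equiv> \<lambda>_. (0, [])"

lemma case_empty_env: "case_nat (0, []) empty_env = empty_env"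
  by (auto split: nat.split)

lemma length_le_2_cases:
  assumes "length xs \<le> 2"
  obtains "xs = []" | x where "xs = [x]" | x y where "xs = [x, y]"
  using assms by (cases xs; cases "tl xs") (auto simp: le_Suc_eq numeral_2_eq_2)

text \<open>The components of the interpretation are the possible shapes, since a component must
  have a single dimension while an element of \<open>G\<close> may have any of finitely many. One
  formula is chosen for each shape, or list of shapes, in question.\<close>

lemma eint_fo_interpretation:
  assumes f: "f \<in> vals s \<rightarrow>\<^sub>E vals t" and G: "eint s G"
    and rep: "\<And>A u. represents s u A \<Longrightarrow> represents t (f u) (G A empty_env)"
  shows "fo_interpretation s t f"
proof -
  let ?sh = "\<lambda>_ :: nat. (0 :: nat, 0 :: nat)"
  let ?G = "\<lambda>A. G A empty_env"
  obtain S where S: "finite S" "within s ?sh (\<lambda>A \<mu>. univ (G A \<mu>)) S"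
    using eset_univ[OF G] unfolding eset_iff ebound_def by blast
  have "has_shape X ?sh empty_env" for X by (simp add: has_shape_def shape_def)
  note S = S(1) withinD[OF S(2) _ this]
  obtain U where U: "\<And>p. formula_in (voc s) (snd p) (U p)"
    "\<And>p A u as. represents s u A \<Longrightarrow> set as \<subseteq> univ A \<Longrightarrow> length as = snd p \<Longrightarrow>
      sat_tuple A as (U p) \<longleftrightarrow> (fst p, as) \<in> univ (?G A)"
  proof -
    have "edef s (\<lambda>A \<mu>. \<mu> 0 \<in> univ (G A (\<lambda>x. \<mu> (Suc x))))" by (intro edef_univ eint_shift[OF G] eterm_var)
    from edef_formula[OF this, where l = 0 and j = 0]
    have "\<exists>\<phi>. formula_in (voc s) (snd p) \<phi> \<and> (\<forall>A u as. represents s u A \<longrightarrow> set as \<subseteq> univ A \<longrightarrow> length as = snd p \<longrightarrow>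
      (sat_tuple A as \<phi> \<longleftrightarrow> (fst p, as) \<in> univ (?G A)))" for p :: "nat \<times> nat"
      by (simp add: case_empty_env)
    then show ?thesis using that by metis
  qed
  obtain R0 where R0: "\<And>R. formula_in (voc s) 0 (R0 R)"
    "\<And>R A u. represents s u A \<Longrightarrow> sat_tuple A [] (R0 R) \<longleftrightarrow> [] \<in> rel (?G A) R"
  proof -
    have "\<exists>\<phi>. formula_in (voc s) 0 \<phi> \<and> (\<forall>A u. represents s u A \<longrightarrow> (sat_tuple A [] \<phi> \<longleftrightarrow> [] \<in> rel (?G A) R))" for R
      using edef_formula[OF edef_rel0[OF G, of R], where l = 0 and j = 0 and k = 0 and i = 0]
      by (simp add: case_empty_env)
    then show ?thesis using that by metis
  qed
  \<comment> \<open>With \<open>l = 0\<close> the second tuple in \<open>edef_formula\<close> is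
    empty and merges with the empty environment, so a formula about a single tuple results.\<close>
  define \<Phi>1 where "\<Phi>1 R p \<phi> \<longleftrightarrow> formula_in (voc s) (snd p) \<phi> \<and> (\<forall>A u as. represents s u A \<longrightarrow> set as \<subseteq> univ A \<longrightarrow>
    length as = snd p \<longrightarrow> (sat_tuple A as \<phi> \<longleftrightarrow> [(fst p, as)] \<in> rel (?G A) R))" for R and p :: "nat \<times> nat" and \<phi>
  define R1 where "R1 R p = (SOME \<phi>. \<Phi>1 R p \<phi>)" for R p
  have "\<Phi>1 R p (R1 R p)" for R p
  proof -
    have e: "edef s (\<lambda>A \<mu>. [\<mu> 0] \<in> rel (G A (\<lambda>x. \<mu> (Suc x))) R)" by (intro edef_rel1 eint_shift[OF G] eterm_var)
    have "\<exists>\<phi>. \<Phi>1 R p \<phi>"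
      using edef_formula[OF e, where l = 0 and j = 0 and k = "snd p" and i = "fst p"]
      by (simp add: case_empty_env \<Phi>1_def)
    then show ?thesis unfolding R1_def by (rule someI_ex)
  qed
  then have R1: "\<And>R p. formula_in (voc s) (snd p) (R1 R p)"
    "\<And>R p A u as. represents s u A \<Longrightarrow> set as \<subseteq> univ A \<Longrightarrow> length as = snd p \<Longrightarrow>
      sat_tuple A as (R1 R p) \<longleftrightarrow> [(fst p, as)] \<in> rel (?G A) R"
    unfolding \<Phi>1_def by blast+
  define \<Phi>2 where "\<Phi>2 R p q \<phi> \<longleftrightarrow> formula_in (voc s) (snd p + snd q) \<phi> \<and> (\<forall>A u as bs. represents s u A \<longrightarrow>
    set as \<subseteq> univ A \<longrightarrow> set bs \<subseteq> univ A \<longrightarrow> length as = snd p \<longrightarrow> length bs = snd q \<longrightarrow>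
    (sat_tuple A (as @ bs) \<phi> \<longleftrightarrow> [(fst p, as), (fst q, bs)] \<in> rel (?G A) R))" for R and p q :: "nat \<times> nat" and \<phi>
  define R2 where "R2 R p q = (SOME \<phi>. \<Phi>2 R p q \<phi>)" for R p q
  have "\<Phi>2 R p q (R2 R p q)" for R p q
  proof -
    have e: "edef s (\<lambda>A \<mu>. [\<mu> 0, \<mu> (Suc 0)] \<in> rel (G A (\<lambda>x. \<mu> (Suc (Suc x)))) R)"
      by (intro edef_rel2 eint_shift[OF G] eterm_var)
    have "\<exists>\<phi>. \<Phi>2 R p q \<phi>"
      using edef_formula[OF e, where l = "snd q" and j = "fst q" and k = "snd p" and i = "fst p"]
      by (simp add: \<Phi>2_def)
    then show ?thesis unfolding R2_def by (rule someI_ex)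
  qed
  then have R2: "\<And>R p q. formula_in (voc s) (snd p + snd q) (R2 R p q)"
    "\<And>R p q A u as bs. represents s u A \<Longrightarrow> set as \<subseteq> univ A \<Longrightarrow> set bs \<subseteq> univ A \<Longrightarrow> length as = snd p \<Longrightarrow>
      length bs = snd q \<Longrightarrow> sat_tuple A (as @ bs) (R2 R p q) \<longleftrightarrow> [(fst p, as), (fst q, bs)] \<in> rel (?G A) R"
    unfolding \<Phi>2_def by blast+
  define J where "J = \<lparr>comps = prod_encode ` S, dim = (\<lambda>c. snd (prod_decode c)), ufml = (\<lambda>c. U (prod_decode c)),
    rfml = (\<lambda>R cs. case map prod_decode cs of [] \<Rightarrow> R0 R | [p] \<Rightarrow> R1 R p | [p, q] \<Rightarrow> R2 R p q | _ \<Rightarrow> FFalse)\<rparr>"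
  \<comment> \<open>Replaces the component of an element by the code of its shape. It is injective,
    so the interpreted structure is an isomorphic copy of the one given by \<open>G\<close>.\<close>
  define h where "h e = (prod_encode (shape e), snd e)" for e :: elem
  have h_inj: "inj h" by (auto simp: inj_def h_def shape_def prod_eq_iff prod_encode_eq)
  have "interp_over (voc s) (voc t) J"
    unfolding interp_over_def
  proof (intro conjI ballI allI impI)
    show "finite (comps J)" using S(1) by (simp add: J_def)
    show "formula_in (voc s) (dim J c) (ufml J c)" for c using U(1) by (simp add: J_def)
    fix R n and cs :: "nat list" assume R: "voc t R = Some n" "length cs = n"
    then have "length cs \<le> 2" using voc_le_2 by blast
    then show "formula_in (voc s) (sum_list (map (dim J) cs)) (rfml J R cs)"
      by (cases rule: length_le_2_cases) (simp_all add: J_def R0(1) R1(1) R2(1))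
  qed
  moreover have "represents t (f u) (apply_interp (voc t) J A)" if A: "represents s u A" for u and A :: "(sym, nat) struct"
  proof -
    have in_univ: "x \<in> interp_univ J A \<longleftrightarrow> x \<in> h ` univ (?G A)" for x
    proof
      assume "x \<in> interp_univ J A"
      then obtain p as where p: "x = (prod_encode p, as)" "p \<in> S" "set as \<subseteq> univ A" "length as = snd p" "sat_tuple A as (U p)"
        by (auto simp: interp_univ_def J_def subset_eq)
      then have "(fst p, as) \<in> univ (?G A)" using U(2)[OF A] by blast
      moreover have "x = h (fst p, as)" using p by (simp add: h_def shape_def)
      ultimately show "x \<in> h ` univ (?G A)" by blast
    next
      assume "x \<in> h ` univ (?G A)"
      then obtain e where e: "e \<in> univ (?G A)" "x = h e" by blast
      from S(2)[OF A e(1)] have "shape e \<in> S" "set (snd e) \<subseteq> univ A" by auto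
      moreover from this have "sat_tuple A (snd e) (U (shape e))"
        using U(2)[OF A, of "snd e" "shape e"] e(1) by (simp add: shape_def)
      ultimately show "x \<in> interp_univ J A" using e(2) by (auto simp: interp_univ_def J_def h_def shape_def)
    qed
    note repG = rep[OF A]
    have "apply_interp (voc t) J A = map_struct h (?G A)"
    proof (rule struct.equality)
      show "univ (apply_interp (voc t) J A) = univ (map_struct h (?G A))"
        using in_univ by (auto simp: apply_interp_def map_struct_def)
      have main: "sat_tuple A (concat (map snd (map h es))) (rfml J R (map fst (map h es))) \<longleftrightarrow> es \<in> rel (?G A) R"
        if es: "set es \<subseteq> univ (?G A)" "length es \<le> 2" for es R
      proof -
        have e: "set (snd e) \<subseteq> univ A" "length (snd e) = snd (shape e)" "(fst (shape e), snd e) = e" if "e \<in> set es" for e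
          using S(2)[OF A, of e] es(1) that by (auto simp: shape_def)
        from es(2) show ?thesis
        proof (cases rule: length_le_2_cases)
          case 1
          then show ?thesis using R0(2)[OF A] by (simp add: J_def)
        next
          case (2 x)
          then show ?thesis using R1(2)[OF A e(1,2), of x R] e(3)[of x] by (simp add: J_def h_def)
        next
          case (3 x y)
          then show ?thesis using R2(2)[OF A e(1) e(1) e(2) e(2), of x y R] e(3)[of x] e(3)[of y] by (simp add: J_def h_def)
        qed
      qed
      have "xs \<in> rel (apply_interp (voc t) J A) R \<longleftrightarrow> xs \<in> map h ` rel (?G A) R" for xs R
      proof
        assume "xs \<in> rel (apply_interp (voc t) J A) R"
        then have xs: "set xs \<subseteq> interp_univ J A" "voc t R = Some (length xs)"
          "sat_tuple A (concat (map snd xs)) (rfml J R (map fst xs))"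
          by (auto simp: apply_interp_def)
        then have "set xs \<subseteq> h ` univ (?G A)" using in_univ by blast
        then have "xs \<in> map h ` lists (univ (?G A))"
          by (subst lists_image[symmetric]) (simp only: in_lists_conv_set, blast)
        then obtain es where es: "set es \<subseteq> univ (?G A)" "xs = map h es"
          unfolding lists_eq_set by blast
        have "length es \<le> 2" using voc_le_2[OF xs(2)] es(2) by simp
        from main[OF es(1) this, of R] xs(3) es(2) show "xs \<in> map h ` rel (?G A) R" by simp
      next
        assume "xs \<in> map h ` rel (?G A) R"
        then obtain es where es: "es \<in> rel (?G A) R" "xs = map h es" by blast
        from represents_rel[OF repG es(1)] have v: "voc t R = Some (length es)" "set es \<subseteq> univ (?G A)" by auto
        have "\<forall>x \<in> set xs. x \<in> interp_univ J A" unfolding in_univ es(2) using v(2) by (simp add: subset_eq)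
        with main[OF v(2) voc_le_2[OF v(1)], of R] es v
        show "xs \<in> rel (apply_interp (voc t) J A) R" by (simp add: apply_interp_def in_lists_conv_set)
      qed
      then show "rel (apply_interp (voc t) J A) = rel (map_struct h (?G A))"
        by (auto simp: map_struct_def)
    qed simp
    then show ?thesis using represents_map_struct[OF repG inj_on_subset[OF h_inj subset_UNIV]] by simp
  qed
  ultimately show ?thesis using f unfolding fo_interpretation_def by blast
qed

text \<open>The starting point for \<open>derivable_eint\<close>: a copy of the input in which an
  element is a tuple of length one in component 0.\<close>

lemma eint_identity: "eint s (\<lambda>A \<mu>. map_struct (\<lambda>a. (0, [a])) A)"
proof (rule eintI)
  have shape1: "shape e = (0, Suc 0) \<longleftrightarrow> (\<exists>a. e = (0, [a]))" for e :: elem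
    by (cases e) (auto simp: shape_def length_Suc_conv)
  let ?G = "\<lambda>A \<mu>. map_struct (\<lambda>a. (0, [a])) A :: (sym, elem) struct"
  have "ebound s (\<lambda>A \<mu>. univ (?G A \<mu>))"
    unfolding ebound_def
    by (intro allI exI[of _ "{(0, Suc 0)}"] conjI withinI) (auto simp: map_struct_def shape_def)
  moreover have "edef s (\<lambda>A \<mu>. \<mu> 0 \<in> univ (?G A (\<lambda>x. \<mu> (Suc x))))"
  proof (rule edef_cong[OF edef_shape_const[of s "\<lambda>sh. sh 0 = (0, Suc 0)"]])
    fix A :: "(sym, nat) struct" and \<mu> :: env assume "\<And>x. set (snd (\<mu> x)) \<subseteq> univ A"
    from this[of 0] show "shape (\<mu> 0) = (0, Suc 0) \<longleftrightarrow> \<mu> 0 \<in> univ (?G A (\<lambda>x. \<mu> (Suc x)))"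
      unfolding shape1 by (auto simp: map_struct_def)
  qed
  ultimately show "eset s (\<lambda>A \<mu>. univ (?G A \<mu>))" by (simp add: eset_iff)
  fix R
  show "edef s (\<lambda>A \<mu>. [] \<in> rel (?G A \<mu>) R)" unfolding edef_def
  proof
    fix sh
    show "fdef s sh (\<lambda>A \<mu>. [] \<in> rel (?G A \<mu>) R)"
    proof (cases "voc s R = Some 0")
      case True
      then show ?thesis by (intro fdefI[of _ "FRel R []"]) (auto simp: map_struct_def)
    next
      case False
      show ?thesis by (rule fdef_cong[OF fdef_const[of s sh False]])
        (use False represents_rel in \<open>fastforce simp: map_struct_def\<close>)
    qed
  qed
  show "edef s (\<lambda>A \<mu>. [\<mu> 0] \<in> rel (?G A (\<lambda>x. \<mu> (Suc x))) R)" unfolding edef_def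
  proof
    fix sh
    have m: "[e] \<in> rel (?G A \<mu>) R \<longleftrightarrow> (\<exists>a. e = (0, [a]) \<and> [a] \<in> rel A R)" for e A \<mu>
      by (auto simp: map_struct_def image_iff Cons_eq_map_conv)
    show "fdef s sh (\<lambda>A \<mu>. [\<mu> 0] \<in> rel (?G A (\<lambda>x. \<mu> (Suc x))) R)"
    proof (cases "voc s R = Some 1 \<and> sh 0 = (0, Suc 0)")
      case True
      show ?thesis
      proof (rule fdefI[of _ "FRel R [prod_encode (0, 0)]"])
        fix A :: "(sym, nat) struct" and \<mu> u assume "has_shape (univ A) sh \<mu>"
        then have "shape (\<mu> 0) = (0, Suc 0)" using True by (simp add: has_shape_def)
        then obtain a where "\<mu> 0 = (0, [a])" unfolding shape1 by blast
        then show "[\<mu> 0] \<in> rel (?G A (\<lambda>x. \<mu> (Suc x))) R \<longleftrightarrow> sat A (flat \<mu>) (FRel R [prod_encode (0, 0)])"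
          unfolding m by simp
      qed (use True in auto)
    next
      case False
      show ?thesis
      proof (rule fdef_cong[OF fdef_const[of s sh False]])
        fix A :: "(sym, nat) struct" and \<mu> u assume A: "represents s u A" "has_shape (univ A) sh \<mu>"
        have "shape (\<mu> 0) = sh 0" using A(2) by (simp add: has_shape_def)
        then show "False \<longleftrightarrow> [\<mu> 0] \<in> rel (?G A (\<lambda>x. \<mu> (Suc x))) R"
          unfolding m using False represents_rel[OF A(1)] by (fastforce simp: shape_def)
      qed
    qed
  qed
  show "edef s (\<lambda>A \<mu>. [\<mu> 0, \<mu> (Suc 0)] \<in> rel (?G A (\<lambda>x. \<mu> (Suc (Suc x)))) R)" unfolding edef_def
  proof
    fix sh
    have m: "[e, e'] \<in> rel (?G A \<mu>) R \<longleftrightarrow> (\<exists>a b. e = (0, [a]) \<and> e' = (0, [b]) \<and> [a, b] \<in> rel A R)" for e e' A \<mu>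
      by (auto simp: map_struct_def image_iff Cons_eq_map_conv)
    show "fdef s sh (\<lambda>A \<mu>. [\<mu> 0, \<mu> (Suc 0)] \<in> rel (?G A (\<lambda>x. \<mu> (Suc (Suc x)))) R)"
    proof (cases "voc s R = Some 2 \<and> sh 0 = (0, Suc 0) \<and> sh (Suc 0) = (0, Suc 0)")
      case True
      show ?thesis
      proof (rule fdefI[of _ "FRel R [prod_encode (0, 0), prod_encode (Suc 0, 0)]"])
        fix A :: "(sym, nat) struct" and \<mu> u assume "has_shape (univ A) sh \<mu>"
        then have "shape (\<mu> 0) = (0, Suc 0)" "shape (\<mu> (Suc 0)) = (0, Suc 0)" using True by (simp_all add: has_shape_def)
        then obtain a b where "\<mu> 0 = (0, [a])" "\<mu> (Suc 0) = (0, [b])" unfolding shape1 by blast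
        then show "[\<mu> 0, \<mu> (Suc 0)] \<in> rel (?G A (\<lambda>x. \<mu> (Suc (Suc x)))) R \<longleftrightarrow>
            sat A (flat \<mu>) (FRel R [prod_encode (0, 0), prod_encode (Suc 0, 0)])"
          unfolding m by simp
      qed (use True in auto)
    next
      case False
      show ?thesis
      proof (rule fdef_cong[OF fdef_const[of s sh False]])
        fix A :: "(sym, nat) struct" and \<mu> u assume A: "represents s u A" "has_shape (univ A) sh \<mu>"
        have "shape (\<mu> 0) = sh 0" "shape (\<mu> (Suc 0)) = sh (Suc 0)" using A(2) by (simp_all add: has_shape_def)
        then show "False \<longleftrightarrow> [\<mu> 0, \<mu> (Suc 0)] \<in> rel (?G A (\<lambda>x. \<mu> (Suc (Suc x)))) R"
          unfolding m using False represents_rel[OF A(1)] by (fastforce simp: shape_def)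
      qed
    qed
  qed
qed

lemma derivable_fo_interpretation:
  assumes "derivable s t f"
  shows "fo_interpretation s t f"
proof -
  obtain G where G: "eint s G" "\<And>A \<mu> v w. represents s w A \<Longrightarrow>
      represents s v (map_struct (\<lambda>a. (0 :: nat, [a])) A) \<Longrightarrow> represents t (f v) (G A \<mu>)"
    using derivable_eint[OF assms eint_identity] by metis
  show ?thesis
  proof (rule eint_fo_interpretation[OF derivable_vals[OF assms] G(1)])
    fix A :: "(sym, nat) struct" and u assume A: "represents s u A"
    then have "represents s u (map_struct (\<lambda>a. (0 :: nat, [a])) A)"
      by (rule represents_map_struct) (simp add: inj_on_def)
    then show "represents t (f u) (G A empty_env)" using G(2)[OF A] by blast
  qed
qed

section \<open>Given interpretations as definable structures\<close>

lemma edef_sat_tuple: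
  assumes p: "formula_in (voc s) k \<phi>" and t: "eterm t"
  shows "edef s (\<lambda>A \<mu>. length (snd (t \<mu>)) = k \<and> sat_tuple A (snd (t \<mu>)) \<phi>)"
  unfolding edef_def
proof
  fix sh
  obtain c vs where t: "set vs \<subseteq> slots sh" "\<And>\<mu> X. has_shape X sh \<mu> \<Longrightarrow> t \<mu> = (c, map (flat \<mu>) vs)"
    by (rule etermE[OF t, of sh]) (rule that; assumption)
  show "fdef s sh (\<lambda>A \<mu>. length (snd (t \<mu>)) = k \<and> sat_tuple A (snd (t \<mu>)) \<phi>)"
  proof (cases "length vs = k")
    case True
    obtain \<phi>' where f': "fo_over (voc s) \<phi>'" "free_vars \<phi>' \<subseteq> (!) vs ` free_vars \<phi>"
      "\<And>(A :: (sym, nat) struct) \<nu>. sat A \<nu> \<phi>' \<longleftrightarrow> sat A (\<lambda>x. \<nu> (vs ! x)) \<phi>"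
      using fo_rename[of "voc s" \<phi> "(!) vs"] p unfolding formula_in_def by blast
    have fv: "x < length vs" if "x \<in> free_vars \<phi>" for x using that p True by (auto simp: formula_in_def)
    show ?thesis
    proof (rule fdefI[OF f'(1)])
      show "free_vars \<phi>' \<subseteq> slots sh"
      proof
        fix v assume "v \<in> free_vars \<phi>'"
        then obtain x where "x \<in> free_vars \<phi>" "v = vs ! x" using f'(2) by blast
        with fv[of x] t(1) show "v \<in> slots sh" by auto
      qed
      fix A :: "(sym, nat) struct" and \<mu> u assume h: "has_shape (univ A) sh \<mu>"
      have "sat A ((!) (map (flat \<mu>) vs)) \<phi> \<longleftrightarrow> sat A (\<lambda>x. flat \<mu> (vs ! x)) \<phi>"
        by (rule sat_cong) (simp add: fv)
      then show "length (snd (t \<mu>)) = k \<and> sat_tuple A (snd (t \<mu>)) \<phi> \<longleftrightarrow> sat A (flat \<mu>) \<phi>'"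
        using True by (simp add: t(2)[OF h] sat_tuple_def f'(3))
    qed
  next
    case False
    show ?thesis
    proof (rule fdef_cong[OF fdef_const[of s sh False]])
      fix A :: "(sym, nat) struct" and \<mu> u assume h: "has_shape (univ A) sh \<mu>"
      show "False \<longleftrightarrow> length (snd (t \<mu>)) = k \<and> sat_tuple A (snd (t \<mu>)) \<phi>" using False by (simp add: t(2)[OF h])
    qed
  qed
qed

lemma eint_apply_interp:
  assumes J: "interp_over (voc s) (voc t) J"
  shows "eint s (\<lambda>A \<mu>. apply_interp (voc t) J A)"
proof -
  have rf: "formula_in (voc s) (sum_list (map (dim J) cs)) (rfml J R cs)"
    if "voc t R = Some (length cs)" "set cs \<subseteq> comps J" for R cs
    using J that unfolding interp_over_def lists_eq_set by blast
  have U: "edef s (\<lambda>A \<mu>. \<mu> x \<in> interp_univ J A)" for x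
  proof -
    \<comment> \<open>The formula \<open>ufml J i\<close> depends on the component \<open>i\<close>,
      which is part of the shape; with the shape as a separate argument it is fixed, and
      \<open>edef_shape\<close> puts the actual shape back.\<close>
    let ?Q = "\<lambda>(sh :: nat \<Rightarrow> nat \<times> nat) (A :: (sym, nat) struct) (\<mu> :: env). fst (sh x) \<in> comps J \<and>
        (length (snd (\<mu> x)) = dim J (fst (sh x)) \<and> sat_tuple A (snd (\<mu> x)) (ufml J (fst (sh x))))"
      have q: "edef s (?Q sh)" for sh
    proof (cases "fst (sh x) \<in> comps J")
      case True
      then have "formula_in (voc s) (dim J (fst (sh x))) (ufml J (fst (sh x)))" using J by (simp add: interp_over_def)
      from edef_sat_tuple[OF this eterm_var] True show ?thesis by simp
    qed (simp add: edef_const)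
    have "edef s (\<lambda>A \<mu>. ?Q (\<lambda>x. shape (\<mu> x)) A \<mu>)" by (rule edef_shape[of s ?Q]) (rule q)
    then show ?thesis
      by (rule edef_cong) (auto simp: interp_univ_def shape_def case_prod_unfold)
  qed
  show ?thesis
  proof (rule eintI)
    have "ebound s (\<lambda>A \<mu>. interp_univ J A)"
      unfolding ebound_def
      by (intro allI exI[of _ "(\<lambda>i. (i, dim J i)) ` comps J"] conjI withinI)
        (use J in \<open>auto simp: interp_over_def interp_univ_def shape_def\<close>)
    with U show "eset s (\<lambda>A \<mu>. univ (apply_interp (voc t) J A))"
      by (simp add: eset_iff apply_interp_def)
    fix R
    show "edef s (\<lambda>A \<mu>. [] \<in> rel (apply_interp (voc t) J A) R)"
    proof (cases "voc t R = Some 0")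
      case True
      then have "formula_in (voc s) 0 (rfml J R [])" using rf[of R "[]"] by simp
      from edef_sat_tuple[OF this eterm_const[of 0]] True show ?thesis by (simp add: apply_interp_def)
    qed (simp add: apply_interp_def edef_const)
    show "edef s (\<lambda>A \<mu>. [\<mu> 0] \<in> rel (apply_interp (voc t) J A) R)"
    proof (cases "voc t R = Some 1")
      case True
      let ?Q = "\<lambda>(sh :: nat \<Rightarrow> nat \<times> nat) (A :: (sym, nat) struct) (\<mu> :: env). fst (sh 0) \<in> comps J \<and> (length (snd (\<mu> 0)) = dim J (fst (sh 0)) \<and>
          sat_tuple A (snd (\<mu> 0)) (rfml J R [fst (sh 0)]))"
      have q: "edef s (?Q sh)" for sh
      proof (cases "fst (sh 0) \<in> comps J")
        case c: True
        have "formula_in (voc s) (dim J (fst (sh 0))) (rfml J R [fst (sh 0)])"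
          using rf[of R "[fst (sh 0)]"] True c by simp
        from edef_sat_tuple[OF this eterm_var] c show ?thesis by simp
      qed (simp add: edef_const)
      have "edef s (\<lambda>A \<mu>. ?Q (\<lambda>x. shape (\<mu> x)) A \<mu>)" by (rule edef_shape[of s ?Q]) (rule q)
      from edef_conj[OF U[of 0] this] show ?thesis
        by (rule edef_cong) (use True in \<open>auto simp: apply_interp_def interp_univ_def shape_def\<close>)
    qed (simp add: apply_interp_def edef_const)
    show "edef s (\<lambda>A \<mu>. [\<mu> 0, \<mu> (Suc 0)] \<in> rel (apply_interp (voc t) J A) R)"
    proof (cases "voc t R = Some 2")
      case True
      let ?Q = "\<lambda>(sh :: nat \<Rightarrow> nat \<times> nat) (A :: (sym, nat) struct) (\<mu> :: env). (fst (sh 0) \<in> comps J \<and> fst (sh (Suc 0)) \<in> comps J) \<and>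
          (length (snd (\<mu> 0) @ snd (\<mu> (Suc 0))) = dim J (fst (sh 0)) + dim J (fst (sh (Suc 0))) \<and>
          sat_tuple A (snd (\<mu> 0) @ snd (\<mu> (Suc 0))) (rfml J R [fst (sh 0), fst (sh (Suc 0))]))"
      have q: "edef s (?Q sh)" for sh
      proof (cases "fst (sh 0) \<in> comps J \<and> fst (sh (Suc 0)) \<in> comps J")
        case c: True
        have "formula_in (voc s) (dim J (fst (sh 0)) + dim J (fst (sh (Suc 0)))) (rfml J R [fst (sh 0), fst (sh (Suc 0))])"
          using rf[of R "[fst (sh 0), fst (sh (Suc 0))]"] True c by (simp add: numeral_2_eq_2)
        \<comment> \<open>The concatenation of the two tuples is treated as one term; only its
          entries matter here, so its component is set to 0.\<close>
        from edef_sat_tuple[OF this eterm_append[OF eterm_var[of 0] eterm_var[of "Suc 0"], of "\<lambda>_ _. 0"]] c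
        show ?thesis by simp
      next
        case False
        then have "?Q sh = (\<lambda>A \<mu>. False)" by auto
        then show ?thesis by (simp only: edef_const)
      qed
      have "edef s (\<lambda>A \<mu>. ?Q (\<lambda>x. shape (\<mu> x)) A \<mu>)" by (rule edef_shape[of s ?Q]) (rule q)
      from edef_conj[OF U[of 0] edef_conj[OF U[of "Suc 0"] this]] show ?thesis
        by (rule edef_cong) (use True in \<open>auto simp: apply_interp_def interp_univ_def shape_def\<close>)
    qed (simp add: apply_interp_def edef_const numeral_2_eq_2)
  qed
qed

section \<open>Computing output values by derivable functions\<close>

text \<open>The parameters \<open>\<mu>\<close> are passed to a derivable function as distinguished
  elements of the input: \<open>p\<close> is the list of these points, and \<open>pos\<close> tells
  where the entry belonging to a slot is found.\<close>

definition encodes :: "mty \<Rightarrow> (nat \<Rightarrow> nat \<times> nat) \<Rightarrow> nat \<Rightarrow> (nat \<Rightarrow> nat) \<Rightarrow> (sym, nat) struct \<Rightarrow> env \<Rightarrow> nat list \<Rightarrow> bool" where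
  "encodes s sh m pos A \<mu> p \<longleftrightarrow> (\<exists>u. represents s u A) \<and> has_shape (univ A) sh \<mu> \<and> set p \<subseteq> univ A \<and> length p = m \<and>
     (\<forall>x \<in> slots sh. p ! pos x = flat \<mu> x)"

definition decides :: "mty \<Rightarrow> (nat \<Rightarrow> nat \<times> nat) \<Rightarrow> nat \<Rightarrow> (nat \<Rightarrow> nat) \<Rightarrow>
    ((sym, nat) struct \<Rightarrow> env \<Rightarrow> bool) \<Rightarrow> (val \<Rightarrow> bool) \<Rightarrow> bool" where
  "decides s sh m pos Q P \<longleftrightarrow> dvp (dtys m s) P \<and> (\<forall>A \<mu> p. encodes s sh m pos A \<mu> p \<longrightarrow>
    (P (val_of (dtys m s) (dstructs p s A)) \<longleftrightarrow> Q A \<mu>))"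

text \<open>Nothing is demanded where \<open>G A \<mu>\<close> represents no value of type
  \<open>t\<close>. So in the case of a sum both branches can be computed, although only one of them
  is meaningful.\<close>

definition computes :: "mty \<Rightarrow> (nat \<Rightarrow> nat \<times> nat) \<Rightarrow> nat \<Rightarrow> (nat \<Rightarrow> nat) \<Rightarrow> mty \<Rightarrow>
    ((sym, nat) struct \<Rightarrow> env \<Rightarrow> (sym, elem) struct) \<Rightarrow> (val \<Rightarrow> val) \<Rightarrow> bool" where
  "computes s sh m pos t G g \<longleftrightarrow> dv (dtys m s) t g \<and> (\<forall>A \<mu> p v. encodes s sh m pos A \<mu> p \<longrightarrow>
    represents t v (G A \<mu>) \<longrightarrow> g (val_of (dtys m s) (dstructs p s A)) = v)"

lemma decidesD: "decides s sh m pos Q P \<Longrightarrow> dvp (dtys m s) P"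
  "decides s sh m pos Q P \<Longrightarrow> encodes s sh m pos A \<mu> p \<Longrightarrow>
    P (val_of (dtys m s) (dstructs p s A)) \<longleftrightarrow> Q A \<mu>"
  by (simp_all add: decides_def)

lemma computesD: "computes s sh m pos t G g \<Longrightarrow> dv (dtys m s) t g"
  "computes s sh m pos t G g \<Longrightarrow> encodes s sh m pos A \<mu> p \<Longrightarrow> represents t v (G A \<mu>) \<Longrightarrow>
    g (val_of (dtys m s) (dstructs p s A)) = v"
  by (simp_all add: computes_def)

lemma decides_exists:
  assumes "edef s Q" "\<And>x. x \<in> slots sh \<Longrightarrow> pos x < m"
  shows "\<exists>P. decides s sh m pos Q P"
proof -
  obtain \<phi> where f: "fo_over (voc s) \<phi>" "free_vars \<phi> \<subseteq> slots sh"
    "\<And>A \<mu> u. represents s u A \<Longrightarrow> has_shape (univ A) sh \<mu> \<Longrightarrow> Q A \<mu> \<longleftrightarrow> sat A (flat \<mu>) \<phi>"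
    by (rule fdefE[OF assms(1)[unfolded edef_def, rule_format, of sh]]) (rule that; assumption)
  have "pos x < m" if "x \<in> free_vars \<phi>" for x using that assms(2) f(2) by blast
  from dvp_formula[of s \<phi> pos m, OF f(1) this] obtain P where P: "dvp (dtys m s) P"
    "\<And>v (A :: (sym, nat) struct) as. represents s v A \<Longrightarrow> set as \<subseteq> univ A \<Longrightarrow> length as = m \<Longrightarrow>
      P (val_of (dtys m s) (dstructs as s A)) \<longleftrightarrow> sat A (\<lambda>x. as ! pos x) \<phi>" by blast
  show ?thesis unfolding decides_def
  proof (intro exI[of _ P] conjI allI impI P(1))
    fix A \<mu> p assume "encodes s sh m pos A \<mu> p"
    then obtain u where A: "represents s u A" "has_shape (univ A) sh \<mu>" "set p \<subseteq> univ A" "length p = m"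
      "\<And>x. x \<in> slots sh \<Longrightarrow> p ! pos x = flat \<mu> x" unfolding encodes_def by blast
    have "sat A (\<lambda>x. p ! pos x) \<phi> \<longleftrightarrow> sat A (flat \<mu>) \<phi>"
      by (rule sat_cong) (use A(5) f(2) in blast)
    then show "P (val_of (dtys m s) (dstructs p s A)) \<longleftrightarrow> Q A \<mu>" using P(2)[OF A(1,3,4)] f(3)[OF A(1,2)] by simp
  qed
qed

lemma filter_mset_sum_single:
  "finite X \<Longrightarrow> filter_mset P (\<Sum>a\<in>X. {#h a#}) = (\<Sum>a\<in>{a \<in> X. P (h a)}. {#h a#})"
proof (induction X rule: finite_induct)
  case (insert x X)
  have "{a \<in> insert x X. P (h a)} = (if P (h x) then insert x {a \<in> X. P (h a)} else {a \<in> X. P (h a)})" by auto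
  with insert show ?case by simp
qed simp

text \<open>For sums and products the factors are reducts of \<open>G\<close> with the same
  parameters. For a multiset the root of a class becomes a new parameter of the class, which is why
  \<open>sh\<close>, \<open>pos\<close> and \<open>m\<close> are generalised.\<close>

lemma computes_exists:
  assumes "eint s G" "\<And>x. x \<in> slots sh \<Longrightarrow> pos x < m"
  shows "\<exists>g. computes s sh m pos t G g"
  using assms
proof (induction t arbitrary: G sh pos m)
  case TOne
  show ?case unfolding computes_def
    by (intro exI[of _ "\<lambda>_. VUnit"]) (auto simp: dv_terminal dest: represents_OneD)
next
  case (TSum t1 t2)
  obtain g1 where g1: "computes s sh m pos t1 (\<lambda>A \<mu>. unl (G A \<mu>)) g1"
    using TSum.IH(1)[OF eint_unl[OF TSum.prems(1)] TSum.prems(2)] ..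
  obtain g2 where g2: "computes s sh m pos t2 (\<lambda>A \<mu>. unr (G A \<mu>)) g2"
    using TSum.IH(2)[OF eint_unr[OF TSum.prems(1)] TSum.prems(2)] ..
  obtain P where P: "decides s sh m pos (\<lambda>A \<mu>. [] \<in> rel (G A \<mu>) Fresh) P"
    using decides_exists[OF edef_rel0[OF TSum.prems(1)] TSum.prems(2)] ..
  show ?case unfolding computes_def
  proof (intro exI[of _ "\<lambda>w. if P w then VInl (g1 w) else VInr (g2 w)"] conjI allI impI)
    show "dv (dtys m s) (TSum t1 t2) (\<lambda>w. if P w then VInl (g1 w) else VInr (g2 w))"
      by (intro dv_if dv_inl dv_inr decidesD(1)[OF P] computesD(1)[OF g1] computesD(1)[OF g2])
    fix A \<mu> p v assume e: "encodes s sh m pos A \<mu> p" and r: "represents (TSum t1 t2) v (G A \<mu>)"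
    let ?w = "val_of (dtys m s) (dstructs p s A)"
    from r show "(if P ?w then VInl (g1 ?w) else VInr (g2 ?w)) = v"
    proof (cases rule: represents_SumD)
      case (Inl x)
      show ?thesis using computesD(2)[OF g1 e Inl(2)] decidesD(2)[OF P e] Inl(1,4) by simp
    next
      case (Inr x)
      show ?thesis using computesD(2)[OF g2 e Inr(2)] decidesD(2)[OF P e] Inr(1,4) by simp
    qed
  qed
next
  case (TProd t1 t2)
  obtain g1 where g1: "computes s sh m pos t1 (\<lambda>A \<mu>. fst_struct (G A \<mu>)) g1"
    using TProd.IH(1)[OF eint_fst[OF TProd.prems(1)] TProd.prems(2)] ..
  obtain g2 where g2: "computes s sh m pos t2 (\<lambda>A \<mu>. snd_struct (G A \<mu>)) g2"
    using TProd.IH(2)[OF eint_snd[OF TProd.prems(1)] TProd.prems(2)] ..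
  show ?case unfolding computes_def
  proof (intro exI[of _ "\<lambda>w. VPair (g1 w) (g2 w)"] conjI allI impI)
    show "dv (dtys m s) (TProd t1 t2) (\<lambda>w. VPair (g1 w) (g2 w))"
      by (intro dv_pair computesD(1)[OF g1] computesD(1)[OF g2])
    fix A \<mu> p v assume e: "encodes s sh m pos A \<mu> p" and r: "represents (TProd t1 t2) v (G A \<mu>)"
    obtain w w' where w: "v = VPair w w'" "represents t1 w (fst_struct (G A \<mu>))" "represents t2 w' (snd_struct (G A \<mu>))"
      by (rule represents_ProdD[OF r])
    show "VPair (g1 (val_of (dtys m s) (dstructs p s A))) (g2 (val_of (dtys m s) (dstructs p s A))) = v"
      using computesD(2)[OF g1 e w(2)] computesD(2)[OF g2 e w(3)] w(1) by simp
  qed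
next
  case (TMul t)
  let ?C = "\<lambda>A \<mu>. roots t (clean (G A \<mu>))"
  note C = eset_roots[OF TMul.prems(1), of t]
  obtain S where S: "finite S" "within s sh ?C S" using C unfolding eset_iff ebound_def by blast
  define K where "K A \<mu> = block (voc t) (clean (G A (\<lambda>x. \<mu> (Suc x)))) (\<mu> 0)" for A \<mu>
  have K: "eint s K" unfolding K_def by (intro eint_block eint_shift[OF TMul.prems(1)] eterm_var)
  \<comment> \<open>The entries of the new parameter are appended behind the \<open>m\<close> old
    points, so place 0 is found from position \<open>m\<close> on, and the old places keep their
    positions.\<close>
  define pos' where "pos' x = (let (y, j) = prod_decode x in if y = 0 then m + j else pos (prod_encode (y - 1, j)))" for x
  have pos'_simps: "pos' (prod_encode (0, j)) = m + j" "pos' (prod_encode (Suc y, j)) = pos (prod_encode (y, j))" for y j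
    by (simp_all add: pos'_def)
  have pos': "pos' x < m + snd q" if x: "x \<in> slots (case_nat q sh)" for x q
  proof -
    obtain y j where y: "x = prod_encode (y, j)" "j < snd (case_nat q sh y)" by (rule slotsE[OF x])
    show ?thesis
    proof (cases y)
      case (Suc y')
      then have "pos (prod_encode (y', j)) < m" using y TMul.prems(2) by simp
      then show ?thesis using y Suc by (simp add: pos'_simps)
    qed (use y in \<open>simp add: pos'_simps\<close>)
  qed
  have "\<forall>q. \<exists>g. computes s (case_nat q sh) (m + snd q) pos' t K g"
    by (intro allI TMul.IH[OF K] pos')
  from choice[OF this] obtain g where "\<forall>q. computes s (case_nat q sh) (m + snd q) pos' t K (g q)" ..
  note g = computesD[OF this[rule_format]]
  have "edef s (\<lambda>A \<mu>. \<mu> 0 \<in> ?C A (\<lambda>x. \<mu> (Suc x)))" using C by (simp add: eset_iff)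
  then have "\<forall>q. \<exists>P. decides s (case_nat q sh) (m + snd q) pos' (\<lambda>A \<mu>. \<mu> 0 \<in> ?C A (\<lambda>x. \<mu> (Suc x))) P"
    by (intro allI decides_exists pos')
  from choice[OF this] obtain P where
    "\<forall>q. decides s (case_nat q sh) (m + snd q) pos' (\<lambda>A \<mu>. \<mu> 0 \<in> ?C A (\<lambda>x. \<mu> (Suc x))) (P q)" ..
  note P = decidesD[OF this[rule_format]]
  let ?L = "\<lambda>A k. {as. set as \<subseteq> univ A \<and> length as = k}"
  have "\<forall>k. \<exists>h. dv (dtys m s) (TMul (dtys k (dtys m s))) (\<lambda>v. VMul (h v)) \<and>
    (\<forall>v (A :: (sym, nat) struct). represents (dtys m s) v A \<longrightarrow>
      h v = (\<Sum>as\<in>?L A k. {#val_of (dtys k (dtys m s)) (dstructs as (dtys m s) A)#}))"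
    by (intro allI dv_tuples)
  from choice[OF this] obtain h where h': "\<forall>k. dv (dtys m s) (TMul (dtys k (dtys m s))) (\<lambda>v. VMul (h k v)) \<and>
    (\<forall>v (A :: (sym, nat) struct). represents (dtys m s) v A \<longrightarrow>
      h k v = (\<Sum>as\<in>?L A k. {#val_of (dtys k (dtys m s)) (dstructs as (dtys m s) A)#}))" ..
  have h: "dv (dtys m s) (TMul (dtys (m + k) s)) (\<lambda>v. VMul (h k v))" "\<And>v (A :: (sym, nat) struct). represents (dtys m s) v A \<Longrightarrow>
      h k v = (\<Sum>as\<in>?L A k. {#val_of (dtys (m + k) s) (dstructs as (dtys m s) A)#})" for k
    using spec[OF h', of k] unfolding dtys_add by blast+
  \<comment> \<open>The contribution of the roots of shape \<open>q\<close>: all tuples of dimension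
    \<open>snd q\<close> are enumerated as further distinguished points, those that are roots in
    component \<open>fst q\<close> are kept, and each is replaced by the value of its class.\<close>
  define F where "F q w = image_mset (g q) (filter_mset (P q) (h (snd q) w))" for q w
  have "dv (dtys m s) (TMul t) (\<lambda>w. VMul (F q w))" for q
    using dv_comp[OF dv_comp[OF h(1)[of "snd q"] dv_filter[OF P(1)]] dv_map[OF g(1)]] by (simp add: F_def)
  from dv_Sum[OF S(1) this] have "dv (dtys m s) (TMul t) (\<lambda>w. VMul (\<Sum>q\<in>S. F q w))" .
  moreover have "VMul (\<Sum>q\<in>S. F q (val_of (dtys m s) (dstructs p s A))) = v"
    if e: "encodes s sh m pos A \<mu> p" and r: "represents (TMul t) v (G A \<mu>)" for A \<mu> p v
  proof -
    from e obtain u where A: "represents s u A" "has_shape (univ A) sh \<mu>" "set p \<subseteq> univ A" "length p = m"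
      "\<And>x. x \<in> slots sh \<Longrightarrow> p ! pos x = flat \<mu> x" unfolding encodes_def by blast
    let ?B = "dstructs p s A"
    let ?w = "val_of (dtys m s) ?B"
    have B: "univ ?B = univ A" "represents (dtys m s) ?w ?B" using dstructs_represents[OF A(1,3,4)] by auto
    define D where "D = roots t (G A \<mu>)"
    define b where "b c = val_of t (block (voc t) (G A \<mu>) c)" for c
    have D: "finite D" "\<And>c. c \<in> D \<Longrightarrow> represents t (b c) (block (voc t) (G A \<mu>) c)" "v = VMul (\<Sum>c\<in>D. {#b c#})"
      using represents_Mul_roots[OF r] unfolding D_def b_def by (metis (no_types, lifting))+
    have CD: "?C A \<mu> = D" by (simp add: D_def clean_eq[OF r])
    have fin: "finite (?L A k)" for k using represents_finite[OF A(1)] by (rule finite_lists_length_eq)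
    have F: "F q ?w = (\<Sum>as\<in>{as \<in> ?L A (snd q). (fst q, as) \<in> D}. {#b (fst q, as)#})" for q
    proof -
      define x where "x as = val_of (dtys (m + snd q) s) (dstructs (p @ as) s A)" for as
      have hx: "h (snd q) ?w = (\<Sum>as\<in>?L A (snd q). {#x as#})"
        by (simp add: h(2)[OF B(2)] B(1) x_def dstructs_append A(4))
      have enc: "encodes s (case_nat q sh) (m + snd q) pos' A (case_nat (fst q, as) \<mu>) (p @ as)"
        if as: "as \<in> ?L A (snd q)" for as
        unfolding encodes_def
      proof (intro conjI ballI)
        show "\<exists>u. represents s u A" using A(1) by blast
        show "has_shape (univ A) (case_nat q sh) (case_nat (fst q, as) \<mu>)"
          by (rule has_shape_case[OF A(2)]) (use as in \<open>auto simp: shape_def\<close>)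
        show "set (p @ as) \<subseteq> univ A" "length (p @ as) = m + snd q" using as A by auto
        fix z assume z: "z \<in> slots (case_nat q sh)"
        obtain y j where y: "z = prod_encode (y, j)" "j < snd (case_nat q sh y)" by (rule slotsE[OF z])
        show "(p @ as) ! pos' z = flat (case_nat (fst q, as) \<mu>) z"
        proof (cases y)
          case 0
          then show ?thesis using y A(4) by (simp add: pos'_simps nth_append)
        next
          case (Suc y')
          then have sl: "prod_encode (y', j) \<in> slots sh" using y by simp
          from TMul.prems(2)[OF sl] A(5)[OF sl] show ?thesis
            using y Suc A(4) by (simp add: pos'_simps nth_append)
        qed
      qed
      have Px: "P q (x as) \<longleftrightarrow> (fst q, as) \<in> D" if as: "as \<in> ?L A (snd q)" for as
        using P(2)[OF enc[OF as]] CD by (simp add: x_def)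
      have gx: "g q (x as) = b (fst q, as)" if as: "as \<in> ?L A (snd q)" "(fst q, as) \<in> D" for as
        unfolding x_def by (rule g(2)[OF enc[OF as(1)]]) (use D(2)[OF as(2)] in \<open>simp add: K_def clean_eq[OF r]\<close>)
      have "F q ?w = (\<Sum>as\<in>{as \<in> ?L A (snd q). P q (x as)}. {#g q (x as)#})"
        by (simp only: F_def hx filter_mset_sum_single[OF fin] image_mset_sum_single)
      also have "{as \<in> ?L A (snd q). P q (x as)} = {as \<in> ?L A (snd q). (fst q, as) \<in> D}" using Px by blast
      finally show ?thesis using gx by (auto intro!: sum.cong)
    qed
    have "(\<Sum>q\<in>S. F q ?w) = (\<Sum>(q, as)\<in>Sigma S (\<lambda>q. {as \<in> ?L A (snd q). (fst q, as) \<in> D}). {#b (fst q, as)#})"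
      unfolding F
    proof (intro sum.Sigma S(1) ballI)
      show "finite {as \<in> ?L A (snd q). (fst q, as) \<in> D}" for q
        by (rule finite_subset[OF _ fin[of "snd q"]]) blast
    qed
    also have "\<dots> = (\<Sum>c\<in>D. {#b c#})"
    \<comment> \<open>Each root occurs exactly once, namely under its own shape. Hence the
      multiplicities agree with those of the output multiset.\<close>
    proof (rule sum.reindex_bij_witness[of _ "\<lambda>c. (shape c, snd c)" "\<lambda>(q, as). (fst q, as)"])
      fix c assume "c \<in> D"
      with withinD[OF S(2) A(1,2), of c] CD have "shape c \<in> S" "set (snd c) \<subseteq> univ A" by auto
      then show "(shape c, snd c) \<in> Sigma S (\<lambda>q. {as \<in> ?L A (snd q). (fst q, as) \<in> D})"
        using \<open>c \<in> D\<close> by (simp add: shape_def)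
    qed (auto simp: shape_def)
    finally show ?thesis using D(3) by simp
  qed
  ultimately show ?case unfolding computes_def
    by (intro exI[of _ "\<lambda>w. VMul (\<Sum>q\<in>S. F q w)"] conjI allI impI)
qed

text \<open>Without parameters there are no slots and no points, so \<open>computes\<close> speaks
  about \<open>val_of s A\<close> itself, which is \<open>v\<close> for any structure
  \<open>A\<close> that represents \<open>v\<close>.\<close>

lemma fo_interpretation_derivable:
  assumes "fo_interpretation s t f"
  shows "derivable s t f"
proof -
  from assms obtain J where f: "f \<in> vals s \<rightarrow>\<^sub>E vals t" and J: "interp_over (voc s) (voc t) J"
    "\<And>v A. v \<in> vals s \<Longrightarrow> represents s v (A :: (sym, nat) struct) \<Longrightarrow> represents t (f v) (apply_interp (voc t) J A)"
    unfolding fo_interpretation_def by blast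
  let ?sh = "\<lambda>_ :: nat. (0 :: nat, 0 :: nat)"
  have sl: "slots ?sh = {}" by (auto simp: slots_def)
  obtain g where "computes s ?sh 0 id t (\<lambda>A \<mu>. apply_interp (voc t) J A) g"
    using computes_exists[OF eint_apply_interp[OF J(1)], of ?sh id 0] sl by auto
  note g = computesD[OF this]
  have "g v = f v" if v: "v \<in> vals s" for v
  proof -
    obtain A :: "(sym, nat) struct" where A: "represents s v A"
      using represents_exists[OF infinite_UNIV_nat, of v s] v by blast
    have "encodes s ?sh 0 id A (\<lambda>_. (0, [])) []"
      using A sl by (auto simp: encodes_def has_shape_def shape_def)
    from g(2)[OF this J(2)[OF v A]] show ?thesis using val_of_eq[OF A] by simp
  qed
  then have "restrict g (vals s) = f" using f by (auto simp: fun_eq_iff PiE_iff extensional_def)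
  then show ?thesis using g(1) by (simp add: dv_def)
qed

theorem theorem4p11:
  fixes \<Sigma> \<Gamma> :: mty and f :: "val \<Rightarrow> val"
  assumes "f \<in> vals \<Sigma> \<rightarrow>\<^sub>E vals \<Gamma>"
  shows "fo_interpretation \<Sigma> \<Gamma> f \<longleftrightarrow> derivable \<Sigma> \<Gamma> f"
  using fo_interpretation_derivable derivable_fo_interpretation by blast

end
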